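(* Let $n\ge m\ge1$ be integers, $x=(x_1,\dots,x_n)$ and $y=(y_1,\dots,y_m)$. Then $$\mathrm{s}^{\mathrm{CB}}_{u^{n+m}}(x,y;\beta)=\sum_{\lambda\subseteq u^m}\mathrm{s}^{\mathrm{CB}}_{(u^{n-m},\lambda)}(x;\beta)\cdot\mathrm{s}^{\mathrm{CB}}_{\lambda}(y;\beta),\qquad u\in\tfrac12\mathbb{Z}_{\ge0}.$$ In particular, for $\beta=0$ and $\beta=1$: $$\mathrm{sp}^{(2n+2m)}_{u^{n+m}}(x,y)=\sum_{\lambda\subseteq u^m}\mathrm{sp}^{(2n)}_{(u^{n-m},\lambda)}(x)\cdot\mathrm{sp}^{(2m)}_{\lambda}(y),\qquad u\in\mathbb{Z}_{\ge0},$$ $$\mathrm{so}^{(2n+2m+1)}_{u^{n+m}}(x,y)=\sum_{\lambda\subseteq u^m}\mathrm{so}^{(2n+1)}_{(u^{n-m},\lambda)}(x)\cdot\mathrm{so}^{(2m+1)}_{\lambda}(y),\qquad u\in\tfrac12\mathbb{Z}_{\ge0}.$$ Moreover, $$\mathrm{sp}^{(2n+2m+2)}_{u^{n+m+1}}(x,y,s)=s^{-u}\sum_{\lambda\subseteq u^{m+1}}\mathrm{sp}^{(2n+1)}_{(u^{n-m},\lambda)}(x;s)\cdot\mathrm{sp}^{(2m+1)}_{\lambda}(y;s),\qquad u\in\mathbb{Z}_{\ge0},$$ where $s$ is an extra single variable.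
   Context: Partitions: a half-integer is an element of $\frac12+\mathbb{Z}$. A $k$-partition (resp. $k$-half-partition) is a $k$-tuple $\lambda_1\ge\dots\ge\lambda_k\ge0$ of integers (resp. half-integers). $u^k=(u,\dots,u)$ ($k$ times); $(a,b)$ denotes concatenation. A sum over $\lambda\subseteq u^k$ is over all $k$-partitions (if $u$ is an integer) or all $k$-half-partitions (if $u$ is a half-integer) with $\lambda_1\le u$. Arrays: a half-triangular array of height $M$ is $z=(z_{i,j})_{1\le i\le M,\,1\le j\le\lceil i/2\rceil}$; interlacing conditions: $z_{i+1,j+1}\le z_{i,j}\le z_{i+1,j}$, each inequality whenever both entries exist; shape: the last row; $\mathrm{type}(z)_i=\sum_{j=1}^{\lceil i/2\rceil}z_{i,j}-\sum_{j=1}^{\lceil(i-1)/2\rceil}z_{i-1,j}$. A symplectic pattern of height $M$ is a half-triangular array of non-negative integers satisfying the interlacing conditions. For an $n$-partition $\lambda$, $\mathrm{sp}^{(2n)}_\lambda(x_1,\dots,x_n)=\sum_z\prod_{i=1}^nx_i^{\mathrm{type}(z)_{2i}-\mathrm{type}(z)_{2i-1}}$ over symplectic patterns of height $2n$ and shape $\lambda$. For an $(n+1)$-partition $\lambda$, $\mathrm{sp}^{(2n+1)}_\lambda(x_1,\dots,x_n;y)=\sum_z\prod_{i=1}^nx_i^{\mathrm{type}(z)_{2i}-\mathrm{type}(z)_{2i-1}}\,y^{\mathrm{type}(z)_{2n+1}}$ over symplectic patterns of height $2n+1$ and shape $\lambda$. A split orthogonal pattern of height $2n$ is a half-triangular array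 satisfying the interlacing conditions whose odd ends $z_{2i-1,i}$ ($1\le i\le n$) lie in $\frac12\mathbb{Z}_{\ge0}$ and whose other entries lie either all in $\mathbb{Z}_{\ge0}$ or all in $\frac12+\mathbb{Z}_{\ge0}$. If $z_{2n,1}$ is an integer (resp. half-integer), its atypical entries are its half-integer (resp. integer) entries; $|\mathfrak a(z)|$ is their number. For an $n$-partition or $n$-half-partition $\lambda$, $$\mathrm{s}^{\mathrm{CB}}_\lambda(x_1,\dots,x_n;\beta)=\sum_z\beta^{|\mathfrak a(z)|}\prod_{i=1}^nx_i^{\mathrm{type}(z)_{2i}-\mathrm{type}(z)_{2i-1}},\qquad \mathrm{so}^{(2n+1)}_\lambda(x_1,\dots,x_n)=\sum_z\prod_{i=1}^nx_i^{\mathrm{type}(z)_{2i}-\mathrm{type}(z)_{2i-1}},$$ both sums over split orthogonal patterns of height $2n$ and shape $\lambda$ (with $0^0=1$). *)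

theory Defs
  imports Complex_Main "HOL-Library.Poly_Mapping"
begin

text \<open>
  Everything lives in the ring of formal Laurent polynomials with rational exponents, that is, the
  monoid ring of the finitely supported exponent vectors \<open>'v \<Rightarrow>\<^sub>0 rat\<close>. Rational exponents are
  needed because half-integral shapes produce the formal powers \<open>x\<^sub>i\<^sup>a\<close> with \<open>a\<close> a half-integer.
  A tuple of variables \<open>(x\<^sub>1, \<dots>, x\<^sub>n)\<close> is a list of indeterminates, and \<open>x\<^sub>i\<close> is \<open>x ! (i - 1)\<close>.
\<close>

type_synonym ('v, 'a) laurent = "('v \<Rightarrow>\<^sub>0 rat) \<Rightarrow>\<^sub>0 'a"

definition scalar :: "'a::zero \<Rightarrow> ('v, 'a) laurent" where
  "scalar c = Poly_Mapping.single 0 c"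

definition var_pow :: "'v \<Rightarrow> rat \<Rightarrow> ('v, 'a::zero_neq_one) laurent" where
  "var_pow v a = Poly_Mapping.single (Poly_Mapping.single v a) 1"

definition half_ints :: "rat set" where
  "half_ints = {q. q - 1/2 \<in> \<int>}"

definition partitions :: "nat \<Rightarrow> rat list set" where
  "partitions k = {l. length l = k \<and> sorted_wrt (\<ge>) l \<and> (\<forall>a\<in>set l. a \<in> \<int> \<and> 0 \<le> a)}"

definition half_partitions :: "nat \<Rightarrow> rat list set" where
  "half_partitions k = {l. length l = k \<and> sorted_wrt (\<ge>) l \<and> (\<forall>a\<in>set l. a \<in> half_ints \<and> 0 \<le> a)}"

text \<open>The index set of the sum over \<open>\<lambda> \<subseteq> u\<^sup>k\<close>.\<close>

definition parts_in :: "rat \<Rightarrow> nat \<Rightarrow> rat list set" where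
  "parts_in u k =
    {l. (u \<in> \<int> \<and> l \<in> partitions k \<or> u \<in> half_ints \<and> l \<in> half_partitions k) \<and>
        (k > 0 \<longrightarrow> hd l \<le> u)}"


text \<open>
  Row \<open>i\<close> of a half-triangular array has \<open>\<lceil>i/2\<rceil>\<close> entries. Arrays are functions that are forced to
  be 0 outside the index set, so that distinct functions are distinct arrays.
\<close>

definition row_len :: "nat \<Rightarrow> nat" where
  "row_len i = (i + 1) div 2"

definition positions :: "nat \<Rightarrow> (nat \<times> nat) set" where
  "positions M = {(i, j). 1 \<le> i \<and> i \<le> M \<and> 1 \<le> j \<and> j \<le> row_len i}"

definition half_triangular :: "nat \<Rightarrow> (nat \<Rightarrow> nat \<Rightarrow> rat) \<Rightarrow> bool" where
  "half_triangular M z \<longleftrightarrow> (\<forall>i j. (i, j) \<notin> positions M \<longrightarrow> z i j = 0)"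

definition interlacing :: "nat \<Rightarrow> (nat \<Rightarrow> nat \<Rightarrow> rat) \<Rightarrow> bool" where
  "interlacing M z \<longleftrightarrow> (\<forall>i j. (i, j) \<in> positions M \<longrightarrow>
     ((i + 1, j + 1) \<in> positions M \<longrightarrow> z (i + 1) (j + 1) \<le> z i j) \<and>
     ((i + 1, j) \<in> positions M \<longrightarrow> z i j \<le> z (i + 1) j))"

definition shape :: "nat \<Rightarrow> (nat \<Rightarrow> nat \<Rightarrow> rat) \<Rightarrow> rat list" where
  "shape M z = map (z M) [1..<row_len M + 1]"

definition row_type :: "(nat \<Rightarrow> nat \<Rightarrow> rat) \<Rightarrow> nat \<Rightarrow> rat" where
  "row_type z i = (\<Sum>j=1..row_len i. z i j) - (\<Sum>j=1..row_len (i - 1). z (i - 1) j)"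

definition weight :: "'v list \<Rightarrow> (nat \<Rightarrow> nat \<Rightarrow> rat) \<Rightarrow> ('v, 'a::comm_ring_1) laurent" where
  "weight x z = (\<Prod>i=1..length x. var_pow (x ! (i - 1)) (row_type z (2*i) - row_type z (2*i - 1)))"


definition symplectic_pattern :: "nat \<Rightarrow> (nat \<Rightarrow> nat \<Rightarrow> rat) \<Rightarrow> bool" where
  "symplectic_pattern M z \<longleftrightarrow>
     half_triangular M z \<and> interlacing M z \<and> (\<forall>(i, j)\<in>positions M. z i j \<in> \<nat>)"

definition sp_even :: "rat list \<Rightarrow> 'v list \<Rightarrow> ('v, 'a::comm_ring_1) laurent" where
  "sp_even l x =
    (\<Sum>z | symplectic_pattern (2 * length x) z \<and> shape (2 * length x) z = l. weight x z)"

definition sp_odd :: "rat list \<Rightarrow> 'v list \<Rightarrow> 'v \<Rightarrow> ('v, 'a::comm_ring_1) laurent" where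
  "sp_odd l x y =
    (\<Sum>z | symplectic_pattern (2 * length x + 1) z \<and> shape (2 * length x + 1) z = l.
       weight x z * var_pow y (row_type z (2 * length x + 1)))"


definition odd_ends :: "nat \<Rightarrow> (nat \<times> nat) set" where
  "odd_ends n = {(2*i - 1, i) | i. 1 \<le> i \<and> i \<le> n}"

definition split_orthogonal_pattern :: "nat \<Rightarrow> (nat \<Rightarrow> nat \<Rightarrow> rat) \<Rightarrow> bool" where
  "split_orthogonal_pattern n z \<longleftrightarrow>
     half_triangular (2*n) z \<and> interlacing (2*n) z \<and>
     (\<forall>(i, j)\<in>odd_ends n. 2 * z i j \<in> \<nat>) \<and>
     ((\<forall>(i, j)\<in>positions (2*n) - odd_ends n. z i j \<in> \<nat>) \<or>
      (\<forall>(i, j)\<in>positions (2*n) - odd_ends n. z i j - 1/2 \<in> \<nat>))"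

definition atypical :: "nat \<Rightarrow> (nat \<Rightarrow> nat \<Rightarrow> rat) \<Rightarrow> (nat \<times> nat) set" where
  "atypical n z =
    (if z (2*n) 1 \<in> \<int> then {(i, j)\<in>positions (2*n). z i j \<in> half_ints}
     else {(i, j)\<in>positions (2*n). z i j \<in> \<int>})"

definition s_CB :: "rat list \<Rightarrow> 'v list \<Rightarrow> 'a \<Rightarrow> ('v, 'a::comm_ring_1) laurent" where
  "s_CB l x \<beta> =
    (\<Sum>z | split_orthogonal_pattern (length x) z \<and> shape (2 * length x) z = l.
       scalar (\<beta> ^ card (atypical (length x) z)) * weight x z)"

definition so_odd :: "rat list \<Rightarrow> 'v list \<Rightarrow> ('v, 'a::comm_ring_1) laurent" where
  "so_odd l x =
    (\<Sum>z | split_orthogonal_pattern (length x) z \<and> shape (2 * length x) z = l. weight x z)"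


text \<open>All the index sets above are finite, so no sum collapses to 0 by convention.\<close>

lemma finite_bounded_halves: "finite {q::rat. 2 * q \<in> \<nat> \<and> q \<le> b}"
proof -
  obtain N :: nat where N: "2 * b \<le> of_nat N"
    using real_arch_simple[of "of_rat (2 * b)"] by (metis of_rat_less_eq of_rat_of_nat_eq)
  have "{q::rat. 2 * q \<in> \<nat> \<and> q \<le> b} \<subseteq> (\<lambda>k. of_nat k / 2) ` {..N}"
  proof
    fix q :: rat
    assume "q \<in> {q. 2 * q \<in> \<nat> \<and> q \<le> b}"
    then obtain k where k: "2 * q = of_nat k" and "q \<le> b"
      by (auto elim: Nats_cases)
    with N have "(of_nat k :: rat) \<le> of_nat N"
      by linarith
    hence "k \<le> N"
      by simp
    moreover have "q = of_nat k / 2"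
      using k by simp
    ultimately show "q \<in> (\<lambda>k. of_nat k / 2) ` {..N}"
      by blast
  qed
  thus ?thesis
    by (rule finite_subset) simp
qed

lemma finite_positions: "finite (positions M)"
  by (rule finite_subset[of _ "{..M} \<times> {..row_len M}"])
     (auto simp: positions_def row_len_def)

lemma interlacing_le_last_row:
  assumes "interlacing M z" "(i, j) \<in> positions M"
  shows "z i j \<le> z M j"
proof -
  have "i \<le> M" "1 \<le> i" "1 \<le> j" "j \<le> row_len i"
    using assms(2) by (auto simp: positions_def)
  from \<open>i \<le> M\<close> have "i \<le> k \<Longrightarrow> k \<le> M \<Longrightarrow> z i j \<le> z k j" for k
  proof (induction k)
    case (Suc k)
    show ?case
    proof (cases "i = Suc k")
      case False
      with Suc have "i \<le> k" "z i j \<le> z k j"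
        by auto
      moreover have "(k, j) \<in> positions M" "(k + 1, j) \<in> positions M"
        using \<open>i \<le> k\<close> Suc.prems \<open>1 \<le> i\<close> \<open>1 \<le> j\<close> \<open>j \<le> row_len i\<close>
        by (auto simp: positions_def row_len_def)
      ultimately show ?thesis
        using assms(1) unfolding interlacing_def by force
    qed simp
  qed simp
  thus ?thesis
    using \<open>i \<le> M\<close> by blast
qed

lemma finite_half_triangular:
  assumes "\<And>z. P z \<Longrightarrow> half_triangular M z \<and> interlacing M z \<and> (\<forall>(i, j)\<in>positions M. 2 * z i j \<in> \<nat>)"
  shows "finite {z. P z \<and> shape M z = l}"
proof -
  define B where "B = {q::rat. 2 * q \<in> \<nat> \<and> q \<le> Max (set l)}"
  define F where "F = {f. \<forall>p. (p \<in> positions M \<longrightarrow> f p \<in> B) \<and> (p \<notin> positions M \<longrightarrow> f p = 0)}"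
  have "finite F"
    unfolding F_def B_def
    by (rule finite_set_of_finite_funs[OF finite_positions finite_bounded_halves])
  moreover have "{z. P z \<and> shape M z = l} \<subseteq> curry ` F"
  proof
    fix z
    assume "z \<in> {z. P z \<and> shape M z = l}"
    hence z: "half_triangular M z" "interlacing M z" "\<forall>(i, j)\<in>positions M. 2 * z i j \<in> \<nat>"
      and l: "l = shape M z"
      using assms by auto
    have "z i j \<in> B" if "(i, j) \<in> positions M" for i j
    proof -
      have "1 \<le> j" "j \<le> row_len M"
        using that by (auto simp: positions_def row_len_def)
      hence "z M j \<in> set l"
        unfolding l shape_def set_map by (intro imageI) auto
      hence "z i j \<le> Max (set l)"
        using interlacing_le_last_row[OF z(2) that] Max_ge[of "set l" "z M j"]
        by (meson List.finite_set order_trans)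
      thus ?thesis
        using z(3) that by (auto simp: B_def)
    qed
    hence "case_prod z \<in> F"
      using z(1) by (auto simp: F_def half_triangular_def)
    thus "z \<in> curry ` F"
      by (metis curry_case_prod imageI)
  qed
  ultimately show ?thesis
    using finite_surj by blast
qed

lemma Nats_double: "(q::rat) \<in> \<nat> \<Longrightarrow> 2 * q \<in> \<nat>"
  using Nats_add[of q q] by simp

lemma finite_symplectic_patterns: "finite {z. symplectic_pattern M z \<and> shape M z = l}"
  by (rule finite_half_triangular) (auto simp: symplectic_pattern_def Nats_double)

lemma finite_split_orthogonal_patterns:
  "finite {z. split_orthogonal_pattern n z \<and> shape (2*n) z = l}"
proof (rule finite_half_triangular)
  fix z
  assume z: "split_orthogonal_pattern n z"
  have half: "2 * q \<in> \<nat>" if "q - 1/2 \<in> \<nat>" for q :: rat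
  proof -
    have "2 * (q - 1/2) + 1 \<in> \<nat>"
      by (rule Nats_add[OF Nats_double[OF that] Nats_1])
    thus ?thesis
      by (simp add: algebra_simps)
  qed
  have "2 * z i j \<in> \<nat>" if "(i, j) \<in> positions (2*n)" for i j
    using z that half[of "z i j"] Nats_double[of "z i j"]
    unfolding split_orthogonal_pattern_def by blast
  thus "half_triangular (2*n) z \<and> interlacing (2*n) z \<and> (\<forall>(i, j)\<in>positions (2*n). 2 * z i j \<in> \<nat>)"
    using z by (auto simp: split_orthogonal_pattern_def)
qed

lemma finite_parts_in: "finite (parts_in u k)"
proof -
  have "parts_in u k \<subseteq> {l. set l \<subseteq> {q. 2 * q \<in> \<nat> \<and> q \<le> u} \<and> length l = k}"
  proof
    fix l
    assume l: "l \<in> parts_in u k"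
    have len: "length l = k" and srt: "sorted_wrt (\<ge>) l"
      using l by (auto simp: parts_in_def partitions_def half_partitions_def)
    have "2 * a \<in> \<nat> \<and> a \<le> u" if a: "a \<in> set l" for a
    proof
      have "a \<in> \<int> \<or> a - 1/2 \<in> \<int>" "0 \<le> a"
        using l a by (auto simp: parts_in_def partitions_def half_partitions_def half_ints_def)
      moreover have "2 * a \<in> \<int>" if "a - 1/2 \<in> \<int>"
      proof -
        have "(a - 1/2) + (a - 1/2) + 1 \<in> \<int>"
          using that by (intro Ints_add Ints_1)
        thus ?thesis
          by (simp add: algebra_simps)
      qed
      ultimately have "2 * a \<in> \<int>" "0 \<le> 2 * a"
        by auto
      thus "2 * a \<in> \<nat>"
        by (simp add: Nats_altdef2)
      from a have "a \<le> hd l"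
        using srt by (cases l) auto
      moreover have "hd l \<le> u"
        using l len a by (auto simp: parts_in_def)
      ultimately show "a \<le> u"
        by simp
    qed
    thus "l \<in> {l. set l \<subseteq> {q. 2 * q \<in> \<nat> \<and> q \<le> u} \<and> length l = k}"
      using len by auto
  qed
  thus ?thesis
    using finite_lists_length_eq[OF finite_bounded_halves] finite_subset by blast
qed

end

theory Submission
  imports Defs
begin

text \<open>
  Cut a pattern with last row \<open>u\<^sup>n\<^sup>+\<^sup>m\<close> at row \<open>2n\<close>. Interlacing forces all but \<open>\<lceil>i/2\<rceil>\<close> entries of the
  row \<open>i\<close> steps before the last one to be \<open>u\<close>, so row \<open>2n\<close> has the form \<open>(u\<^sup>n\<^sup>-\<^sup>m, \<lambda>)\<close>, and the free entries
  of the rows \<open>2n + 2m, \<dots>, 2n\<close>, in this order, form a pattern of shape \<open>\<lambda>\<close> whose variables are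
  reversed. This yields the identities up to the order of \<open>y\<close>; the odd symplectic one arises from
  a cut between the two rows of \<open>s\<close>, placed between \<open>x\<close> and \<open>y\<close>, up to inverting \<open>s\<close>. It remains to
  show that the functions are symmetric and, in the symplectic case, invariant under inversion.

  Symplectic patterns are chains of horizontal strips with bounded row lengths. Operators adding
  horizontal strips commute (by toggling a row), which gives the inversion; for the exchange of two
  variables the bound on the intermediate row length is removed by inclusion-exclusion.
  For integral shapes, \<open>s\<^sup>C\<^sup>B\<close> is the sum of the symplectic functions over all ways of removing a vertical
  strip, weighted by powers of \<open>\<beta>\<close>; for half-integral shapes, lowering the shape by \<open>1/2\<close> splits off
  the factor \<open>\<Prod> (x\<^sub>i\<^sup>-\<^sup>1\<^sup>/\<^sup>2 + \<beta> x\<^sub>i\<^sup>1\<^sup>/\<^sup>2)\<close>.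
\<close>


section \<open>Rows and the operator adding a horizontal strip\<close>

text \<open>Rows are finitely supported functions, so that length is a separate property
  (\<open>supp_le\<close>) and interlacing itself knows no bound; only in this form do the strip
  operators commute. For inversion the toggled row is odd, and its length is controlled by the row
  below. An exchange of two variables also moves the even row between them: it may have only
  \<open>k + 1\<close> entries, while toggling can create \<open>k + 2\<close>. This is the obstacle
  behind the correction term. Atypical odd ends obstruct toggling altogether: for integral shapes
  the factor \<open>1 + \<beta> * p 1\<close> occurs only where the odd end is positive, hence
  depends on the toggled row. Vertical strips remove it, since they commute with horizontal ones,
  and passing them through a length bound produces exactly this factor. For half-integral shapes
  both values of an odd end are always possible, so the factor is constant. The encoding of odd ends
  works because the last entry of an odd row is bounded by its neighbours from above only: rounding
  it up by 1/2 changes no interlacing condition.\<close>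

definition supp_le :: "nat \<Rightarrow> (nat \<Rightarrow> nat) \<Rightarrow> bool" where
  "supp_le k f \<longleftrightarrow> (\<forall>j\<ge>k. f j = 0)"

definition finsupp :: "(nat \<Rightarrow> nat) \<Rightarrow> bool" where
  "finsupp f \<longleftrightarrow> (\<exists>k. supp_le k f)"

definition wt :: "(nat \<Rightarrow> nat) \<Rightarrow> int" where
  "wt f = (\<Sum>j | f j \<noteq> 0. int (f j))"

definition interl :: "(nat \<Rightarrow> nat) \<Rightarrow> (nat \<Rightarrow> nat) \<Rightarrow> bool" where
  "interl f g \<longleftrightarrow> (\<forall>j. f j \<le> g j \<and> g (Suc j) \<le> f j)"

lemma supp_leD: "supp_le k f \<Longrightarrow> k \<le> j \<Longrightarrow> f j = 0"
  by (simp add: supp_le_def)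

lemma supp_le_mono: "supp_le k f \<Longrightarrow> k \<le> l \<Longrightarrow> supp_le l f"
  by (simp add: supp_le_def)

lemma supp_le_pointwise: "supp_le k g \<Longrightarrow> (\<And>j. f j \<le> g j) \<Longrightarrow> supp_le k f"
  unfolding supp_le_def by (metis le_zero_eq)

lemma finsuppI: "supp_le k f \<Longrightarrow> finsupp f"
  by (auto simp: finsupp_def)

lemma wt_eq: "supp_le k f \<Longrightarrow> wt f = (\<Sum>j<k. int (f j))"
  unfolding wt_def by (rule sum.mono_neutral_left) (auto simp: supp_le_def intro: leI)

lemma interl_supp_le: "interl f g \<Longrightarrow> supp_le k g \<Longrightarrow> supp_le k f"
  unfolding interl_def by (metis supp_le_pointwise)

lemma interl_supp_le_Suc: "interl f g \<Longrightarrow> supp_le k f \<Longrightarrow> supp_le (Suc k) g"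
  unfolding interl_def supp_le_def by (metis Suc_le_D Suc_le_mono le_zero_eq)

lemma interl_finsupp: "interl f g \<Longrightarrow> finsupp g \<Longrightarrow> finsupp f"
  unfolding finsupp_def using interl_supp_le by blast

lemma interl_antimono: "interl f g \<Longrightarrow> antimono g"
  unfolding antimono_iff_le_Suc interl_def using order_trans by blast

lemma finite_rows_le:
  assumes "finsupp g"
  shows "finite {f. \<forall>j. f j \<le> (g j :: nat)}"
proof -
  obtain k where k: "supp_le k g"
    using assms by (auto simp: finsupp_def)
  have "{f. \<forall>j. f j \<le> g j} \<subseteq>
      {f. \<forall>j. (j \<in> {..<k} \<longrightarrow> f j \<in> {..Max (g ` {..<k})}) \<and> (j \<notin> {..<k} \<longrightarrow> f j = 0)}"
  proof clarify
    fix f j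
    assume f: "\<forall>j. f j \<le> g j"
    have "f j \<le> Max (g ` {..<k})" if "j < k"
      using f that by (meson Max_ge finite_imageI finite_lessThan imageI lessThan_iff order_trans)
    moreover have "f j = 0" if "k \<le> j"
      using f k that by (metis le_zero_eq supp_le_def)
    ultimately show "(j \<in> {..<k} \<longrightarrow> f j \<in> {..Max (g ` {..<k})}) \<and> (j \<notin> {..<k} \<longrightarrow> f j = 0)"
      by auto
  qed
  thus ?thesis
    by (rule finite_subset) (rule finite_set_of_finite_funs, auto)
qed

lemma finite_interl: "finsupp g \<Longrightarrow> finite {f. interl f g}"
  by (rule finite_subset[OF _ finite_rows_le[of g]]) (auto simp: interl_def)

section \<open>Strip operators and their commutation by toggling a row\<close>

definition strip_op ::
  "(int \<Rightarrow> 'r::comm_ring_1) \<Rightarrow> ((nat \<Rightarrow> nat) \<Rightarrow> 'r) \<Rightarrow> (nat \<Rightarrow> nat) \<Rightarrow> 'r" where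
  "strip_op p F g = (\<Sum>f | interl f g. p (wt g - wt f) * F f)"

lemma strip_op_cong:
  "(\<And>f. interl f g \<Longrightarrow> F f = F' f) \<Longrightarrow> strip_op p F g = strip_op p F' g"
  unfolding strip_op_def by (rule sum.cong) auto

text \<open>This is the Bender-Knuth involution on a single row: each entry is reflected in the
  interval from \<open>max (h (Suc j)) (f j)\<close> to \<open>min (h j) (f (j - 1))\<close> that
  the two adjacent rows leave to it. Entry 0 has no predecessor in \<open>f\<close>, so its upper
  end is \<open>h 0\<close>.\<close>

definition toggle :: "(nat \<Rightarrow> nat) \<Rightarrow> (nat \<Rightarrow> nat) \<Rightarrow> (nat \<Rightarrow> nat) \<Rightarrow> nat \<Rightarrow> nat" where
  "toggle h f g = (\<lambda>j. max (h (Suc j)) (f j) + (if j = 0 then h 0 else min (h j) (f (j - 1))) - g j)"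

lemma toggle:
  assumes fg: "interl f g" and gh: "interl g h"
  shows "interl f (toggle h f g)" "interl (toggle h f g) h" "toggle h f (toggle h f g) = g"
    "finsupp h \<Longrightarrow> wt (toggle h f g) = wt h + wt f - wt g"
proof -
  have lo: "max (h (Suc j)) (f j) \<le> g j" for j
    using fg gh by (auto simp: interl_def)
  have hi: "g j \<le> (if j = 0 then h 0 else min (h j) (f (j - 1)))" for j
    using fg gh by (cases j) (auto simp: interl_def)
  have t_lo: "max (h (Suc j)) (f j) \<le> toggle h f g j" for j
    using lo[of j] hi[of j] unfolding toggle_def by linarith
  have t_hi: "toggle h f g j \<le> (if j = 0 then h 0 else min (h j) (f (j - 1)))" for j
    using lo[of j] hi[of j] unfolding toggle_def by linarith
  show "interl f (toggle h f g)"
    unfolding interl_def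
  proof
    fix j
    show "f j \<le> toggle h f g j \<and> toggle h f g (Suc j) \<le> f j"
      using t_lo[of j] t_hi[of "Suc j"] by auto
  qed
  show "interl (toggle h f g) h"
    unfolding interl_def
  proof
    fix j
    show "toggle h f g j \<le> h j \<and> h (Suc j) \<le> toggle h f g j"
      using t_lo[of j] t_hi[of j] by (auto split: if_splits)
  qed
  show "toggle h f (toggle h f g) = g"
  proof
    fix j
    show "toggle h f (toggle h f g) j = g j"
      using lo[of j] hi[of j] by (simp add: toggle_def)
  qed
  show "wt (toggle h f g) = wt h + wt f - wt g" if fin: "finsupp h"
  proof -
    obtain k where h: "supp_le k h"
      using fin by (auto simp: finsupp_def)
    have g: "supp_le k g"
      using h gh interl_supp_le by blast
    have f: "supp_le k f"
      using g fg interl_supp_le by blast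
    have t: "supp_le k (toggle h f g)"
      using h \<open>interl (toggle h f g) h\<close> interl_supp_le by blast
    \<comment> \<open>The lower end at \<open>k\<close> and the upper end at \<open>Suc k\<close>
      are the maximum and the minimum of the same pair \<open>h (Suc k)\<close>, \<open>f k\<close>,
      so together they give the sum of that pair. One maximum remains, and it vanishes beyond the
      supports.\<close>
    have S: "(\<Sum>j<Suc k. int (max (h (Suc j)) (f j)) + int (if j = 0 then h 0 else min (h j) (f (j - 1))))
        = int (max (h (Suc k)) (f k)) + (\<Sum>j<Suc k. int (h j)) + (\<Sum>j<k. int (f j))" for k
    proof (induction k)
      case (Suc k)
      have "int (max (h (Suc k)) (f k)) + int (min (h (Suc k)) (f k)) = int (h (Suc k)) + int (f k)"
        by (simp add: max_def min_def)
      with Suc show ?case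
        by (subst sum.lessThan_Suc) (simp del: of_nat_max of_nat_min)
    qed simp
    have E: "int (toggle h f g j) = int (max (h (Suc j)) (f j)) +
        int (if j = 0 then h 0 else min (h j) (f (j - 1))) - int (g j)" for j
      using lo[of j] hi[of j] unfolding toggle_def by linarith
    have "wt (toggle h f g) = (\<Sum>j<Suc k. int (toggle h f g j))"
      using t supp_le_mono[of k _ "Suc k"] by (intro wt_eq) auto
    also have "\<dots> = int (max (h (Suc k)) (f k)) + (\<Sum>j<Suc k. int (h j)) + (\<Sum>j<k. int (f j))
        - (\<Sum>j<Suc k. int (g j))"
      by (simp only: E sum_subtractf S)
    also have "\<dots> = wt h + wt f - wt g"
      using h f g by (simp add: wt_eq supp_leD)
    finally show ?thesis .
  qed
qed

text \<open>For fixed outer rows, toggling the row between them exchanges the sizes of the two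
  strips. The weights can therefore be arbitrary functions of the strip sizes.\<close>

lemma strip_op_commute:
  assumes h: "finsupp h"
  shows "strip_op p (strip_op q F) h = strip_op q (strip_op p F) h"
proof -
  have *: "strip_op p (strip_op q F) h =
      (\<Sum>(g, f)\<in>(SIGMA g:{g. interl g h}. {f. interl f g}). p (wt h - wt g) * q (wt g - wt f) * F f)" for p q
    unfolding strip_op_def sum_distrib_left mult.assoc[symmetric]
    using h interl_finsupp finite_interl by (subst sum.Sigma) auto
  show ?thesis
    unfolding *
    by (rule sum.reindex_bij_witness[of _ "\<lambda>(g, f). (toggle h f g, f)" "\<lambda>(g, f). (toggle h f g, f)"])
       (auto simp: toggle h mult.commute)
qed

text \<open>Imposes the length bound of an even row. The odd row above it then has at most one entry
  more by interlacing, so bounds on the even rows suffice.\<close>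

definition trunc :: "nat \<Rightarrow> ((nat \<Rightarrow> nat) \<Rightarrow> 'r::comm_ring_1) \<Rightarrow> (nat \<Rightarrow> nat) \<Rightarrow> 'r" where
  "trunc k F = (\<lambda>f. if supp_le k f then F f else 0)"

abbreviation (input) inv_char :: "(int \<Rightarrow> 'r) \<Rightarrow> int \<Rightarrow> 'r" where
  "inv_char p \<equiv> \<lambda>d. p (- d)"

text \<open>Abstracts the powers of one variable, with \<open>p d\<close> in the role of the
  \<open>d\<close>-th power.\<close>

definition additive_char :: "(int \<Rightarrow> 'r::comm_ring_1) \<Rightarrow> bool" where
  "additive_char p \<longleftrightarrow> p 0 = 1 \<and> (\<forall>a b. p (a + b) = p a * p b)"

lemma additive_char_inv: "additive_char p \<Longrightarrow> p a * p (- a) = 1"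
  unfolding additive_char_def by (metis add.right_inverse)

text \<open>
  The head of the list belongs to the last two rows of the pattern. The factor \<open>\<phi>\<close> collects the
  choices for the odd end of a row, which depend only on whether that entry may be lowered.
\<close>

fun pat :: "((int \<Rightarrow> 'r::comm_ring_1) \<times> (bool \<Rightarrow> 'r)) list \<Rightarrow> (nat \<Rightarrow> nat) \<Rightarrow> 'r" where
  "pat [] f = (if f = (\<lambda>_. 0) then 1 else 0)"
| "pat ((p, \<phi>) # ps) f =
    strip_op p (\<lambda>g. \<phi> (0 < g (length ps)) * strip_op (inv_char p) (trunc (length ps) (pat ps)) g) f"

section \<open>Adding 1 to the first entries of a row\<close>

definition raise :: "nat \<Rightarrow> (nat \<Rightarrow> nat) \<Rightarrow> nat \<Rightarrow> nat" where
  "raise k f = (\<lambda>j. if j < k then Suc (f j) else f j)"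

lemma inj_raise: "inj (raise k)"
  unfolding inj_def raise_def fun_eq_iff by (metis Suc_inject)

lemma supp_le_raise [simp]: "supp_le k (raise k f) \<longleftrightarrow> supp_le k f"
  by (simp add: supp_le_def raise_def)

lemma wt_raise: "supp_le k f \<Longrightarrow> wt (raise k f) = wt f + int k"
proof -
  assume f: "supp_le k f"
  have "wt (raise k f) = (\<Sum>j<k. int (f j) + 1)"
    using f by (subst wt_eq[of k]) (simp_all, simp add: raise_def add.commute)
  thus ?thesis
    using f by (simp add: wt_eq sum.distrib)
qed

lemma raise_pred:
  assumes "\<And>j. j < k \<Longrightarrow> 0 < f j"
  shows "raise k (\<lambda>j. if j < k then f j - 1 else f j) = f"
  using assms by (fastforce simp: raise_def fun_eq_iff)

lemma interl_raise:
  assumes "supp_le k g"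
  shows "interl (raise k f) (raise k g) \<longleftrightarrow> interl f g"
proof -
  have "raise k f j \<le> raise k g j \<and> raise k g (Suc j) \<le> raise k f j \<longleftrightarrow> f j \<le> g j \<and> g (Suc j) \<le> f j" for j
    using assms supp_leD[OF assms, of "Suc j"] by (cases "Suc j < k") (auto simp: raise_def)
  thus ?thesis
    by (simp add: interl_def)
qed

lemma interl_raise_Suc:
  assumes "supp_le (Suc k) g" "supp_le k f"
  shows "interl (raise k f) (raise (Suc k) g) \<longleftrightarrow> interl f g"
proof -
  have "raise k f j \<le> raise (Suc k) g j \<and> raise (Suc k) g (Suc j) \<le> raise k f j
      \<longleftrightarrow> f j \<le> g j \<and> g (Suc j) \<le> f j" for j
    using supp_leD[OF assms(1), of "Suc j"] supp_leD[OF assms(2), of j]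
    by (cases "j < k") (auto simp: raise_def)
  thus ?thesis
    by (simp add: interl_def)
qed

section \<open>Symmetry of symplectic patterns\<close>

lemma additive_char_inv_char: "additive_char p \<Longrightarrow> additive_char (inv_char p)"
  unfolding additive_char_def by (metis add.inverse_neutral minus_add_distrib)

lemma strip_op_diff: "strip_op p (\<lambda>f. F f - F' f) g = strip_op p F g - strip_op p F' g"
  by (simp add: strip_op_def algebra_simps sum_subtractf)

lemma strip_op_scale: "strip_op p (\<lambda>f. c * F f) g = c * strip_op p F g"
  by (simp add: strip_op_def sum_distrib_left mult.left_commute)

lemma strip_op_eq_0: "(\<And>f. interl f g \<Longrightarrow> F f = 0) \<Longrightarrow> strip_op p F g = 0"
  by (simp add: strip_op_def)

lemma strip_op_trunc_eq_0:
  assumes "\<And>f. \<not> supp_le k f \<Longrightarrow> F f = 0" "\<not> supp_le (Suc k) g"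
  shows "strip_op p F g = 0"
  using assms interl_supp_le_Suc by (intro strip_op_eq_0) blast

lemma ex_raise: "(\<forall>j<k. 0 < f j) \<Longrightarrow> \<exists>f'. f = raise k f'"
  using raise_pred[of k f] by metis

lemma raise_pos: "j < k \<Longrightarrow> 0 < raise k f j"
  by (simp add: raise_def)

text \<open>Raising both rows by the same number of boxes leaves the strip size unchanged, so no
  factor appears. The hypothesis on \<open>F\<close> discards the lower rows that are not of the
  form \<open>raise k f\<close>.\<close>

lemma strip_op_raise:
  assumes g: "supp_le k g"
    and F: "\<And>f. supp_le k f \<Longrightarrow> \<not> (\<forall>j<k. 0 < f j) \<Longrightarrow> F f = 0"
  shows "strip_op p F (raise k g) = strip_op p (\<lambda>f. F (raise k f)) g"
proof -
  have fin: "finite {f. interl f (raise k g)}"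
    using g by (intro finite_interl finsuppI[of k]) simp
  have "strip_op p F (raise k g) =
      (\<Sum>f\<in>raise k ` {f. interl f g}. p (wt (raise k g) - wt f) * F f)"
    unfolding strip_op_def
  proof (rule sum.mono_neutral_right[OF fin])
    show "raise k ` {f. interl f g} \<subseteq> {f. interl f (raise k g)}"
      using g interl_raise by blast
    show "\<forall>f\<in>{f. interl f (raise k g)} - raise k ` {f. interl f g}.
        p (wt (raise k g) - wt f) * F f = 0"
    proof
      fix f
      assume f: "f \<in> {f. interl f (raise k g)} - raise k ` {f. interl f g}"
      have "\<not> (\<forall>j<k. 0 < f j)"
        using f g interl_raise ex_raise[of k f] by blast
      moreover have "supp_le k f"
        using f g interl_supp_le[of f "raise k g" k] by simp
      ultimately show "p (wt (raise k g) - wt f) * F f = 0"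
        using F by simp
    qed
  qed
  also have "\<dots> = strip_op p (\<lambda>f. F (raise k f)) g"
    unfolding strip_op_def
  proof (subst sum.reindex)
    show "inj_on (raise k) {f. interl f g}"
      using inj_raise inj_on_subset by blast
    show "sum ((\<lambda>f. p (wt (raise k g) - wt f) * F f) \<circ> raise k) {f. interl f g} =
        (\<Sum>f | interl f g. p (wt g - wt f) * F (raise k f))"
      using g interl_supp_le by (intro sum.cong) (auto simp: wt_raise)
  qed
  finally show ?thesis .
qed

text \<open>Here the upper row gains one box more than the lower one, whence the factor
  \<open>p 1\<close>. Positivity of the first \<open>k\<close> entries below comes for free, as
  entry \<open>j\<close> is at least the raised entry \<open>Suc j\<close> of the row above.\<close>

lemma strip_op_raise_Suc:
  assumes p: "additive_char p"
    and g: "supp_le (Suc k) g"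
    and F: "\<And>f. \<not> supp_le k f \<Longrightarrow> F f = 0"
  shows "strip_op p F (raise (Suc k) g) = p 1 * strip_op p (\<lambda>f. F (raise k f)) g"
proof -
  have fin: "finite {f. interl f (raise (Suc k) g)}" "finite {f. interl f g}"
    using g by (auto intro!: finite_interl finsuppI[of "Suc k"])
  have "strip_op p F (raise (Suc k) g) =
      (\<Sum>f\<in>raise k ` {f. interl f g \<and> supp_le k f}. p (wt (raise (Suc k) g) - wt f) * F f)"
    unfolding strip_op_def
  proof (rule sum.mono_neutral_right[OF fin(1)])
    show "raise k ` {f. interl f g \<and> supp_le k f} \<subseteq> {f. interl f (raise (Suc k) g)}"
      using g interl_raise_Suc by blast
    show "\<forall>f\<in>{f. interl f (raise (Suc k) g)} - raise k ` {f. interl f g \<and> supp_le k f}.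
        p (wt (raise (Suc k) g) - wt f) * F f = 0"
    proof
      fix f
      assume f: "f \<in> {f. interl f (raise (Suc k) g)} - raise k ` {f. interl f g \<and> supp_le k f}"
      have "\<forall>j<k. 0 < f j"
      proof clarify
        fix j assume "j < k"
        thus "0 < f j"
          using f raise_pos[of "Suc j" "Suc k" g] by (auto simp: interl_def dest!: spec[of _ j])
      qed
      then obtain f' where f': "f = raise k f'"
        using ex_raise by blast
      have "\<not> supp_le k f"
        using f interl_raise_Suc[OF g, of f'] by (auto simp: f')
      thus "p (wt (raise (Suc k) g) - wt f) * F f = 0"
        using F by simp
    qed
  qed
  also have "\<dots> = (\<Sum>f | interl f g \<and> supp_le k f. p 1 * (p (wt g - wt f) * F (raise k f)))"
  proof (subst sum.reindex)
    show "inj_on (raise k) {f. interl f g \<and> supp_le k f}"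
      using inj_raise inj_on_subset by blast
    have *: "p (wt g + int (Suc k) - (wt f + int k)) = p 1 * p (wt g - wt f)" for f
    proof -
      have "wt g + int (Suc k) - (wt f + int k) = 1 + (wt g - wt f)"
        by simp
      thus ?thesis
        using p unfolding additive_char_def by metis
    qed
    show "sum ((\<lambda>f. p (wt (raise (Suc k) g) - wt f) * F f) \<circ> raise k) {f. interl f g \<and> supp_le k f} =
        (\<Sum>f | interl f g \<and> supp_le k f. p 1 * (p (wt g - wt f) * F (raise k f)))"
      using g by (intro sum.cong) (simp_all add: wt_raise * mult.assoc del: of_nat_Suc)
  qed
  also have "\<dots> = (\<Sum>f | interl f g. p 1 * (p (wt g - wt f) * F (raise k f)))"
    by (rule sum.mono_neutral_left) (use fin F in auto)
  finally show ?thesis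
    by (simp add: strip_op_def sum_distrib_left)
qed

lemma strip_op_commute4:
  assumes "finsupp g"
  shows "strip_op q (strip_op q' (strip_op p (strip_op p' F))) g =
         strip_op p (strip_op p' (strip_op q (strip_op q' F))) g"
proof -
  have fin: "interl f g \<Longrightarrow> finsupp f" for f
    using assms interl_finsupp by blast
  have fin2: "interl e f \<Longrightarrow> interl f g \<Longrightarrow> finsupp e" for e f
    using fin interl_finsupp by blast
  have "strip_op q (strip_op q' (strip_op p (strip_op p' F))) g =
        strip_op q (strip_op p (strip_op q' (strip_op p' F))) g"
    by (intro strip_op_cong strip_op_commute fin)
  also have "\<dots> = strip_op p (strip_op q (strip_op q' (strip_op p' F))) g"
    using assms by (rule strip_op_commute)
  also have "\<dots> = strip_op p (strip_op q (strip_op p' (strip_op q' F))) g"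
    by (intro strip_op_cong strip_op_commute) (rule fin2)
  also have "\<dots> = strip_op p (strip_op p' (strip_op q (strip_op q' F))) g"
    by (intro strip_op_cong strip_op_commute fin)
  finally show ?thesis .
qed

text \<open>\<open>p\<close> belongs to the lower and \<open>q\<close> to the upper pair of strips;
  the even row between the pairs is the one with the obstructing bound \<open>Suc k\<close>.\<close>

definition two_steps where
  "two_steps p q k F = strip_op q (strip_op (inv_char q) (trunc (Suc k)
     (strip_op p (strip_op (inv_char p) (trunc k F)))))"

text \<open>
  Without the bound on the support of the middle row the four strip operators commute. In a
  discarded term the middle row has \<open>k + 2\<close> positive entries, which forces the five rows to have
  \<open>k\<close>, \<open>k + 1\<close>, \<open>k + 2\<close>, \<open>k + 2\<close> and \<open>k + 2\<close> positive entries. Lowering all of them by 1 turns the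
  discarded terms into a sum of the same kind without the bound.
\<close>

lemma strip_op_exceeding:
  fixes F :: "(nat \<Rightarrow> nat) \<Rightarrow> 'r::comm_ring_1"
  assumes p: "additive_char p" and h: "supp_le (Suc (Suc k)) h"
  defines "H \<equiv> strip_op p (strip_op (inv_char p) (trunc k F))"
  shows "strip_op q (strip_op q' (\<lambda>f. if supp_le (Suc k) f then 0 else H f)) h =
    (if \<forall>j<Suc (Suc k). 0 < h j
     then strip_op q (strip_op q' (strip_op p (strip_op (inv_char p) (trunc k (\<lambda>f. F (raise k f))))))
       (\<lambda>j. h j - 1) else 0)"
proof -
  let ?K = "Suc (Suc k)"
  let ?Q = "\<lambda>f. if supp_le (Suc k) f then 0 else H f"
  have H0: "strip_op p' (trunc k F') f = 0" if "\<not> supp_le (Suc k) f"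
    for p' :: "int \<Rightarrow> 'r" and F' f
    using that by (intro strip_op_trunc_eq_0[of k]) (auto simp: trunc_def)
  \<comment> \<open>Rows on which \<open>H\<close> does not vanish are weakly decreasing, so a
    positive entry at index \<open>Suc k\<close> makes all the entries before it positive.\<close>
  have Q0: "?Q f = 0" if f: "supp_le ?K f" "\<not> (\<forall>j<?K. 0 < f j)" for f
  proof (cases "supp_le (Suc k) f")
    case False
    have "f (Suc k) > 0"
      using f(1) False by (metis bot_nat_0.not_eq_extremum le_antisym not_less_eq_eq supp_le_def)
    moreover have "\<not> antimono f"
    proof
      assume "antimono f"
      hence "f (Suc k) \<le> f j" if "j < ?K" for j
        using that by (simp add: antimono_def)
      thus False
        using f(2) \<open>f (Suc k) > 0\<close> by (meson order_less_le_trans)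
    qed
    ultimately have "H f = 0"
      unfolding H_def using interl_antimono by (intro strip_op_eq_0) blast
    thus ?thesis by simp
  qed simp
  have Q1: "strip_op q' ?Q g = 0" if g: "supp_le ?K g" "\<not> (\<forall>j<?K. 0 < g j)" for g
  proof (rule strip_op_eq_0)
    fix f
    assume f: "interl f g"
    have "\<not> (\<forall>j<?K. 0 < f j)"
      using g f unfolding interl_def by (meson order_less_le_trans)
    thus "?Q f = 0"
      using f g interl_supp_le by (intro Q0) auto
  qed
  show ?thesis
  proof (cases "\<forall>j<?K. 0 < h j")
    case True
    then obtain h' where h': "h = raise ?K h'"
      using ex_raise by blast
    have s: "supp_le ?K h'"
      using h h' by simp
    \<comment> \<open>Subtraction on natural numbers keeps the zeros beyond \<open>?K\<close>, so
      subtracting 1 everywhere undoes \<open>raise ?K\<close>.\<close>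
    have h'': "(\<lambda>j. h j - 1) = h'"
      using s by (auto simp: h' raise_def supp_le_def)
    have *: "?Q (raise ?K f) = strip_op p (strip_op (inv_char p) (trunc k (\<lambda>f. F (raise k f)))) f"
      if f: "supp_le ?K f" for f
    proof -
      have "\<not> supp_le (Suc k) (raise ?K f)"
        unfolding supp_le_def raise_def by (metis lessI less_or_eq_imp_le nat.distinct(1))
      hence "?Q (raise ?K f) = H (raise ?K f)"
        by simp
      \<comment> \<open>Only the two strips of \<open>p\<close> lengthen the row. They contribute
        \<open>p 1\<close> and \<open>p (- 1)\<close>, which cancel; the strips of \<open>q\<close>
        keep the length \<open>?K\<close> and contribute nothing.\<close>
      also have "\<dots> = p 1 * strip_op p (\<lambda>f. strip_op (inv_char p) (trunc k F) (raise (Suc k) f)) f"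
        unfolding H_def by (rule strip_op_raise_Suc[OF p f]) (rule H0)
      also have "strip_op p (\<lambda>f. strip_op (inv_char p) (trunc k F) (raise (Suc k) f)) f =
          strip_op p (\<lambda>f. p (- 1) * strip_op (inv_char p) (trunc k (\<lambda>f. F (raise k f))) f) f"
      proof (rule strip_op_cong)
        fix e
        show "strip_op (inv_char p) (trunc k F) (raise (Suc k) e) =
            p (- 1) * strip_op (inv_char p) (trunc k (\<lambda>f. F (raise k f))) e"
        proof (cases "supp_le (Suc k) e")
          case True
          have "(\<lambda>f. trunc k F (raise k f)) = trunc k (\<lambda>f. F (raise k f))"
            by (simp add: trunc_def)
          thus ?thesis
            using strip_op_raise_Suc[OF additive_char_inv_char[OF p], of k e "trunc k F"] True by (simp add: trunc_def)
        next
          case False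
          thus ?thesis
            by (simp add: H0)
        qed
      qed
      finally show ?thesis
        using additive_char_inv[OF p, of 1] by (simp add: strip_op_scale mult.assoc[symmetric])
    qed
    have "strip_op q (strip_op q' ?Q) h = strip_op q (\<lambda>g. strip_op q' ?Q (raise ?K g)) h'"
      unfolding h' by (rule strip_op_raise[OF s Q1])
    also have "\<dots> = strip_op q (strip_op q' (\<lambda>f. ?Q (raise ?K f))) h'"
      using s interl_supp_le by (intro strip_op_cong strip_op_raise Q0) auto
    also have "\<dots> = strip_op q (strip_op q' (strip_op p (strip_op (inv_char p)
        (trunc k (\<lambda>f. F (raise k f)))))) h'"
    proof (intro strip_op_cong)
      fix g f
      assume "interl g h'" "interl f g"
      hence "supp_le ?K f"
        using s interl_supp_le by blast
      thus "?Q (raise ?K f) = strip_op p (strip_op (inv_char p) (trunc k (\<lambda>f. F (raise k f)))) f"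
        by (rule *)
    qed
    finally show ?thesis
      unfolding h'' if_P[OF True] .
  next
    case False
    have "strip_op q (strip_op q' ?Q) h = 0"
    proof (rule strip_op_eq_0)
      fix g
      assume g: "interl g h"
      have "\<not> (\<forall>j<?K. 0 < g j)"
        using g False unfolding interl_def by (meson order_less_le_trans)
      thus "strip_op q' ?Q g = 0"
        using g h interl_supp_le by (intro Q1) auto
    qed
    thus ?thesis
      unfolding if_not_P[OF False] .
  qed
qed

text \<open>The sum without the bound and the correction are both values of four strip operators
  with no bound between them, at \<open>h\<close> and at \<open>h\<close> lowered by 1. Each of them
  is symmetric by commutation, hence so is the difference.\<close>

lemma two_steps_sym:
  assumes p: "additive_char p" and q: "additive_char q" and h: "supp_le (Suc (Suc k)) h"
  shows "two_steps p q k F h = two_steps q p k F h"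
proof -
  let ?g = "\<lambda>p q F. strip_op q (strip_op (inv_char q) (strip_op p (strip_op (inv_char p) (trunc k F))))"
  have *: "two_steps p q k F h = ?g p q F h -
      (if \<forall>j<Suc (Suc k). 0 < h j then ?g p q (\<lambda>f. F (raise k f)) (\<lambda>j. h j - 1) else 0)"
    if p: "additive_char p" for p q
  proof -
    let ?H = "strip_op p (strip_op (inv_char p) (trunc k F))"
    have "trunc (Suc k) ?H = (\<lambda>f. ?H f - (if supp_le (Suc k) f then 0 else ?H f))"
      by (auto simp: trunc_def)
    hence "two_steps p q k F h = strip_op q (strip_op (inv_char q)
        (\<lambda>f. ?H f - (if supp_le (Suc k) f then 0 else ?H f))) h"
      by (simp add: two_steps_def)
    also have "\<dots> = strip_op q (strip_op (inv_char q) ?H) h -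
        strip_op q (strip_op (inv_char q) (\<lambda>f. if supp_le (Suc k) f then 0 else ?H f)) h"
      by (simp add: strip_op_diff[abs_def])
    finally show ?thesis
      by (simp only: strip_op_exceeding[OF p h])
  qed
  have "supp_le (Suc (Suc k)) (\<lambda>j. h j - 1)"
    using h by (simp add: supp_le_def)
  hence "finsupp h" "finsupp (\<lambda>j. h j - 1)"
    using h finsuppI by blast+
  hence "?g p q F h = ?g q p F h"
    "?g p q (\<lambda>f. F (raise k f)) (\<lambda>j. h j - 1) = ?g q p (\<lambda>f. F (raise k f)) (\<lambda>j. h j - 1)"
    using strip_op_commute4 by blast+
  thus ?thesis
    by (simp only: *[OF p, of q] *[OF q, of p])
qed

section \<open>Symplectic patterns: exchange, reversal and inversion of variables\<close>

definition sp_pat :: "(int \<Rightarrow> 'r::comm_ring_1) list \<Rightarrow> (nat \<Rightarrow> nat) \<Rightarrow> 'r" where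
  "sp_pat ps = pat (map (\<lambda>p. (p, \<lambda>_. 1)) ps)"

lemma sp_pat_Nil: "sp_pat [] f = (if f = (\<lambda>_. 0) then 1 else 0)"
  by (simp add: sp_pat_def)

lemma sp_pat_Cons:
  "sp_pat (p # ps) f = strip_op p (strip_op (inv_char p) (trunc (length ps) (sp_pat ps))) f"
  by (simp add: sp_pat_def cong: if_cong)

lemma sp_pat_swap:
  assumes "additive_char p" "additive_char q" "supp_le (Suc (Suc (length ps))) f"
  shows "sp_pat (p # q # ps) f = sp_pat (q # p # ps) f"
proof -
  have "sp_pat (p # q # ps) f = two_steps q p (length ps) (sp_pat ps) f" for p q
    by (simp add: two_steps_def sp_pat_Cons[abs_def])
  thus ?thesis
    using two_steps_sym assms by metis
qed

text \<open>Truncation evaluates the tail only on rows within its length bound, so an identity known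
  just for those rows can be used underneath further variables.\<close>

lemma sp_pat_cong:
  assumes "length qs = length rs" "\<And>f. supp_le (length qs) f \<Longrightarrow> sp_pat qs f = sp_pat rs f"
    and "supp_le (length (ps @ qs)) f"
  shows "sp_pat (ps @ qs) f = sp_pat (ps @ rs) f"
  using assms(3)
proof (induction ps arbitrary: f)
  case (Cons p ps)
  have "trunc (length (ps @ qs)) (sp_pat (ps @ qs)) = trunc (length (ps @ rs)) (sp_pat (ps @ rs))"
    using Cons.IH assms(1) by (auto simp: trunc_def)
  thus ?case
    by (simp add: sp_pat_Cons)
qed (use assms in auto)

lemma sp_pat_move:
  assumes "additive_char p" "\<forall>q\<in>set qs. additive_char q" "supp_le (Suc (length (qs @ ps))) f"
  shows "sp_pat (p # qs @ ps) f = sp_pat (qs @ p # ps) f"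
  using assms
proof (induction qs arbitrary: f)
  case (Cons q qs)
  have "sp_pat (p # (q # qs) @ ps) f = sp_pat ([q] @ (p # qs @ ps)) f"
    using Cons.prems by (simp add: sp_pat_swap)
  also have "\<dots> = sp_pat ([q] @ (qs @ p # ps)) f"
    using Cons by (intro sp_pat_cong) auto
  finally show ?case
    by simp
qed simp

lemma sp_pat_rev:
  assumes "\<forall>p\<in>set ps. additive_char p" "supp_le (length ps) f"
  shows "sp_pat (rev ps) f = sp_pat ps f"
  using assms
proof (induction ps arbitrary: f)
  case (Cons p ps)
  have "sp_pat (rev (p # ps)) f = sp_pat (p # rev ps @ []) f"
    using Cons.prems by (subst sp_pat_move) auto
  also have "\<dots> = sp_pat ([p] @ rev ps) f"
    by simp
  also have "\<dots> = sp_pat ([p] @ ps) f"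
    using Cons by (intro sp_pat_cong) auto
  finally show ?case
    by simp
qed simp

text \<open>Inverting the head variable exchanges its two strips. The odd row between them is not
  truncated, so plain commutation applies.\<close>

lemma sp_pat_inv:
  assumes "finsupp f"
  shows "sp_pat (inv_char p # ps) f = sp_pat (p # ps) f"
  using strip_op_commute[OF assms, of p "inv_char p"] by (simp add: sp_pat_Cons)

section \<open>Vertical strips and patterns with atypical entries\<close>

definition vstrip :: "(nat \<Rightarrow> nat) \<Rightarrow> (nat \<Rightarrow> nat) \<Rightarrow> bool" where
  "vstrip f g \<longleftrightarrow> (\<forall>j. f j \<le> g j \<and> g j \<le> Suc (f j))"

definition vstrip_op ::
  "'r::comm_ring_1 \<Rightarrow> ((nat \<Rightarrow> nat) \<Rightarrow> 'r) \<Rightarrow> (nat \<Rightarrow> nat) \<Rightarrow> 'r" where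
  "vstrip_op \<beta> F g = (\<Sum>f | vstrip f g. \<beta> ^ nat (wt g - wt f) * F f)"

lemma finite_vstrip: "finsupp g \<Longrightarrow> finite {f. vstrip f g}"
  by (rule finite_subset[OF _ finite_rows_le[of g]]) (auto simp: vstrip_def)

lemma vstrip_supp_le: "vstrip f g \<Longrightarrow> supp_le k g \<Longrightarrow> supp_le k f"
  unfolding vstrip_def by (metis supp_le_pointwise)

lemma vstrip_op_cong:
  "(\<And>f. vstrip f g \<Longrightarrow> F f = F' f) \<Longrightarrow> vstrip_op \<beta> F g = vstrip_op \<beta> F' g"
  unfolding vstrip_op_def by (rule sum.cong) auto

lemma prod_if_const:
  "finite A \<Longrightarrow> (\<Prod>x\<in>A. if P x then c else 0) = (if \<forall>x\<in>A. P x then c ^ card A else (0::'r::comm_ring_1))"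
  by (induction A rule: finite_induct) auto

text \<open>Expansion of the product: every position decides independently whether it belongs to
  \<open>X\<close>.\<close>

lemma sum_subsets_prod:
  fixes t :: "'r::comm_ring_1"
  assumes "finite A"
  shows "(\<Sum>X | X \<subseteq> A \<and> (\<forall>j\<in>X. P j) \<and> (\<forall>j\<in>A-X. Q j). t ^ card X) =
    (\<Prod>j\<in>A. (if P j then t else 0) + (if Q j then 1 else 0))"
proof -
  have "(\<Prod>j\<in>A. (if P j then t else 0) + (if Q j then 1 else 0)) =
      (\<Sum>X\<in>Pow A. (\<Prod>j\<in>X. if P j then t else 0) * (\<Prod>j\<in>A-X. if Q j then 1 else 0))"
    using assms by (rule prod_add)
  also have "\<dots> = (\<Sum>X\<in>Pow A. if (\<forall>j\<in>X. P j) \<and> (\<forall>j\<in>A-X. Q j) then t ^ card X else 0)"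
  proof (rule sum.cong)
    fix X assume "X \<in> Pow A"
    hence "finite X"
      using assms finite_subset by auto
    thus "(\<Prod>j\<in>X. if P j then t else 0) * (\<Prod>j\<in>A-X. if Q j then 1 else 0) =
        (if (\<forall>j\<in>X. P j) \<and> (\<forall>j\<in>A-X. Q j) then t ^ card X else 0)"
      using assms by (simp add: prod_if_const)
  qed simp
  also have "\<dots> = (\<Sum>X | X \<subseteq> A \<and> (\<forall>j\<in>X. P j) \<and> (\<forall>j\<in>A-X. Q j). t ^ card X)"
    using assms by (subst sum.inter_filter[symmetric]) (auto intro!: sum.cong)
  finally show ?thesis ..
qed

text \<open>
  Where \<open>q\<close> fails, a factor \<open>1 + t\<close> turns into \<open>t\<close>; the two products have these factors at adjacent places.
\<close>

lemma prod_shift_condition: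
  fixes t :: "'r::comm_ring_1"
  assumes "\<And>j. \<not> q j \<Longrightarrow> s j \<and> s (Suc j)" and "q k"
  shows "(\<Prod>j<Suc k. (if s j then t else 0) + (if j = 0 \<or> q (j - 1) then 1 else 0)) =
    (\<Prod>j<Suc k. (if s j then t else 0) + (if q j then 1 else 0))"
proof -
  define L where "L n = (\<Prod>j<n. (if s j then t else 0) + (if j = 0 \<or> q (j - 1) then 1 else 0))" for n
  define R where "R n = (\<Prod>j<n. (if s j then t else 0) + (if q j then 1 else 0))" for n
  \<comment> \<open>A failure of \<open>q (n - 1)\<close> removes a summand 1 from \<open>R\<close>
    at place \<open>n - 1\<close> but from \<open>L\<close> only at place \<open>n\<close>. Until
    \<open>q\<close> holds again, the partial products differ by having \<open>t\<close> in place of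
    \<open>1 + t\<close>.\<close>
  have "if n = 0 \<or> q (n - 1) then L n = R n else \<exists>X. R n = t * X \<and> L n = (1 + t) * X" for n
  proof (induction n)
    case 0
    show ?case by (simp add: L_def R_def)
  next
    case (Suc n)
    have L: "L (Suc n) = L n * ((if s n then t else 0) + (if n = 0 \<or> q (n - 1) then 1 else 0))"
      and R: "R (Suc n) = R n * ((if s n then t else 0) + (if q n then 1 else 0))"
      by (simp_all add: L_def R_def)
    show ?case
    proof (cases "n = 0 \<or> q (n - 1)")
      case True
      thus ?thesis
        using Suc assms(1)[of n] L R by (cases "q n") (auto simp: algebra_simps)
    next
      case False
      then obtain X where X: "R n = t * X" "L n = (1 + t) * X"
        using Suc by auto
      have "s n"
        using assms(1)[of "n - 1"] False by simp
      hence "L (Suc n) = (1 + t) * (t * X)" "R (Suc n) = t * X * (t + (if q n then 1 else 0))"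
        using L R X False by (auto simp: algebra_simps)
      thus ?thesis
        by (cases "q n") (simp_all add: algebra_simps, intro exI[of _ "t * X"], simp add: algebra_simps)
    qed
  qed
  from this[of "Suc k"] show ?thesis
    using assms(2) by (simp add: L_def R_def)
qed

lemma additive_char_diff_nat:
  assumes "additive_char p"
  shows "p (a - int n) = p a * p (- 1) ^ n"
proof (induction n)
  case (Suc n)
  have "p (a - int (Suc n)) = p ((a - int n) + (- 1))"
    by (simp add: algebra_simps)
  also have "\<dots> = p (a - int n) * p (- 1)"
    using assms unfolding additive_char_def by blast
  finally show ?case
    using Suc by (simp add: mult_ac)
qed simp

text \<open>With the outer rows fixed, the intermediate row is determined by the set
  \<open>X\<close> of positions holding a box of the vertical strip, so both sides are sums over
  subsets. The condition on positions in \<open>X\<close> is \<open>s j\<close> on both sides; off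
  \<open>X\<close> it is \<open>q (j - 1)\<close> on the left and \<open>q j\<close> on the right.
  \<open>prod_shift_condition\<close> compensates this shift.\<close>

lemma vstrip_interl_kernel:
  fixes \<beta> :: "'r::comm_ring_1"
  assumes p: "additive_char p" and fin: "finsupp h" and h: "antimono h" and f: "antimono f"
  shows "(\<Sum>g | vstrip g h \<and> interl f g. \<beta> ^ nat (wt h - wt g) * p (wt g - wt f)) =
         (\<Sum>g | interl g h \<and> vstrip f g. p (wt h - wt g) * \<beta> ^ nat (wt g - wt f))"
\<comment> \<open>If this condition fails somewhere, no intermediate row exists on either side and
  both sums are empty.\<close>
proof (cases "\<forall>j. f j \<le> h j \<and> h (Suc j) \<le> Suc (f j)")
  case False
  then obtain j where j: "\<not> (f j \<le> h j \<and> h (Suc j) \<le> Suc (f j))"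
    by blast
  have "\<not> (vstrip g h \<and> interl f g)" "\<not> (interl g h \<and> vstrip f g)" for g
    using j unfolding vstrip_def interl_def by (meson Suc_le_mono order_trans)+
  thus ?thesis
    by (simp only: Collect_empty_eq[THEN iffD2] sum.empty simp_thms all_simps)
next
  case True
  obtain k where k: "supp_le k h"
    using fin by (auto simp: finsupp_def)
  hence hk: "supp_le (Suc k) h"
    by (rule supp_le_mono) simp
  have fk: "supp_le (Suc k) f"
    using hk True by (meson supp_le_pointwise)
  \<comment> \<open>A box of the vertical strip contributes \<open>\<beta>\<close> and makes the
    horizontal strip smaller by 1.\<close>
  define t where "t = \<beta> * p (- 1)"
  define s where "s j \<longleftrightarrow> f j < h j" for j
  define q where "q j \<longleftrightarrow> h (Suc j) \<le> f j" for j
  define D where "D = wt h - wt f"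
  have D: "\<beta> ^ n * p (D - int n) = p D * t ^ n" for n
    by (simp add: additive_char_diff_nat[OF p] t_def power_mult_distrib mult_ac)
  define dec where "dec X = (\<lambda>j. if j \<in> X then h j - 1 else h j)" for X
  define inc where "inc X = (\<lambda>j. if j \<in> X then Suc (f j) else f j)" for X
  have count: "(\<Sum>j<n. if j \<in> X then 1 else 0) = int (card ({..<n} \<inter> X))" for X :: "nat set" and n
    by (subst sum.inter_restrict[symmetric]) simp_all
  have wt_dec: "wt (dec X) = wt h - int (card X)" if "X \<subseteq> {..<Suc k}" "\<forall>j\<in>X. s j" for X
  proof -
    have "supp_le (Suc k) (dec X)"
      using hk by (simp add: supp_le_def dec_def)
    moreover have "int (dec X j) = int (h j) - (if j \<in> X then 1 else 0)" for j
      using that(2) by (auto simp: dec_def s_def)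
    ultimately have "wt (dec X) = (\<Sum>j<Suc k. int (h j) - (if j \<in> X then 1 else 0))"
      by (simp only: wt_eq)
    also have "\<dots> = wt h - int (card ({..<Suc k} \<inter> X))"
      using hk by (simp only: sum_subtractf wt_eq count)
    finally show ?thesis
      using that(1) by (simp add: Int_absorb1)
  qed
  have wt_inc: "wt (inc X) = wt f + int (card X)" if "X \<subseteq> {..<Suc k}" for X
  proof -
    have "supp_le (Suc k) (inc X)"
      using fk that by (auto simp: supp_le_def inc_def)
    hence "wt (inc X) = (\<Sum>j<Suc k. int (f j) + (if j \<in> X then 1 else 0))"
      by (subst wt_eq) (auto simp: inc_def intro!: sum.cong)
    also have "\<dots> = wt f + int (card ({..<Suc k} \<inter> X))"
      using fk by (simp only: sum.distrib wt_eq count)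
    finally show ?thesis
      using that(1) by (simp add: Int_absorb1)
  qed
  have "(\<Sum>g | vstrip g h \<and> interl f g. \<beta> ^ nat (wt h - wt g) * p (wt g - wt f)) =
      (\<Sum>X | X \<subseteq> {..<Suc k} \<and> (\<forall>j\<in>X. s j) \<and> (\<forall>j\<in>{..<Suc k}-X. j = 0 \<or> q (j - 1)). p D * t ^ card X)"
  proof (rule sum.reindex_bij_witness[where j = "\<lambda>g. {j. g j < h j}" and i = dec])
    fix g assume "g \<in> {g. vstrip g h \<and> interl f g}"
    hence g: "vstrip g h" "interl f g"
      by auto
    have gj: "g j = h j \<or> Suc (g j) = h j" "f j \<le> g j" "g (Suc j) \<le> f j" for j
      using g by (auto simp: vstrip_def interl_def le_Suc_eq dest: spec[of _ j])
    have *: "dec {j. g j < h j} = g"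
    proof
      fix j show "dec {j. g j < h j} j = g j"
        using gj(1)[of j] by (auto simp: dec_def)
    qed
    thus "dec {j. g j < h j} = g" .
    have X: "{j. g j < h j} \<subseteq> {..<Suc k}"
      using hk unfolding supp_le_def by (auto simp: not_le[symmetric] simp del: not_le)
    have s: "\<forall>j\<in>{j. g j < h j}. s j"
      using gj(2) by (auto simp: s_def intro: le_less_trans)
    have "j = 0 \<or> q (j - 1)" if "\<not> g j < h j" for j
      using gj(1)[of j] gj(3)[of "j - 1"] that by (cases j) (auto simp: q_def)
    thus "{j. g j < h j} \<in> {X. X \<subseteq> {..<Suc k} \<and> (\<forall>j\<in>X. s j) \<and> (\<forall>j\<in>{..<Suc k}-X. j = 0 \<or> q (j - 1))}"
      using X s by auto
    have "wt g = wt h - int (card {j. g j < h j})"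
      using wt_dec[OF X s] * by simp
    thus "p D * t ^ card {j. g j < h j} = \<beta> ^ nat (wt h - wt g) * p (wt g - wt f)"
      by (simp add: D[symmetric]) (simp add: D_def algebra_simps)
  next
    fix X assume "X \<in> {X. X \<subseteq> {..<Suc k} \<and> (\<forall>j\<in>X. s j) \<and> (\<forall>j\<in>{..<Suc k}-X. j = 0 \<or> q (j - 1))}"
    hence X: "X \<subseteq> {..<Suc k}" "\<forall>j\<in>X. s j" "\<And>j. j < Suc k \<Longrightarrow> j \<notin> X \<Longrightarrow> j = 0 \<or> q (j - 1)"
      by auto
    show "{j. dec X j < h j} = X"
      using X(2) by (auto simp: dec_def s_def)
    have "vstrip (dec X) h"
      by (auto simp: vstrip_def dec_def)
    moreover have "interl f (dec X)"
      unfolding interl_def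
    proof
      fix j
      have "f j \<le> dec X j"
        using X(2) True by (auto simp: dec_def s_def)
      moreover have "dec X (Suc j) \<le> f j"
      proof (cases "Suc j \<in> X \<or> \<not> Suc j < Suc k")
        case c: True
        thus ?thesis
          using True[rule_format, of j] hk by (auto simp: dec_def supp_le_def)
      next
        case False
        thus ?thesis
          using X(3)[of "Suc j"] by (auto simp: dec_def q_def)
      qed
      ultimately show "f j \<le> dec X j \<and> dec X (Suc j) \<le> f j" ..
    qed
    ultimately show "dec X \<in> {g. vstrip g h \<and> interl f g}"
      by blast
  qed
  also have "\<dots> = p D * (\<Prod>j<Suc k. (if s j then t else 0) + (if j = 0 \<or> q (j - 1) then 1 else 0))"
    by (simp only: sum_distrib_left[symmetric] sum_subsets_prod[OF finite_lessThan])
  also have "\<dots> = p D * (\<Prod>j<Suc k. (if s j then t else 0) + (if q j then 1 else 0))"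
  proof (subst prod_shift_condition)
    \<comment> \<open>Position \<open>k\<close> lies beyond the support of \<open>h\<close>, so no
      discrepancy is left pending at the end of the product.\<close>
    show "q k"
      using k by (simp add: q_def supp_le_def)
    \<comment> \<open>The failure of \<open>q j\<close> means \<open>f j < h (Suc j)\<close>.
      Monotonicity of \<open>h\<close> then gives \<open>s j\<close>, and that of \<open>f\<close>
      gives \<open>s (Suc j)\<close>.\<close>
    fix j assume "\<not> q j"
    moreover have "h (Suc j) \<le> h j" "f (Suc j) \<le> f j"
      using h f by (simp_all add: antimono_iff_le_Suc)
    ultimately show "s j \<and> s (Suc j)"
      by (auto simp: q_def s_def)
  qed simp
  also have "\<dots> = (\<Sum>X | X \<subseteq> {..<Suc k} \<and> (\<forall>j\<in>X. s j) \<and> (\<forall>j\<in>{..<Suc k}-X. q j). p D * t ^ card X)"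
    by (simp only: sum_distrib_left[symmetric] sum_subsets_prod[OF finite_lessThan])
  also have "\<dots> = (\<Sum>g | interl g h \<and> vstrip f g. p (wt h - wt g) * \<beta> ^ nat (wt g - wt f))"
  proof (rule sum.reindex_bij_witness[where i = "\<lambda>g. {j. f j < g j}" and j = inc])
    fix g assume "g \<in> {g. interl g h \<and> vstrip f g}"
    hence g: "interl g h" "vstrip f g"
      by auto
    have gj: "g j = f j \<or> g j = Suc (f j)" "g j \<le> h j" "h (Suc j) \<le> g j" for j
      using g by (auto simp: vstrip_def interl_def le_Suc_eq dest: spec[of _ j])
    show "inc {j. f j < g j} = g"
    proof
      fix j show "inc {j. f j < g j} j = g j"
        using gj(1)[of j] by (auto simp: inc_def)
    qed
    have X: "{j. f j < g j} \<subseteq> {..<Suc k}"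
      using interl_supp_le[OF g(1) hk] unfolding supp_le_def by (auto simp: not_le[symmetric] simp del: not_le)
    have s: "\<forall>j\<in>{j. f j < g j}. s j"
      using gj(2) by (auto simp: s_def intro: less_le_trans)
    have "q j" if "\<not> f j < g j" for j
      using gj(1)[of j] gj(3)[of j] that by (auto simp: q_def)
    thus "{j. f j < g j} \<in> {X. X \<subseteq> {..<Suc k} \<and> (\<forall>j\<in>X. s j) \<and> (\<forall>j\<in>{..<Suc k}-X. q j)}"
      using X s by auto
  next
    fix X assume "X \<in> {X. X \<subseteq> {..<Suc k} \<and> (\<forall>j\<in>X. s j) \<and> (\<forall>j\<in>{..<Suc k}-X. q j)}"
    hence X: "X \<subseteq> {..<Suc k}" "\<forall>j\<in>X. s j" "\<And>j. j < Suc k \<Longrightarrow> j \<notin> X \<Longrightarrow> q j"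
      by auto
    show "{j. f j < inc X j} = X"
      by (auto simp: inc_def)
    have "vstrip f (inc X)"
      by (auto simp: vstrip_def inc_def)
    moreover have "interl (inc X) h"
      unfolding interl_def
    proof
      fix j
      have "inc X j \<le> h j"
        using X(2) True by (auto simp: inc_def s_def Suc_le_eq)
      moreover have "h (Suc j) \<le> inc X j"
        using True[rule_format, of j] X(3)[of j] hk by (cases "j < Suc k") (auto simp: inc_def q_def supp_le_def)
      ultimately show "inc X j \<le> h j \<and> h (Suc j) \<le> inc X j" ..
    qed
    ultimately show "inc X \<in> {g. interl g h \<and> vstrip f g}"
      by blast
    show "p (wt h - wt (inc X)) * \<beta> ^ nat (wt (inc X) - wt f) = p D * t ^ card X"
      by (simp add: D[symmetric] wt_inc[OF X(1)]) (simp add: D_def algebra_simps)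
  qed
  finally show ?thesis .
qed

text \<open>Interchange of summation reduces this to the kernel identity for a fixed inner row
  \<open>f\<close>, which requires \<open>f\<close> to be weakly decreasing. Removing a vertical
  strip need not leave such a row, hence the vanishing condition on \<open>F\<close>.\<close>

lemma vstrip_op_strip_op:
  fixes F :: "(nat \<Rightarrow> nat) \<Rightarrow> 'r::comm_ring_1"
  assumes p: "additive_char p" and fin: "finsupp h" and h: "antimono h"
    and F: "\<And>f. \<not> antimono f \<Longrightarrow> F f = 0"
  shows "vstrip_op \<beta> (strip_op p F) h = strip_op p (vstrip_op \<beta> F) h"
proof -
  let ?B = "{f. \<forall>j. f j \<le> h j}"
  have B: "finite ?B"
    using fin by (rule finite_rows_le)
  have "vstrip_op \<beta> (strip_op p F) h =
      (\<Sum>g | vstrip g h. \<Sum>f\<in>{f\<in>?B. interl f g}. \<beta> ^ nat (wt h - wt g) * p (wt g - wt f) * F f)"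
    unfolding vstrip_op_def strip_op_def sum_distrib_left mult.assoc
    by (intro sum.cong) (auto simp: vstrip_def interl_def intro: order_trans)
  also have "\<dots> = (\<Sum>f\<in>?B. \<Sum>g\<in>{g\<in>{g. vstrip g h}. interl f g}. \<beta> ^ nat (wt h - wt g) * p (wt g - wt f) * F f)"
    by (rule sum.swap_restrict[OF finite_vstrip[OF fin] B])
  also have "\<dots> = (\<Sum>f\<in>?B. \<Sum>g\<in>{g\<in>{g. interl g h}. vstrip f g}. p (wt h - wt g) * \<beta> ^ nat (wt g - wt f) * F f)"
  proof (rule sum.cong[OF refl])
    fix f
    show "(\<Sum>g\<in>{g\<in>{g. vstrip g h}. interl f g}. \<beta> ^ nat (wt h - wt g) * p (wt g - wt f) * F f) =
        (\<Sum>g\<in>{g\<in>{g. interl g h}. vstrip f g}. p (wt h - wt g) * \<beta> ^ nat (wt g - wt f) * F f)"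
      using vstrip_interl_kernel[OF p fin h, of f \<beta>] F[of f]
      by (cases "antimono f") (simp_all flip: sum_distrib_right)
  qed
  also have "\<dots> = (\<Sum>g | interl g h. \<Sum>f\<in>{f\<in>?B. vstrip f g}. p (wt h - wt g) * \<beta> ^ nat (wt g - wt f) * F f)"
    by (rule sum.swap_restrict[OF finite_interl[OF fin] B, symmetric])
  also have "\<dots> = strip_op p (vstrip_op \<beta> F) h"
    unfolding vstrip_op_def strip_op_def sum_distrib_left mult.assoc
    by (intro sum.cong) (auto simp: vstrip_def interl_def intro: order_trans)
  finally show ?thesis .
qed

text \<open>Lowering an odd end by 1/2 adds 1/2 to the exponent in each of the two row differences
  of its variable, so an atypical end costs \<open>\<beta> * p 1\<close>. It exists only if the
  rounded-up end is positive, as entries are non-negative.\<close>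

definition beta_pat :: "'r::comm_ring_1 \<Rightarrow> (int \<Rightarrow> 'r) list \<Rightarrow> (nat \<Rightarrow> nat) \<Rightarrow> 'r" where
  "beta_pat \<beta> ps = pat (map (\<lambda>p. (p, \<lambda>b. if b then 1 + \<beta> * p 1 else 1)) ps)"

lemma beta_pat_Cons:
  "beta_pat \<beta> (p # ps) f = strip_op p (\<lambda>g. (if 0 < g (length ps) then 1 + \<beta> * p 1 else 1) *
     strip_op (inv_char p) (trunc (length ps) (beta_pat \<beta> ps)) g) f"
  by (simp add: beta_pat_def)

lemma sp_pat_eq_0: "\<not> antimono f \<Longrightarrow> sp_pat ps f = 0"
proof (cases ps)
  case Nil
  assume "\<not> antimono f"
  hence "f \<noteq> (\<lambda>_. 0)"
    by (auto simp: antimono_def)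
  thus ?thesis
    by (simp add: Nil sp_pat_Nil)
next
  case (Cons p ps)
  assume "\<not> antimono f"
  thus ?thesis
    unfolding Cons sp_pat_Cons using interl_antimono by (intro strip_op_eq_0) blast
qed

text \<open>The inner row has entry 0 at position \<open>k\<close>, and a vertical strip removes at
  most one box there. So \<open>f k\<close> is 0, or it is 1 and its removal is forced at the price
  \<open>\<beta>\<close>.\<close>

lemma vstrip_op_trunc:
  assumes f: "supp_le (Suc k) f"
  shows "vstrip_op \<beta> (trunc k F) f =
    (if f k = 0 then vstrip_op \<beta> F f else if f k = 1 then \<beta> * vstrip_op \<beta> F (f(k := 0)) else 0)"
proof -
  have k: "supp_le k g \<longleftrightarrow> g k = 0" if "supp_le (Suc k) g" for g
    using that unfolding supp_le_def by (metis le_antisym not_less_eq_eq order_refl)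
  consider "f k = 0" | "f k = 1" | "1 < f k"
    by linarith
  thus ?thesis
  proof cases
    case 1
    hence "supp_le k f"
      using f k by simp
    thus ?thesis
      using 1 vstrip_supp_le by (auto simp: trunc_def intro!: vstrip_op_cong)
  next
    case 2
    let ?f = "f(k := 0)"
    have s: "supp_le k ?f" "supp_le (Suc k) ?f"
      using f k[of ?f] by (auto simp: supp_le_def)
    have wt: "wt f = wt ?f + 1"
      using f s(2) 2 by (simp add: wt_eq)
    have fin: "finite {g. vstrip g f}"
      using f by (intro finite_vstrip finsuppI)
    have eq: "vstrip g f \<and> supp_le k g \<longleftrightarrow> vstrip g ?f" for g
    proof
      assume g: "vstrip g f \<and> supp_le k g"
      hence "g k = 0"
        by (simp add: supp_le_def)
      thus "vstrip g ?f"
        using g by (auto simp: vstrip_def)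
    next
      assume g: "vstrip g ?f"
      hence "supp_le k g"
        using s(1) vstrip_supp_le by blast
      moreover have "vstrip g f"
        using g 2 \<open>supp_le k g\<close> unfolding vstrip_def supp_le_def
        by (metis One_nat_def fun_upd_apply le_refl le_zero_eq zero_le)
      ultimately show "vstrip g f \<and> supp_le k g"
        by blast
    qed
    have "vstrip_op \<beta> (trunc k F) f = (\<Sum>g | vstrip g f \<and> supp_le k g. \<beta> ^ nat (wt f - wt g) * F g)"
      unfolding vstrip_op_def by (rule sum.mono_neutral_cong_right) (use fin in \<open>auto simp: trunc_def\<close>)
    also have "\<dots> = (\<Sum>g | vstrip g ?f. \<beta> * (\<beta> ^ nat (wt ?f - wt g) * F g))"
    proof (rule sum.cong)
      fix g assume "g \<in> {g. vstrip g ?f}"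
      hence g: "vstrip g ?f"
        by simp
      have "wt g \<le> wt ?f"
        using g vstrip_supp_le[OF g s(1)] s(1)
        by (simp only: wt_eq) (auto simp: vstrip_def intro!: sum_mono simp del: fun_upd_apply)
      hence "nat (wt f - wt g) = Suc (nat (wt ?f - wt g))"
        using wt by simp
      thus "\<beta> ^ nat (wt f - wt g) * F g = \<beta> * (\<beta> ^ nat (wt ?f - wt g) * F g)"
        by (simp add: mult.assoc)
    qed (use eq in auto)
    finally show ?thesis
      using 2 by (simp add: vstrip_op_def sum_distrib_left)
  next
    case 3
    have "trunc k F g = 0" if "vstrip g f" for g
    proof -
      have "g k \<noteq> 0"
        using that 3 unfolding vstrip_def by (metis One_nat_def leD)
      thus ?thesis
        by (auto simp: trunc_def supp_le_def)
    qed
    thus ?thesis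
      using 3 by (simp add: vstrip_op_def)
  qed
qed

text \<open>Origin of the factor in \<open>beta_pat\<close>: exchanging the vertical strip with the
  truncation lets the row below \<open>g\<close> have entry 0 or 1 at position \<open>k\<close>. The
  value 1 is possible exactly if \<open>0 < g k\<close>; compared with the row that has 0 there, it
  contributes \<open>\<beta>\<close> for the forced box and \<open>p 1\<close> for the changed strip
  size.\<close>

lemma strip_op_vstrip_op_trunc:
  assumes p: "additive_char p" and g: "supp_le (Suc k) g"
  shows "strip_op (inv_char p) (vstrip_op \<beta> (trunc k F)) g =
    (if 0 < g k then 1 + \<beta> * p 1 else 1) * strip_op (inv_char p) (trunc k (vstrip_op \<beta> F)) g"
proof -
  let ?V = "vstrip_op \<beta> F"
  have k: "supp_le k f \<longleftrightarrow> f k = 0" if "supp_le (Suc k) f" for f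
    using that unfolding supp_le_def by (metis le_antisym not_less_eq_eq order_refl)
  have sup: "supp_le (Suc k) f" if "interl f g" for f
    using that g by (rule interl_supp_le)
  have fin: "finite {f. interl f g}"
    using g by (intro finite_interl finsuppI)
  have T: "strip_op (inv_char p) (trunc k ?V) g = (\<Sum>f | interl f g \<and> f k = 0. p (wt f - wt g) * ?V f)"
    unfolding strip_op_def by (rule sum.mono_neutral_cong_right) (use fin k sup in \<open>auto simp: trunc_def\<close>)
  have "strip_op (inv_char p) (vstrip_op \<beta> (trunc k F)) g =
      (\<Sum>f | interl f g. (if f k = 0 then p (wt f - wt g) * ?V f else 0) +
        (if f k = 1 then p (wt f - wt g) * (\<beta> * ?V (f(k := 0))) else 0))"
    unfolding strip_op_def by (rule sum.cong) (auto simp: vstrip_op_trunc[OF sup])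
  also have "\<dots> = (\<Sum>f | interl f g \<and> f k = 0. p (wt f - wt g) * ?V f) +
      (\<Sum>f | interl f g \<and> f k = 1. p (wt f - wt g) * (\<beta> * ?V (f(k := 0))))"
    by (simp only: sum.distrib sum.inter_filter[OF fin, symmetric] mem_Collect_eq)
  also have "(\<Sum>f | interl f g \<and> f k = 1. p (wt f - wt g) * (\<beta> * ?V (f(k := 0)))) =
      (if 0 < g k then \<Sum>f | interl f g \<and> f k = 0. \<beta> * p 1 * (p (wt f - wt g) * ?V f) else 0)"
  proof (cases "0 < g k")
    case True
    have il: "interl (f(k := 1)) g \<longleftrightarrow> interl f g" if "f k = 0" for f
    proof -
      have "(f(k := 1)) j \<le> g j \<and> g (Suc j) \<le> (f(k := 1)) j \<longleftrightarrow> f j \<le> g j \<and> g (Suc j) \<le> f j" for j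
        using that True g by (auto simp: supp_le_def)
      thus ?thesis
        by (simp add: interl_def)
    qed
    have "(\<Sum>f | interl f g \<and> f k = 1. p (wt f - wt g) * (\<beta> * ?V (f(k := 0)))) =
        (\<Sum>f | interl f g \<and> f k = 0. \<beta> * p 1 * (p (wt f - wt g) * ?V f))"
    proof (rule sum.reindex_bij_witness[of _ "\<lambda>f. f(k := 1)" "\<lambda>f. f(k := 0)"])
      fix f assume f: "f \<in> {f. interl f g \<and> f k = 1}"
      thus "f(k := 0, k := 1) = f"
        by auto
      have il': "interl (f(k := 0)) g"
        using f il[of "f(k := 0)"] by (metis (mono_tags) fun_upd_same fun_upd_triv fun_upd_upd mem_Collect_eq)
      thus "f(k := 0) \<in> {f. interl f g \<and> f k = 0}"
        by simp
      have "wt f = wt (f(k := 0)) + 1"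
        using f sup[of f] sup[OF il'] by (simp add: wt_eq)
      hence "wt f - wt g = 1 + (wt (f(k := 0)) - wt g)"
        by simp
      hence "p (wt f - wt g) = p 1 * p (wt (f(k := 0)) - wt g)"
        using p unfolding additive_char_def by metis
      thus "\<beta> * p 1 * (p (wt (f(k := 0)) - wt g) * ?V (f(k := 0))) = p (wt f - wt g) * (\<beta> * ?V (f(k := 0)))"
        by (simp add: mult_ac)
    qed (use il in auto)
    thus ?thesis
      using True by simp
  next
    case False
    have "f k = 0" if "interl f g" for f
      using that False unfolding interl_def by (metis le_zero_eq not_gr_zero)
    hence "{f. interl f g \<and> f k = 1} = {}"
      by fastforce
    thus ?thesis
      using False by (simp only: sum.empty if_False)
  qed
  finally show ?thesis
    by (simp add: T sum_distrib_left[symmetric] distrib_right)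
qed

text \<open>By induction the vertical strip starts below the head variable. Passing it outward
  through the truncation absorbs the end factor; it then commutes with both horizontal
  strips.\<close>

lemma beta_pat_eq_vstrip_op:
  assumes "\<forall>p\<in>set ps. additive_char p" "supp_le (length ps) f" "antimono f"
  shows "beta_pat \<beta> ps f = vstrip_op \<beta> (sp_pat ps) f"
  using assms
proof (induction ps arbitrary: f)
  case Nil
  hence "f = (\<lambda>_. 0)"
    by (auto simp: supp_le_def)
  moreover have "vstrip g (\<lambda>_. 0) \<longleftrightarrow> g = (\<lambda>_. 0)" for g
    by (auto simp: vstrip_def)
  ultimately show ?case
    by (simp add: beta_pat_def sp_pat_Nil vstrip_op_def)
next
  case (Cons p ps)
  let ?k = "length ps" and ?F = "trunc (length ps) (sp_pat ps)"
  have p: "additive_char p"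
    using Cons.prems by simp
  note p' = additive_char_inv_char[OF p]
  have F0: "?F f = 0" if "\<not> antimono f" for f
    using that sp_pat_eq_0 by (auto simp: trunc_def)
  have G0: "strip_op (inv_char p) ?F f = 0" if "\<not> antimono f" for f
    using that interl_antimono by (intro strip_op_eq_0) blast
  have "beta_pat \<beta> (p # ps) f = strip_op p (strip_op (inv_char p) (vstrip_op \<beta> ?F)) f"
    unfolding beta_pat_Cons
  proof (rule strip_op_cong)
    fix g
    assume g: "interl g f"
    have "supp_le (Suc ?k) g"
      using g Cons.prems interl_supp_le[of g f "Suc ?k"] by simp
    hence "strip_op (inv_char p) (vstrip_op \<beta> ?F) g =
        (if 0 < g ?k then 1 + \<beta> * p 1 else 1) * strip_op (inv_char p) (trunc ?k (vstrip_op \<beta> (sp_pat ps))) g"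
      by (rule strip_op_vstrip_op_trunc[OF p])
    also have "strip_op (inv_char p) (trunc ?k (vstrip_op \<beta> (sp_pat ps))) g =
        strip_op (inv_char p) (trunc ?k (beta_pat \<beta> ps)) g"
    proof (rule strip_op_cong)
      fix e assume "interl e g"
      hence "antimono e"
        unfolding antimono_iff_le_Suc interl_def by (meson order_trans)
      thus "trunc ?k (vstrip_op \<beta> (sp_pat ps)) e = trunc ?k (beta_pat \<beta> ps) e"
        using Cons by (simp add: trunc_def)
    qed
    finally show "(if 0 < g ?k then 1 + \<beta> * p 1 else 1) * strip_op (inv_char p) (trunc ?k (beta_pat \<beta> ps)) g =
        strip_op (inv_char p) (vstrip_op \<beta> ?F) g" ..
  qed
  also have "\<dots> = strip_op p (vstrip_op \<beta> (strip_op (inv_char p) ?F)) f"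
  proof (rule strip_op_cong)
    fix g assume g: "interl g f"
    have "finsupp g"
      using g Cons.prems(2) finsuppI interl_finsupp by blast
    moreover have "antimono g"
      using g unfolding antimono_iff_le_Suc interl_def by (meson order_trans)
    ultimately show "strip_op (inv_char p) (vstrip_op \<beta> ?F) g = vstrip_op \<beta> (strip_op (inv_char p) ?F) g"
      using F0 by (intro vstrip_op_strip_op[OF p', symmetric])
  qed
  also have "\<dots> = vstrip_op \<beta> (strip_op p (strip_op (inv_char p) ?F)) f"
    using Cons.prems G0 by (intro vstrip_op_strip_op[OF p, symmetric] finsuppI)
  also have "\<dots> = vstrip_op \<beta> (sp_pat (p # ps)) f"
    by (simp add: sp_pat_Cons[abs_def])
  finally show ?case .
qed

lemma beta_pat_rev:
  assumes "\<forall>p\<in>set ps. additive_char p" "supp_le (length ps) f" "antimono f"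
  shows "beta_pat \<beta> (rev ps) f = beta_pat \<beta> ps f"
proof -
  have "vstrip_op \<beta> (sp_pat (rev ps)) f = vstrip_op \<beta> (sp_pat ps) f"
    using assms vstrip_supp_le by (intro vstrip_op_cong sp_pat_rev) auto
  thus ?thesis
    using assms by (simp add: beta_pat_eq_vstrip_op)
qed

section \<open>Cutting patterns of rectangular shape\<close>

definition prepend :: "nat \<Rightarrow> nat \<Rightarrow> (nat \<Rightarrow> nat) \<Rightarrow> nat \<Rightarrow> nat" where
  "prepend a u f = (\<lambda>j. if j < a then u else f (j - a))"

definition rows_in :: "nat \<Rightarrow> nat \<Rightarrow> (nat \<Rightarrow> nat) set" where
  "rows_in k u = {f. supp_le k f \<and> antimono f \<and> f 0 \<le> u}"

lemma prepend_add [simp]: "prepend a u f (a + j) = f j"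
  by (simp add: prepend_def)

lemma inj_prepend: "inj (prepend a u)"
  unfolding inj_def by (metis ext prepend_add)

lemma supp_le_prepend: "supp_le (a + k) (prepend a u f) \<longleftrightarrow> supp_le k f"
proof
  assume "supp_le (a + k) (prepend a u f)"
  thus "supp_le k f"
    unfolding supp_le_def by (metis nat_add_left_cancel_le prepend_add)
qed (auto simp: supp_le_def prepend_def)

lemma wt_prepend:
  assumes "finsupp f"
  shows "wt (prepend a u f) = int a * int u + wt f"
proof -
  obtain k where k: "supp_le k f"
    using assms by (auto simp: finsupp_def)
  have "wt (prepend a u f) = (\<Sum>j<a + k. int (prepend a u f j))"
    using k by (simp only: wt_eq supp_le_prepend)
  also have "\<dots> = (\<Sum>j<a. int (prepend a u f j)) + (\<Sum>j<k. int (prepend a u f (a + j)))"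
    by (induction k) simp_all
  also have "\<dots> = int a * int u + wt f"
    using k by (simp add: wt_eq) (simp add: prepend_def)
  finally show ?thesis .
qed

text \<open>The mechanism of the cut: when one \<open>u\<close> is dropped, interlacing turns round,
  and the free part of the upper row lies below the free part of the lower row. The new first entry
  is bounded only by \<open>u\<close>.\<close>

lemma interl_prepend:
  "interl (prepend a u g) (prepend (Suc a) u f) \<longleftrightarrow> interl f g \<and> g 0 \<le> u"
proof
  assume *: "interl (prepend a u g) (prepend (Suc a) u f)"
  have "f j \<le> g j \<and> g (Suc j) \<le> f j" for j
    using *[unfolded interl_def, rule_format, of "a + j"] *[unfolded interl_def, rule_format, of "a + Suc j"]
    by (auto simp: prepend_def)
  moreover have "g 0 \<le> u"
    using *[unfolded interl_def, rule_format, of a] by (auto simp: prepend_def)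
  ultimately show "interl f g \<and> g 0 \<le> u"
    by (simp add: interl_def)
next
  assume *: "interl f g \<and> g 0 \<le> u"
  have "prepend a u g j \<le> prepend (Suc a) u f j \<and> prepend (Suc a) u f (Suc j) \<le> prepend a u g j" for j
  proof (cases "j < a")
    case False
    then obtain i where j: "j = a + i"
      using le_Suc_ex not_less by blast
    show ?thesis
      using * unfolding j interl_def by (cases i) (auto simp: prepend_def)
  qed (auto simp: prepend_def)
  thus "interl (prepend a u g) (prepend (Suc a) u f)"
    by (simp add: interl_def)
qed

lemma interl_prepend_eq:
  "{g. interl g (prepend (Suc a) u f)} = prepend a u ` {g. interl f g \<and> g 0 \<le> u}"
proof
  show "{g. interl g (prepend (Suc a) u f)} \<subseteq> prepend a u ` {g. interl f g \<and> g 0 \<le> u}"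
  proof
    fix g
    assume g: "g \<in> {g. interl g (prepend (Suc a) u f)}"
    \<comment> \<open>The entry is squeezed between the entries \<open>j\<close> and
      \<open>Suc j\<close> of the row above, which both equal \<open>u\<close>.\<close>
    have "g j = u" if "j < a" for j
    proof -
      have "g j \<le> prepend (Suc a) u f j \<and> prepend (Suc a) u f (Suc j) \<le> g j"
        using g by (simp add: interl_def)
      thus ?thesis
        using that by (simp add: prepend_def)
    qed
    hence "g = prepend a u (\<lambda>j. g (a + j))"
      by (auto simp: prepend_def fun_eq_iff)
    moreover from this have "interl f (\<lambda>j. g (a + j)) \<and> g (a + 0) \<le> u"
      using g interl_prepend[of a u "\<lambda>j. g (a + j)" f] by simp
    ultimately show "g \<in> prepend a u ` {g. interl f g \<and> g 0 \<le> u}"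
      by blast
  qed
qed (use interl_prepend in blast)

text \<open>The sum over rows below becomes a sum over free parts above \<open>f\<close>. The two
  rows differ by one prepended entry, hence the \<open>int u\<close> in the exponent.\<close>

lemma strip_op_prepend:
  assumes "finsupp f"
  shows "strip_op p F (prepend (Suc a) u f) =
    (\<Sum>g | interl f g \<and> g 0 \<le> u. p (int u + wt f - wt g) * F (prepend a u g))"
proof -
  have "strip_op p F (prepend (Suc a) u f) =
      (\<Sum>g | interl f g \<and> g 0 \<le> u. p (wt (prepend (Suc a) u f) - wt (prepend a u g)) * F (prepend a u g))"
    unfolding strip_op_def interl_prepend_eq
    by (subst sum.reindex) (auto intro: inj_on_subset[OF inj_prepend])
  also have "\<dots> = (\<Sum>g | interl f g \<and> g 0 \<le> u. p (int u + wt f - wt g) * F (prepend a u g))"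
  proof (rule sum.cong[OF refl])
    fix g assume g: "g \<in> {g. interl f g \<and> g 0 \<le> u}"
    have "finsupp g"
      using g assms interl_supp_le_Suc unfolding finsupp_def by blast
    hence "wt (prepend (Suc a) u f) - wt (prepend a u g) = int u + wt f - wt g"
      using assms by (simp add: wt_prepend algebra_simps)
    thus "p (wt (prepend (Suc a) u f) - wt (prepend a u g)) * F (prepend a u g) =
        p (int u + wt f - wt g) * F (prepend a u g)"
      by simp
  qed
  finally show ?thesis .
qed

lemma finite_rows_in: "finite (rows_in k u)"
proof (rule finite_subset)
  show "rows_in k u \<subseteq> {f. \<forall>j. f j \<le> (if j < k then u else 0)}"
    by (auto simp: rows_in_def supp_le_def antimono_def intro: order_trans)
  show "finite {f. \<forall>j. f j \<le> (if j < k then u else 0)}"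
    by (rule finite_rows_le, rule finsuppI[of k]) (simp add: supp_le_def)
qed

lemma interl_antimono_below: "interl f g \<Longrightarrow> antimono f"
  unfolding antimono_iff_le_Suc interl_def by (meson order_trans)

lemma rows_in_above:
  assumes "f \<in> rows_in k u"
  shows "{g. interl f g \<and> g 0 \<le> u} = {g \<in> rows_in (Suc k) u. interl f g}"
  using assms interl_antimono interl_supp_le_Suc by (auto simp: rows_in_def)

lemma rows_in_below:
  assumes "g \<in> rows_in l u"
  shows "{f. interl f g \<and> supp_le k f} = {f \<in> rows_in k u. interl f g}"
  using assms interl_antimono_below by (auto simp: rows_in_def interl_def intro: order_trans)

lemma rows_in_below':
  assumes "g \<in> rows_in k u"
  shows "{f. interl f g} = {f \<in> rows_in k u. interl f g}"
  using rows_in_below[OF assms, of k] assms interl_supp_le by (auto simp: rows_in_def)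

lemma rows_in_finsupp: "f \<in> rows_in k u \<Longrightarrow> finsupp f"
  by (auto simp: rows_in_def intro: finsuppI)

lemma strip_op_trunc_sum:
  assumes "finsupp g"
  shows "strip_op p (trunc k F) g = (\<Sum>f | interl f g \<and> supp_le k f. p (wt g - wt f) * F f)"
  unfolding strip_op_def
  by (rule sum.mono_neutral_cong_right) (use finite_interl[OF assms] in \<open>auto simp: trunc_def\<close>)

text \<open>The induction removes the variable of \<open>ys\<close> next to the cut and moves its
  two strips from the \<open>xs\<close> side to the reversed side. Turning the strips round
  exchanges the outer rows \<open>f\<close> and \<open>h\<close>, but the exponent
  \<open>wt h + wt f - 2 * wt g\<close> is symmetric in them, so the variable is not inverted. The
  odd end is the entry \<open>g m\<close> on both sides.\<close>

lemma pat_cut: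
  assumes "\<forall>(p, \<phi>)\<in>set ys. additive_char p" "length xs = a + length ys"
  shows "pat (ys @ xs) (prepend (a + 2 * length ys) u (\<lambda>_. 0)) =
    (\<Sum>f\<in>rows_in (length ys) u. pat (rev ys) f * pat xs (prepend a u f))"
  using assms
proof (induction ys arbitrary: a xs rule: rev_induct)
  case Nil
  have "rows_in 0 u = {\<lambda>_. 0}"
    by (auto simp: rows_in_def supp_le_def antimono_def)
  thus ?case
    by simp
next
  case (snoc y ys)
  obtain p \<phi> where y: "y = (p, \<phi>)"
    by fastforce
  have p: "additive_char p"
    using snoc.prems by (auto simp: y)
  define m where "m = length ys"
  define A where "A = rows_in m u"
  define B where "B = rows_in (Suc m) u"
  have A: "finite A" and B: "finite B"
    by (simp_all add: A_def B_def finite_rows_in)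
  define T where "T f g h = pat (rev ys) f * p (wt h + wt f - 2 * wt g) * \<phi> (0 < g m) *
    pat xs (prepend a u h)" for f g h
  have len: "length xs = a + Suc m"
    using snoc.prems by (simp add: m_def)
  \<comment> \<open>With \<open>y\<close> counted among the variables below the cut, the row there
    is longer by one and its free part shorter by one, so two more entries equal
    \<open>u\<close>.\<close>
  have "pat (ys @ y # xs) (prepend (Suc (Suc a) + 2 * length ys) u (\<lambda>_. 0)) =
      (\<Sum>f\<in>rows_in (length ys) u. pat (rev ys) f * pat (y # xs) (prepend (Suc (Suc a)) u f))"
    by (rule snoc.IH) (use snoc.prems in auto)
  also have "\<dots> = (\<Sum>f\<in>A. \<Sum>g\<in>{g\<in>B. interl f g}. \<Sum>h\<in>{h\<in>B. interl g h}. T f g h)"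
    unfolding A_def m_def[symmetric]
  proof (rule sum.cong[OF refl])
    fix f assume f: "f \<in> rows_in m u"
    have "pat (y # xs) (prepend (Suc (Suc a)) u f) =
        (\<Sum>g\<in>{g\<in>B. interl f g}. p (int u + wt f - wt g) * (\<phi> (0 < prepend (Suc a) u g (length xs)) *
          strip_op (inv_char p) (trunc (length xs) (pat xs)) (prepend (Suc a) u g)))"
      unfolding y pat.simps B_def rows_in_above[OF f, symmetric]
      using f rows_in_finsupp by (subst strip_op_prepend) auto
    also have "\<dots> = (\<Sum>g\<in>{g\<in>B. interl f g}. p (int u + wt f - wt g) * (\<phi> (0 < g m) *
        (\<Sum>h\<in>{h\<in>B. interl g h}. p (- (int u + wt g - wt h)) * pat xs (prepend a u h))))"
    proof (rule sum.cong[OF refl])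
      fix g assume g: "g \<in> {g\<in>B. interl f g}"
      have gB: "g \<in> B"
        using g by simp
      have "strip_op (inv_char p) (trunc (length xs) (pat xs)) (prepend (Suc a) u g) =
          (\<Sum>h | interl g h \<and> h 0 \<le> u. p (- (int u + wt g - wt h)) * trunc (length xs) (pat xs) (prepend a u h))"
        using gB by (intro strip_op_prepend) (auto simp: B_def intro: rows_in_finsupp)
      also have "{h. interl g h \<and> h 0 \<le> u} = {h\<in>rows_in (Suc (Suc m)) u. interl g h}"
        using gB rows_in_above by (simp add: B_def)
      \<comment> \<open>Interlacing alone allows \<open>Suc (Suc m)\<close> free entries in
        \<open>h\<close>; truncation at \<open>length xs = a + Suc m\<close> leaves
        \<open>Suc m\<close> of them.\<close>
      also have "(\<Sum>h\<in>\<dots>. p (- (int u + wt g - wt h)) * trunc (length xs) (pat xs) (prepend a u h)) =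
          (\<Sum>h\<in>{h\<in>B. interl g h}. p (- (int u + wt g - wt h)) * pat xs (prepend a u h))"
        unfolding len
        by (rule sum.mono_neutral_cong_right, simp add: finite_rows_in)
          (auto simp: trunc_def supp_le_prepend B_def rows_in_def intro: supp_le_mono
            simp del: add_Suc_right)
      moreover have "prepend (Suc a) u g (length xs) = g m"
        using prepend_add[of "Suc a" u g m] by (simp add: len)
      ultimately show "p (int u + wt f - wt g) * (\<phi> (0 < prepend (Suc a) u g (length xs)) *
          strip_op (inv_char p) (trunc (length xs) (pat xs)) (prepend (Suc a) u g)) =
        p (int u + wt f - wt g) * (\<phi> (0 < g m) *
          (\<Sum>h\<in>{h\<in>B. interl g h}. p (- (int u + wt g - wt h)) * pat xs (prepend a u h)))"
        by simp
    qed
    finally have "pat (rev ys) f * pat (y # xs) (prepend (Suc (Suc a)) u f) =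
      (\<Sum>g\<in>{g\<in>B. interl f g}. \<Sum>h\<in>{h\<in>B. interl g h}. pat (rev ys) f *
         (p (int u + wt f - wt g) * (\<phi> (0 < g m) * (p (- (int u + wt g - wt h)) * pat xs (prepend a u h)))))"
      by (simp only: sum_distrib_left)
    \<comment> \<open>The two contributions of \<open>u\<close>, one from each strip,
      cancel.\<close>
    moreover have "p (wt h + wt f - 2 * wt g) = p (int u + wt f - wt g) * p (- (int u + wt g - wt h))" for g h
    proof -
      have "wt h + wt f - 2 * wt g = (int u + wt f - wt g) + (- (int u + wt g - wt h))"
        by simp
      thus ?thesis
        using p unfolding additive_char_def by metis
    qed
    ultimately show "pat (rev ys) f * pat (y # xs) (prepend (Suc (Suc a)) u f) =
        (\<Sum>g\<in>{g\<in>B. interl f g}. \<Sum>h\<in>{h\<in>B. interl g h}. T f g h)"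
      by (simp add: T_def mult_ac)
  qed
  \<comment> \<open>The order of summation is reversed from \<open>f\<close>, \<open>g\<close>,
    \<open>h\<close> to \<open>h\<close>, \<open>g\<close>, \<open>f\<close>, since \<open>h\<close>
    is the shape at the new cut and \<open>f\<close> becomes its innermost row.\<close>
  also have "\<dots> = (\<Sum>g\<in>B. \<Sum>f\<in>{f\<in>A. interl f g}. \<Sum>h\<in>{h\<in>B. interl g h}. T f g h)"
    by (rule sum.swap_restrict[OF A B])
  also have "\<dots> = (\<Sum>g\<in>B. \<Sum>h\<in>{h\<in>B. interl g h}. \<Sum>f\<in>{f\<in>A. interl f g}. T f g h)"
    by (rule sum.cong[OF refl]) (rule sum.swap)
  also have "\<dots> = (\<Sum>h\<in>B. \<Sum>g\<in>{g\<in>B. interl g h}. \<Sum>f\<in>{f\<in>A. interl f g}. T f g h)"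
    by (rule sum.swap_restrict[OF B B])
  also have "\<dots> = (\<Sum>h\<in>B. pat (rev (ys @ [y])) h * pat xs (prepend a u h))"
  proof (rule sum.cong[OF refl])
    fix h assume h: "h \<in> B"
    have "pat (rev (ys @ [y])) h = (\<Sum>g\<in>{g\<in>B. interl g h}. p (wt h - wt g) * (\<phi> (0 < g m) *
        (\<Sum>f\<in>{f\<in>A. interl f g}. p (- (wt g - wt f)) * pat (rev ys) f)))"
    proof -
      have "pat (rev (ys @ [y])) h = (\<Sum>g\<in>{g\<in>B. interl g h}. p (wt h - wt g) * (\<phi> (0 < g m) *
          strip_op (inv_char p) (trunc m (pat (rev ys))) g))"
        using h rows_in_below'[of h "Suc m" u]
        by (simp add: y strip_op_def[of p] m_def[symmetric] B_def)
      also have "\<dots> = (\<Sum>g\<in>{g\<in>B. interl g h}. p (wt h - wt g) * (\<phi> (0 < g m) *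
          (\<Sum>f\<in>{f\<in>A. interl f g}. p (- (wt g - wt f)) * pat (rev ys) f)))"
        by (intro sum.cong refl)
           (auto simp: strip_op_trunc_sum rows_in_finsupp rows_in_below B_def A_def)
      finally show ?thesis .
    qed
    hence "pat (rev (ys @ [y])) h * pat xs (prepend a u h) =
        (\<Sum>g\<in>{g\<in>B. interl g h}. \<Sum>f\<in>{f\<in>A. interl f g}. p (wt h - wt g) * (\<phi> (0 < g m) *
          (p (- (wt g - wt f)) * pat (rev ys) f)) * pat xs (prepend a u h))"
      by (simp only: sum_distrib_left sum_distrib_right)
    moreover have "p (wt h + wt f - 2 * wt g) = p (wt h - wt g) * p (- (wt g - wt f))" for f g
    proof -
      have "wt h + wt f - 2 * wt g = (wt h - wt g) + (- (wt g - wt f))"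
        by simp
      thus ?thesis
        using p unfolding additive_char_def by metis
    qed
    ultimately show "(\<Sum>g\<in>{g\<in>B. interl g h}. \<Sum>f\<in>{f\<in>A. interl f g}. T f g h) =
        pat (rev (ys @ [y])) h * pat xs (prepend a u h)"
      by (simp add: T_def mult_ac)
  qed
  finally show ?case
    by (simp add: B_def m_def)
qed

definition odd_pat :: "(int \<Rightarrow> 'r::comm_ring_1) \<Rightarrow> (int \<Rightarrow> 'r) list \<Rightarrow> (nat \<Rightarrow> nat) \<Rightarrow> 'r" where
  "odd_pat p ps = strip_op p (trunc (length ps) (sp_pat ps))"

lemma sp_pat_cut:
  assumes "\<forall>p\<in>set ys. additive_char p" "length xs = a + length ys"
  shows "sp_pat (ys @ xs) (prepend (a + 2 * length ys) u (\<lambda>_. 0)) =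
    (\<Sum>f\<in>rows_in (length ys) u. sp_pat (rev ys) f * sp_pat xs (prepend a u f))"
  using pat_cut[of "map (\<lambda>p. (p, \<lambda>_. 1)) ys" "map (\<lambda>p. (p, \<lambda>_. 1)) xs" a u] assms
  by (simp add: sp_pat_def rev_map)

lemma beta_pat_cut:
  assumes "\<forall>p\<in>set ys. additive_char p" "length xs = a + length ys"
  shows "beta_pat \<beta> (ys @ xs) (prepend (a + 2 * length ys) u (\<lambda>_. 0)) =
    (\<Sum>f\<in>rows_in (length ys) u. beta_pat \<beta> (rev ys) f * beta_pat \<beta> xs (prepend a u f))"
  using pat_cut[of "map (\<lambda>p. (p, \<lambda>b. if b then 1 + \<beta> * p 1 else 1)) ys"
      "map (\<lambda>p. (p, \<lambda>b. if b then 1 + \<beta> * p 1 else 1)) xs" a u] assms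
  by (simp add: beta_pat_def rev_map)

text \<open>The upper strip of \<open>p\<close> joins the reversed part; turning it round inverts
  its character and splits off \<open>p (int u)\<close>. The lower strip stays with
  \<open>xs\<close> and carries the inverted character from the start, so both halves contain
  \<open>inv_char p\<close>.\<close>

lemma sp_pat_cut_odd:
  assumes ys: "\<forall>p\<in>set ys. additive_char p" and p: "additive_char p" and len: "length xs = a + length ys"
  shows "sp_pat (ys @ p # xs) (prepend (Suc a + 2 * length ys) u (\<lambda>_. 0)) =
    p (int u) * (\<Sum>g\<in>rows_in (Suc (length ys)) u.
      odd_pat (inv_char p) (rev ys) g * odd_pat (inv_char p) xs (prepend a u g))"
proof -
  define m where "m = length ys"
  define A where "A = rows_in m u"
  define B where "B = rows_in (Suc m) u"
  have A: "finite A" and B: "finite B"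
    by (simp_all add: A_def B_def finite_rows_in)
  have "sp_pat (ys @ p # xs) (prepend (Suc a + 2 * length ys) u (\<lambda>_. 0)) =
      (\<Sum>f\<in>A. sp_pat (rev ys) f * sp_pat (p # xs) (prepend (Suc a) u f))"
    unfolding A_def m_def using ys len by (intro sp_pat_cut) auto
  also have "\<dots> = (\<Sum>f\<in>A. \<Sum>g\<in>{g\<in>B. interl f g}. p (int u) * (p (- (wt g - wt f)) * sp_pat (rev ys) f *
      odd_pat (inv_char p) xs (prepend a u g)))"
  proof (rule sum.cong[OF refl])
    fix f assume f: "f \<in> A"
    have "sp_pat (p # xs) (prepend (Suc a) u f) =
        (\<Sum>g | interl f g \<and> g 0 \<le> u. p (int u + wt f - wt g) * odd_pat (inv_char p) xs (prepend a u g))"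
      unfolding sp_pat_Cons odd_pat_def
      using f by (intro strip_op_prepend rows_in_finsupp) (auto simp: A_def)
    also have "{g. interl f g \<and> g 0 \<le> u} = {g\<in>B. interl f g}"
      using f rows_in_above by (simp add: A_def B_def)
    finally have "sp_pat (rev ys) f * sp_pat (p # xs) (prepend (Suc a) u f) =
        (\<Sum>g\<in>{g\<in>B. interl f g}. sp_pat (rev ys) f * (p (int u + wt f - wt g) *
          odd_pat (inv_char p) xs (prepend a u g)))"
      by (simp only: sum_distrib_left)
    moreover have "p (int u + wt f - wt g) = p (int u) * p (- (wt g - wt f))" for g
    proof -
      have "int u + wt f - wt g = int u + (- (wt g - wt f))"
        by simp
      thus ?thesis
        using p unfolding additive_char_def by metis
    qed
    ultimately show "sp_pat (rev ys) f * sp_pat (p # xs) (prepend (Suc a) u f) =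
        (\<Sum>g\<in>{g\<in>B. interl f g}. p (int u) * (p (- (wt g - wt f)) * sp_pat (rev ys) f *
          odd_pat (inv_char p) xs (prepend a u g)))"
      by (simp add: mult_ac)
  qed
  also have "\<dots> = (\<Sum>g\<in>B. \<Sum>f\<in>{f\<in>A. interl f g}. p (int u) * (p (- (wt g - wt f)) * sp_pat (rev ys) f *
      odd_pat (inv_char p) xs (prepend a u g)))"
    by (rule sum.swap_restrict[OF A B])
  also have "\<dots> = p (int u) * (\<Sum>g\<in>B. odd_pat (inv_char p) (rev ys) g * odd_pat (inv_char p) xs (prepend a u g))"
  proof -
    have "odd_pat (inv_char p) (rev ys) g = (\<Sum>f\<in>{f\<in>A. interl f g}. p (- (wt g - wt f)) * sp_pat (rev ys) f)"
      if "g \<in> B" for g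
      using that rows_in_below[of g "Suc m" u m]
      by (simp add: odd_pat_def strip_op_trunc_sum[OF rows_in_finsupp] B_def A_def m_def)
    thus ?thesis
      by (simp add: sum_distrib_left sum_distrib_right)
  qed
  finally show ?thesis
    by (simp add: B_def m_def)
qed

lemma odd_pat_rev:
  assumes "\<forall>p\<in>set ps. additive_char p"
  shows "odd_pat p (rev ps) f = odd_pat p ps f"
proof -
  have "trunc (length ps) (sp_pat (rev ps)) = trunc (length ps) (sp_pat ps)"
    using sp_pat_rev[OF assms] by (auto simp: trunc_def)
  thus ?thesis
    by (simp add: odd_pat_def)
qed

section \<open>Summation over arrays row by row\<close>

definition row_interlacing :: "nat \<Rightarrow> (nat \<Rightarrow> rat) \<Rightarrow> (nat \<Rightarrow> rat) \<Rightarrow> bool" where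
  "row_interlacing i q r \<longleftrightarrow> (\<forall>j. 1 \<le> j \<and> j \<le> row_len i \<longrightarrow>
     (j + 1 \<le> row_len (i + 1) \<longrightarrow> r (j + 1) \<le> q j) \<and> q j \<le> r j)"

text \<open>Rows beyond \<open>M\<close> are fixed to the zero row, so that deleting the last row is
  a bijection. Row 0 is included to give the row differences a starting point.\<close>

definition arrays :: "(nat \<Rightarrow> (nat \<Rightarrow> rat) set) \<Rightarrow> nat \<Rightarrow> (nat \<Rightarrow> nat \<Rightarrow> rat) set" where
  "arrays R M = {z. (\<forall>i. z i \<in> (if i \<le> M then R i else {\<lambda>_. 0})) \<and>
     (\<forall>i<M. row_interlacing i (z i) (z (Suc i)))}"

definition array_sum ::
  "(nat \<Rightarrow> (nat \<Rightarrow> rat) set) \<Rightarrow> (nat \<Rightarrow> (nat \<Rightarrow> rat) \<Rightarrow> (nat \<Rightarrow> rat) \<Rightarrow> 'r::comm_ring_1) \<Rightarrow>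
    nat \<Rightarrow> (nat \<Rightarrow> rat) \<Rightarrow> 'r" where
  "array_sum R w M r = (\<Sum>z | z \<in> arrays R M \<and> z M = r. \<Prod>i=1..M. w i (z (i - 1)) (z i))"

lemma arrays_extend:
  assumes "z \<in> arrays R M" "row_interlacing M (z M) r" "r \<in> R (Suc M)"
  shows "z(Suc M := r) \<in> arrays R (Suc M)"
proof -
  have "\<And>i. z i \<in> (if i \<le> M then R i else {\<lambda>_. 0})" "\<And>i. i < M \<Longrightarrow> row_interlacing i (z i) (z (Suc i))"
    using assms by (auto simp: arrays_def)
  note * = this
  have "(z(Suc M := r)) i \<in> (if i \<le> Suc M then R i else {\<lambda>_. 0})" for i
    using *(1)[of i] assms(3) by (cases "i = Suc M") (auto split: if_splits)
  thus ?thesis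
    using *(2) assms(2) by (auto simp: arrays_def less_Suc_eq)
qed

lemma arrays_restrict:
  assumes "z \<in> arrays R (Suc M)"
  shows "z(Suc M := (\<lambda>_. 0)) \<in> arrays R M" "row_interlacing M (z M) (z (Suc M))" "z (Suc M) \<in> R (Suc M)"
proof -
  have "\<And>i. z i \<in> (if i \<le> Suc M then R i else {\<lambda>_. 0})" "\<And>i. i < Suc M \<Longrightarrow> row_interlacing i (z i) (z (Suc i))"
    using assms by (auto simp: arrays_def)
  note * = this
  show "row_interlacing M (z M) (z (Suc M))"
    by (rule *(2)) simp
  show "z (Suc M) \<in> R (Suc M)"
    using *(1)[of "Suc M"] by simp
  have "(z(Suc M := (\<lambda>_. 0))) i \<in> (if i \<le> M then R i else {\<lambda>_. 0})" for i
    using *(1)[of i] by (auto split: if_splits)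
  thus "z(Suc M := (\<lambda>_. 0)) \<in> arrays R M"
    using *(2) unfolding arrays_def by auto
qed

lemma arrays_beyond: "z \<in> arrays R M \<Longrightarrow> M < i \<Longrightarrow> z i = (\<lambda>_. 0)"
  by (auto simp: arrays_def dest: spec[of _ i])

lemma array_sum_0:
  assumes "R 0 = {\<lambda>_. 0}"
  shows "array_sum R w 0 r = (if r = (\<lambda>_. 0) then 1 else 0)"
proof -
  have "arrays R 0 = {z. \<forall>i. z i \<in> {\<lambda>_. 0}}"
    unfolding arrays_def using assms by (metis (no_types, lifting) le_zero_eq less_nat_zero_code)
  hence "arrays R 0 = {\<lambda>_ _. 0}"
    by (auto simp: fun_eq_iff)
  hence "{z. z \<in> arrays R 0 \<and> z 0 = r} = (if r = (\<lambda>_. 0) then {\<lambda>_ _. 0} else {})"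
    by auto
  thus ?thesis
    by (simp add: array_sum_def)
qed

lemma last_row: "z \<in> arrays R M \<Longrightarrow> z M \<in> R M"
  by (auto simp: arrays_def dest: spec[of _ M])

lemma finite_arrays_fiber:
  assumes R0: "R 0 = {\<lambda>_. 0}" and R: "\<And>i r. r \<in> R (Suc i) \<Longrightarrow> finite {q \<in> R i. row_interlacing i q r}"
  shows "finite {z. z \<in> arrays R M \<and> z M = r}"
proof (induction M arbitrary: r)
  case 0
  have "{z. z \<in> arrays R 0 \<and> z 0 = r} \<subseteq> {\<lambda>_ _. 0}"
  proof clarify
    fix z
    assume z: "z \<in> arrays R 0" "r = z 0"
    show "z = (\<lambda>_ _. 0)"
    proof
      fix i show "z i = (\<lambda>_. 0)"
        using z arrays_beyond[OF z(1), of i] last_row[OF z(1)] R0 by (cases i) auto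
    qed
  qed
  thus ?case
    using finite_subset by blast
next
  case (Suc M)
  show ?case
  proof (cases "r \<in> R (Suc M)")
    case True
    have "{z. z \<in> arrays R (Suc M) \<and> z (Suc M) = r} \<subseteq>
        (\<lambda>z. z(Suc M := r)) ` (\<Union>q\<in>{q \<in> R M. row_interlacing M q r}. {z. z \<in> arrays R M \<and> z M = q})"
    proof clarify
      fix z
      assume z: "z \<in> arrays R (Suc M)" "r = z (Suc M)"
      let ?z = "z(Suc M := (\<lambda>_. 0))"
      have "?z \<in> arrays R M" "row_interlacing M (?z M) r"
        using arrays_restrict[OF z(1)] z(2) by auto
      moreover from this have "?z M \<in> R M"
        using last_row by blast
      moreover have "z = ?z(Suc M := r)"
        using z by simp
      ultimately show "z \<in> (\<lambda>z'. z'(Suc M := z (Suc M))) `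
          (\<Union>q\<in>{q \<in> R M. row_interlacing M q (z (Suc M))}. {z. z \<in> arrays R M \<and> z M = q})"
        using z by blast
    qed
    thus ?thesis
      using Suc R[OF True] by (elim finite_subset) auto
  next
    case False
    hence "{z. z \<in> arrays R (Suc M) \<and> z (Suc M) = r} \<subseteq> {}"
      using arrays_restrict(3) by blast
    thus ?thesis
      by (rule finite_subset) simp
  qed
qed

text \<open>Deleting the last row and grouping by the row below it gives a recursion of the same
  form as the strip operators; it links arrays to \<open>pat\<close>.\<close>

lemma array_sum_Suc:
  assumes R0: "R 0 = {\<lambda>_. 0}" and R: "\<And>i r. r \<in> R (Suc i) \<Longrightarrow> finite {q \<in> R i. row_interlacing i q r}"
    and r: "r \<in> R (Suc M)"
  shows "array_sum R w (Suc M) r =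
    (\<Sum>q | q \<in> R M \<and> row_interlacing M q r. w (Suc M) q r * array_sum R w M q)"
proof -
  let ?Q = "{q. q \<in> R M \<and> row_interlacing M q r}"
  let ?S = "{z. z \<in> arrays R M \<and> row_interlacing M (z M) r}"
  let ?W = "\<lambda>z. \<Prod>i=1..M. w i (z (i - 1)) (z i)"
  note last = last_row[where R = R and M = M]
  have fin: "finite {z. z \<in> arrays R M \<and> z M = q}" for q
    using R0 R by (rule finite_arrays_fiber)
  have finS: "finite ?S"
  proof (rule finite_subset)
    show "?S \<subseteq> (\<Union>q\<in>?Q. {z. z \<in> arrays R M \<and> z M = q})"
      using last by auto
    show "finite (\<Union>q\<in>?Q. {z. z \<in> arrays R M \<and> z M = q})"
      using R[OF r] fin by auto
  qed
  have "array_sum R w (Suc M) r = (\<Sum>z\<in>?S. w (Suc M) (z M) r * ?W z)"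
    unfolding array_sum_def
  proof (rule sum.reindex_bij_witness[of _ "\<lambda>z. z(Suc M := r)" "\<lambda>z. z(Suc M := (\<lambda>_. 0))"])
    fix z assume z: "z \<in> {z. z \<in> arrays R (Suc M) \<and> z (Suc M) = r}"
    hence zr: "z \<in> arrays R (Suc M)" "z (Suc M) = r"
      by auto
    show "z(Suc M := \<lambda>_. 0, Suc M := r) = z"
      using z by auto
    show "z(Suc M := \<lambda>_. 0) \<in> ?S"
      using z arrays_restrict[OF zr(1)] by auto
    have "?W (z(Suc M := \<lambda>_. 0)) = ?W z"
      by (rule prod.cong) auto
    thus "w (Suc M) ((z(Suc M := \<lambda>_. 0)) M) r * ?W (z(Suc M := \<lambda>_. 0)) =
        (\<Prod>i=1..Suc M. w i (z (i - 1)) (z i))"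
      using z by (simp add: mult.commute)
  next
    fix z assume z: "z \<in> ?S"
    show "z(Suc M := r, Suc M := \<lambda>_. 0) = z"
      using z arrays_beyond[of z R M "Suc M"] by auto
    show "z(Suc M := r) \<in> {z. z \<in> arrays R (Suc M) \<and> z (Suc M) = r}"
      using z r by (auto intro: arrays_extend)
  qed
  also have "\<dots> = (\<Sum>q\<in>?Q. \<Sum>z | z \<in> ?S \<and> z M = q. w (Suc M) (z M) r * ?W z)"
    using last by (intro sum.group[symmetric] finS) (use R[OF r] in auto)
  also have "\<dots> = (\<Sum>q\<in>?Q. w (Suc M) q r * array_sum R w M q)"
    unfolding array_sum_def sum_distrib_left
    by (intro sum.cong refl) auto
  finally show ?thesis .
qed

lemma array_sum_cong:
  assumes "\<And>i q r. 1 \<le> i \<Longrightarrow> i \<le> M \<Longrightarrow> w i q r = w' i q r"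
  shows "array_sum R w M r = array_sum R w' M r"
  unfolding array_sum_def using assms by (intro sum.cong prod.cong) auto

text \<open>
  The rows of an array are indexed from 1, those of \<^const>\<open>pat\<close> from 0. The shift \<open>c\<close> is 0 for integral and
  \<open>1/2\<close> for half-integral shapes; the flag \<open>b\<close> marks an atypical odd end, and \<open>adm\<close> excludes the
  negative odd end \<open>0 - 1/2\<close>.
\<close>

definition row_of :: "rat \<Rightarrow> nat \<Rightarrow> (nat \<Rightarrow> nat) \<Rightarrow> nat \<Rightarrow> rat" where
  "row_of c k f = (\<lambda>j. if 1 \<le> j \<and> j \<le> k then of_nat (f (j - 1)) + c else 0)"

definition odd_row_of :: "rat \<Rightarrow> nat \<Rightarrow> bool \<Rightarrow> (nat \<Rightarrow> nat) \<Rightarrow> nat \<Rightarrow> rat" where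
  "odd_row_of c n b f = (row_of c (Suc n) f)(Suc n := of_nat (f n) + c - of_bool b / 2)"

definition adm :: "rat \<Rightarrow> bool set \<Rightarrow> nat \<Rightarrow> bool \<Rightarrow> bool" where
  "adm c B a b \<longleftrightarrow> b \<in> B \<and> (b \<and> c = 0 \<longrightarrow> 0 < a)"

text \<open>\<open>B\<close> selects the kind of pattern: \<open>{False}\<close> forbids atypical
  ends and gives symplectic patterns, \<open>UNIV\<close> gives split orthogonal ones.\<close>

definition row_set :: "rat \<Rightarrow> bool set \<Rightarrow> nat \<Rightarrow> (nat \<Rightarrow> rat) set" where
  "row_set c B i = (if even i then row_of c (i div 2) ` {f. supp_le (i div 2) f}
     else {odd_row_of c (i div 2) b f | b f. supp_le (Suc (i div 2)) f \<and> adm c B (f (i div 2)) b})"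

lemma row_len_even [simp]: "row_len (2 * n) = n" and row_len_odd [simp]: "row_len (Suc (2 * n)) = Suc n"
  by (simp_all add: row_len_def)

lemma row_set_even: "row_set c B (2 * n) = row_of c n ` {f. supp_le n f}"
  by (simp add: row_set_def)

lemma row_set_odd: "row_set c B (Suc (2 * n)) =
    {odd_row_of c n b f | b f. supp_le (Suc n) f \<and> adm c B (f n) b}"
  by (simp add: row_set_def)

lemma row_of_Suc: "i < k \<Longrightarrow> row_of c k f (Suc i) = of_nat (f i) + c"
  by (simp add: row_of_def)

lemma inj_on_row_of: "inj_on (row_of c k) {f. supp_le k f}"
proof (rule inj_onI)
  fix f g
  assume fg: "f \<in> {f. supp_le k f}" "g \<in> {f. supp_le k f}" "row_of c k f = row_of c k g"
  show "f = g"
  proof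
    fix j show "f j = g j"
      using fg(1,2) fun_cong[OF fg(3), of "Suc j"] by (cases "j < k") (auto simp: row_of_Suc supp_le_def)
  qed
qed

lemma half_not_Ints: "(1/2::rat) \<notin> \<int>"
proof
  assume "(1/2::rat) \<in> \<int>"
  then obtain k :: int where "(1/2::rat) = of_int k"
    by (auto elim: Ints_cases)
  hence "of_int (2 * k) = (of_int 1 :: rat)"
    by simp
  hence "2 * k = 1"
    by (simp only: of_int_eq_iff)
  thus False
    by presburger
qed

lemma of_nat_minus_half_in_Ints: "of_nat a - of_bool b / 2 \<in> (\<int> :: rat set) \<longleftrightarrow> \<not> b"
proof -
  have "of_nat a - 1/2 \<notin> (\<int> :: rat set)"
  proof
    assume "of_nat a - 1/2 \<in> (\<int> :: rat set)"
    hence "of_nat a - (of_nat a - 1/2) \<in> (\<int> :: rat set)"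
      by (intro Ints_diff) auto
    thus False
      using half_not_Ints by simp
  qed
  thus ?thesis
    by (cases b) auto
qed

text \<open>An odd end appears only on the smaller side of interlacing inequalities, and there a
  decrease by 1/2 is invisible against integral bounds.\<close>

lemma of_nat_minus_half_le: "of_nat a - of_bool b / 2 \<le> (of_nat d :: rat) \<longleftrightarrow> a \<le> d"
proof (cases "a \<le> d")
  case True
  hence "(of_nat a :: rat) \<le> of_nat d"
    by simp
  thus ?thesis
    using True by (cases b) auto
next
  case False
  hence "(of_nat (Suc d) :: rat) \<le> of_nat a"
    by (simp only: of_nat_le_iff)
  thus ?thesis
    using False by (cases b) auto
qed

lemma odd_row_of_Suc: "i \<le> n \<Longrightarrow> odd_row_of c n b f (Suc i) = of_nat (f i) + c - of_bool (b \<and> i = n) / 2"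
  by (simp add: odd_row_of_def row_of_Suc)

lemma row_interlacing_even:
  assumes f: "supp_le n f" and g: "supp_le (Suc n) g"
  shows "row_interlacing (2 * n) (row_of c n f) (odd_row_of c n b g) \<longleftrightarrow> interl f g"
proof -
  have "row_interlacing (2 * n) (row_of c n f) (odd_row_of c n b g) \<longleftrightarrow>
      (\<forall>i<n. odd_row_of c n b g (Suc (Suc i)) \<le> row_of c n f (Suc i) \<and> row_of c n f (Suc i) \<le> odd_row_of c n b g (Suc i))"
    unfolding row_interlacing_def by (auto simp: Suc_le_eq gr0_conv_Suc)
  also have "\<dots> \<longleftrightarrow> (\<forall>i<n. g (Suc i) \<le> f i \<and> f i \<le> g i)"
  proof -
    have "odd_row_of c n b g (Suc (Suc i)) \<le> row_of c n f (Suc i) \<longleftrightarrow> g (Suc i) \<le> f i" if "i < n" for i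
      using that of_nat_minus_half_le[of "g (Suc i)" "b \<and> Suc i = n" "f i"]
      by (simp only: odd_row_of_Suc row_of_Suc Suc_leI) linarith
    moreover have "row_of c n f (Suc i) \<le> odd_row_of c n b g (Suc i) \<longleftrightarrow> f i \<le> g i" if "i < n" for i
      using that by (simp add: odd_row_of_Suc row_of_Suc)
    ultimately show ?thesis
      by blast
  qed
  also have "\<dots> \<longleftrightarrow> interl f g"
  proof -
    have "f i \<le> g i \<and> g (Suc i) \<le> f i" if "\<not> i < n" for i
      using f g that by (simp add: supp_le_def)
    thus ?thesis
      unfolding interl_def by blast
  qed
  finally show ?thesis .
qed

lemma row_interlacing_odd:
  assumes g: "supp_le (Suc n) g" and h: "supp_le (Suc n) h"
  shows "row_interlacing (Suc (2 * n)) (odd_row_of c n b g) (row_of c (Suc n) h) \<longleftrightarrow> interl g h"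
proof -
  have len: "row_len (Suc (Suc (2 * n))) = Suc n"
    by (simp add: row_len_def)
  have "row_interlacing (Suc (2 * n)) (odd_row_of c n b g) (row_of c (Suc n) h) \<longleftrightarrow>
      (\<forall>i\<le>n. (i < n \<longrightarrow> row_of c (Suc n) h (Suc (Suc i)) \<le> odd_row_of c n b g (Suc i)) \<and>
         odd_row_of c n b g (Suc i) \<le> row_of c (Suc n) h (Suc i))"
    unfolding row_interlacing_def by (auto simp: Suc_le_eq gr0_conv_Suc len less_Suc_eq_le)
  also have "\<dots> \<longleftrightarrow> (\<forall>i\<le>n. (i < n \<longrightarrow> h (Suc i) \<le> g i) \<and> g i \<le> h i)"
  proof -
    have "odd_row_of c n b g (Suc i) \<le> row_of c (Suc n) h (Suc i) \<longleftrightarrow> g i \<le> h i" if "i \<le> n" for i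
      using that of_nat_minus_half_le[of "g i" "b \<and> i = n" "h i"]
      by (simp only: odd_row_of_Suc row_of_Suc less_Suc_eq_le) linarith
    moreover have "row_of c (Suc n) h (Suc (Suc i)) \<le> odd_row_of c n b g (Suc i) \<longleftrightarrow> h (Suc i) \<le> g i" if "i < n" for i
      using that by (simp add: odd_row_of_Suc row_of_Suc)
    ultimately show ?thesis
      by blast
  qed
  also have "\<dots> \<longleftrightarrow> interl g h"
  proof -
    have "h (Suc i) \<le> g i" if "\<not> i < n" for i
      using h that by (simp add: supp_le_def)
    moreover have "g i \<le> h i" if "\<not> i \<le> n" for i
      using g that by (simp add: supp_le_def)
    ultimately show ?thesis
      unfolding interl_def by (meson less_imp_le)
  qed
  finally show ?thesis .
qed

text \<open>Integrality of the odd end relative to \<open>c\<close> reveals the flag, after which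
  the entries determine the row.\<close>

lemma odd_row_of_inj:
  assumes "odd_row_of c n b f = odd_row_of c n b' f'" "supp_le (Suc n) f" "supp_le (Suc n) f'"
  shows "b = b' \<and> f = f'"
proof -
  have "of_nat (f n) - of_bool b / 2 = (of_nat (f' n) - of_bool b' / 2 :: rat)"
    using fun_cong[OF assms(1), of "Suc n"] by (simp add: odd_row_of_Suc)
  hence b: "b = b'"
    using of_nat_minus_half_in_Ints by metis
  have "f j = f' j" for j
  proof (cases "j \<le> n")
    case True
    thus ?thesis
      using fun_cong[OF assms(1), of "Suc j"] b by (simp add: odd_row_of_Suc)
  next
    case False
    thus ?thesis
      using assms by (simp add: supp_le_def)
  qed
  thus ?thesis
    using b by auto
qed

section \<open>Row sums, row weights and the recursion of \<open>pat\<close>\<close>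

definition row_sum :: "nat \<Rightarrow> (nat \<Rightarrow> rat) \<Rightarrow> rat" where
  "row_sum i r = (\<Sum>j=1..row_len i. r j)"

lemma row_sum_row_of:
  assumes "supp_le n f"
  shows "(\<Sum>j=1..n. row_of c n f j) = of_int (wt f) + of_nat n * c"
proof -
  have "(\<Sum>j=1..n. row_of c n f j) = (\<Sum>j<n. of_nat (f j) + c)"
    by (rule sum.reindex_bij_witness[of _ Suc "\<lambda>j. j - 1"]) (auto simp: row_of_def)
  thus ?thesis
    using assms by (simp add: wt_eq sum.distrib)
qed

lemma row_sum_even: "supp_le n f \<Longrightarrow> row_sum (2 * n) (row_of c n f) = of_int (wt f) + of_nat n * c"
  unfolding row_sum_def row_len_even by (rule row_sum_row_of)

lemma row_sum_odd:
  assumes "supp_le (Suc n) f"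
  shows "row_sum (Suc (2 * n)) (odd_row_of c n b f) = of_int (wt f) + of_nat (Suc n) * c - of_bool b / 2"
proof -
  have "(\<Sum>j=1..Suc n. odd_row_of c n b f j) = (\<Sum>j=1..Suc n. row_of c (Suc n) f j) - of_bool b / 2"
    by (simp add: odd_row_of_def row_of_Suc)
  thus ?thesis
    by (simp only: row_sum_def row_len_odd row_sum_row_of[OF assms])
qed

lemma row_set_odd_below:
  assumes "supp_le (Suc n) h"
  shows "{q. q \<in> row_set c B (Suc (2 * n)) \<and> row_interlacing (Suc (2 * n)) q (row_of c (Suc n) h)} =
    (\<lambda>(g, b). odd_row_of c n b g) ` (SIGMA g:{g. interl g h}. {b. adm c B (g n) b})"
  using assms row_interlacing_odd interl_supp_le unfolding row_set_odd by fastforce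

lemma row_set_even_below:
  assumes "supp_le (Suc n) g"
  shows "{q. q \<in> row_set c B (2 * n) \<and> row_interlacing (2 * n) q (odd_row_of c n b g)} =
    row_of c n ` {f. interl f g \<and> supp_le n f}"
  using assms row_interlacing_even unfolding row_set_even by auto

lemma finite_row_set_below:
  assumes "r \<in> row_set c B (Suc i)"
  shows "finite {q \<in> row_set c B i. row_interlacing i q r}"
proof (cases "even i")
  case True
  then obtain n where i: "i = 2 * n"
    by blast
  then obtain b g where r: "r = odd_row_of c n b g" "supp_le (Suc n) g"
    using assms unfolding i row_set_odd by blast
  have "finite {f. interl f g \<and> supp_le n f}"
    using finite_interl[OF finsuppI[OF r(2)]] by (rule rev_finite_subset) auto
  thus ?thesis
    using row_set_even_below[OF r(2)] by (simp add: i r)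
next
  case False
  then obtain n where i: "i = Suc (2 * n)"
    by (auto elim: oddE)
  then obtain h where r: "r = row_of c (Suc n) h" "supp_le (Suc n) h"
    using assms row_set_even[of c B "Suc n"] by auto
  have "finite (SIGMA g:{g. interl g h}. {b. adm c B (g n) b})"
    using finite_interl[OF finsuppI[OF r(2)]] by auto
  thus ?thesis
    using row_set_odd_below[OF r(2)] by (simp add: i r)
qed

lemma row_set_0: "row_set c B 0 = {\<lambda>_. 0}"
proof -
  have "{f. supp_le 0 f} = {\<lambda>_. 0}"
    by (auto simp: supp_le_def)
  thus ?thesis
    by (auto simp: row_set_def row_of_def)
qed

text \<open>Distributes the weight of a pattern over pairs of consecutive rows, as
  \<open>array_sum\<close> requires. Rows \<open>2 * k + 1\<close> and \<open>2 * k + 2\<close>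
  share the variable with list index \<open>k\<close>.\<close>

definition row_weight ::
  "'v list \<Rightarrow> 'a \<Rightarrow> rat \<Rightarrow> nat \<Rightarrow> (nat \<Rightarrow> rat) \<Rightarrow> (nat \<Rightarrow> rat) \<Rightarrow> ('v, 'a::comm_ring_1) laurent" where
  "row_weight x \<beta> c i q r =
    (if even i then var_pow (x ! (i div 2 - 1)) (row_sum i r - row_sum (i - 1) q)
     else scalar \<beta> ^ of_bool (r (row_len i) - c \<notin> \<int>) * var_pow (x ! (i div 2)) (row_sum (i - 1) q - row_sum i r))"

definition var_char :: "'v \<Rightarrow> int \<Rightarrow> ('v, 'a::comm_ring_1) laurent" where
  "var_char v d = var_pow v (of_int d)"

text \<open>The flag adds 1/2 to both row differences; the shift \<open>c\<close> enters once,
  because the odd row has one entry more than the row below it and as many as the row above.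
  \<open>of_bool s\<close> can replace the odd end, as \<open>adm\<close> only tests its
  positivity.\<close>

definition end_factor :: "'a \<Rightarrow> rat \<Rightarrow> bool set \<Rightarrow> 'v \<Rightarrow> bool \<Rightarrow> ('v, 'a::comm_ring_1) laurent" where
  "end_factor \<beta> c B v s = (\<Sum>b | adm c B (of_bool s) b. scalar \<beta> ^ of_bool b * var_pow v (of_bool b - c))"

lemma var_pow_add: "var_pow v (a + b) = var_pow v a * (var_pow v b :: ('v, 'a::comm_ring_1) laurent)"
  by (simp add: var_pow_def mult_single single_add)

lemma var_pow_0 [simp]: "var_pow v 0 = (1 :: ('v, 'a::comm_ring_1) laurent)"
  by (simp add: var_pow_def)

lemma additive_char_var_char: "additive_char (var_char v :: int \<Rightarrow> ('v, 'a::comm_ring_1) laurent)"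
  by (simp add: additive_char_def var_char_def var_pow_add)

text \<open>Two applications of \<open>array_sum_Suc\<close> form one step of \<open>pat\<close>,
  and the sum over the flag splits off as \<open>end_factor\<close>. The list is reversed because
  \<open>pat\<close> begins with the last rows and \<open>x\<close> with the first.\<close>

lemma array_sum_even:
  fixes x :: "'v list" and \<beta> :: "'a::comm_ring_1"
  assumes "n \<le> length x" "supp_le n h"
  shows "array_sum (row_set c B) (row_weight x \<beta> c) (2 * n) (row_of c n h) =
    pat (rev (map (\<lambda>v. (var_char v, end_factor \<beta> c B v)) (take n x))) h"
  using assms
proof (induction n arbitrary: h)
  case 0
  hence "h = (\<lambda>_. 0)"
    by (auto simp: supp_le_def)
  thus ?case
    by (auto simp: array_sum_0 row_set_0 row_of_def)
next
  case (Suc n)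
  let ?R = "row_set c B" and ?w = "row_weight x \<beta> c :: nat \<Rightarrow> _ \<Rightarrow> _ \<Rightarrow> ('v, 'a) laurent"
  let ?v = "x ! n" and ?ps = "rev (map (\<lambda>v. (var_char v, end_factor \<beta> c B v)) (take n x)) ::
    ((int \<Rightarrow> ('v, 'a) laurent) \<times> _) list"
  have len: "length ?ps = n"
    using Suc.prems by simp
  note rec = array_sum_Suc[where R = ?R and w = ?w, OF row_set_0 finite_row_set_below]
  \<comment> \<open>The exponent \<open>of_bool b / 2 - c\<close> is what the odd row contributes
    besides the strip size; the even row above supplies the other
    \<open>of_bool b / 2\<close>.\<close>
  have odd: "array_sum ?R ?w (Suc (2 * n)) (odd_row_of c n b g) =
      scalar \<beta> ^ of_bool b * var_pow ?v (of_bool b / 2 - c) *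
        strip_op (inv_char (var_char ?v)) (trunc n (pat ?ps)) g"
    if g: "supp_le (Suc n) g" "adm c B (g n) b" for b g
  proof -
    have "odd_row_of c n b g \<in> ?R (Suc (2 * n))"
      using g by (auto simp: row_set_odd)
    hence "array_sum ?R ?w (Suc (2 * n)) (odd_row_of c n b g) =
        (\<Sum>q\<in>row_of c n ` {f. interl f g \<and> supp_le n f}.
          ?w (Suc (2 * n)) q (odd_row_of c n b g) * array_sum ?R ?w (2 * n) q)"
      using rec row_set_even_below[OF g(1)] by simp
    also have "\<dots> = (\<Sum>f | interl f g \<and> supp_le n f.
        ?w (Suc (2 * n)) (row_of c n f) (odd_row_of c n b g) * array_sum ?R ?w (2 * n) (row_of c n f))"
      by (subst sum.reindex) (auto intro: inj_on_subset[OF inj_on_row_of])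
    also have "\<dots> = (\<Sum>f | interl f g \<and> supp_le n f. scalar \<beta> ^ of_bool b * var_pow ?v (of_bool b / 2 - c) *
        (inv_char (var_char ?v) (wt g - wt f) * pat ?ps f))"
    proof (rule sum.cong[OF refl])
      fix f assume "f \<in> {f. interl f g \<and> supp_le n f}"
      hence f: "supp_le n f"
        by simp
      have IH: "array_sum ?R ?w (2 * n) (row_of c n f) = pat ?ps f"
        using Suc f by simp
      have char: "inv_char (var_char ?v) (wt g - wt f) = var_pow ?v (of_int (- (wt g - wt f)))"
        by (simp only: var_char_def)
      have "odd_row_of c n b g (Suc n) - c \<notin> \<int> \<longleftrightarrow> b"
        using of_nat_minus_half_in_Ints[of "g n" b] by (simp add: odd_row_of_Suc)
      hence "?w (Suc (2 * n)) (row_of c n f) (odd_row_of c n b g) =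
          scalar \<beta> ^ of_bool b * var_pow ?v (row_sum (2 * n) (row_of c n f) - row_sum (Suc (2 * n)) (odd_row_of c n b g))"
        by (simp add: row_weight_def)
      also have "row_sum (2 * n) (row_of c n f) - row_sum (Suc (2 * n)) (odd_row_of c n b g) =
          (of_bool b / 2 - c) + of_int (- (wt g - wt f))"
        using row_sum_even[OF f] row_sum_odd[OF g(1)] by (simp add: algebra_simps)
      finally show "?w (Suc (2 * n)) (row_of c n f) (odd_row_of c n b g) * array_sum ?R ?w (2 * n) (row_of c n f) =
          scalar \<beta> ^ of_bool b * var_pow ?v (of_bool b / 2 - c) * (inv_char (var_char ?v) (wt g - wt f) * pat ?ps f)"
        using IH by (simp only: var_pow_add char mult.assoc)
    qed
    finally show ?thesis
      by (simp only: strip_op_trunc_sum[OF finsuppI[OF g(1)]] sum_distrib_left)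
  qed
  have "row_of c (Suc n) h \<in> ?R (Suc (Suc (2 * n)))"
    using Suc.prems row_set_even[of c B "Suc n"] by auto
  hence "array_sum ?R ?w (Suc (Suc (2 * n))) (row_of c (Suc n) h) =
      (\<Sum>q\<in>(\<lambda>(g, b). odd_row_of c n b g) ` (SIGMA g:{g. interl g h}. {b. adm c B (g n) b}).
        ?w (Suc (Suc (2 * n))) q (row_of c (Suc n) h) * array_sum ?R ?w (Suc (2 * n)) q)"
    using rec row_set_odd_below[OF Suc.prems(2)] by simp
  also have "\<dots> = (\<Sum>(g, b)\<in>(SIGMA g:{g. interl g h}. {b. adm c B (g n) b}).
        ?w (Suc (Suc (2 * n))) (odd_row_of c n b g) (row_of c (Suc n) h) *
        array_sum ?R ?w (Suc (2 * n)) (odd_row_of c n b g))"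
  proof (subst sum.reindex)
    show "inj_on (\<lambda>(g, b). odd_row_of c n b g) (SIGMA g:{g. interl g h}. {b. adm c B (g n) b})"
    proof (rule inj_onI, clarify)
      fix g b g' b'
      assume "interl g h" "interl g' h" and eq: "odd_row_of c n b g = odd_row_of c n b' g'"
      hence "supp_le (Suc n) g" "supp_le (Suc n) g'"
        using Suc.prems(2) interl_supp_le by blast+
      thus "g = g' \<and> b = b'"
        using odd_row_of_inj[OF eq] by blast
    qed
  qed (simp add: case_prod_beta')
  also have "\<dots> = (\<Sum>g | interl g h. \<Sum>b | adm c B (g n) b.
        ?w (Suc (Suc (2 * n))) (odd_row_of c n b g) (row_of c (Suc n) h) *
        array_sum ?R ?w (Suc (2 * n)) (odd_row_of c n b g))"
    using finite_interl[OF finsuppI[OF Suc.prems(2)]] by (subst sum.Sigma) auto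
  also have "\<dots> = (\<Sum>g | interl g h. var_char ?v (wt h - wt g) * (end_factor \<beta> c B ?v (0 < g n) *
        strip_op (inv_char (var_char ?v)) (trunc n (pat ?ps)) g))"
  proof (rule sum.cong[OF refl])
    fix g assume "g \<in> {g. interl g h}"
    hence g: "supp_le (Suc n) g"
      using Suc.prems interl_supp_le by blast
    let ?G = "strip_op (inv_char (var_char ?v)) (trunc n (pat ?ps)) g"
    have "?w (Suc (Suc (2 * n))) (odd_row_of c n b g) (row_of c (Suc n) h) *
        array_sum ?R ?w (Suc (2 * n)) (odd_row_of c n b g) =
        var_char ?v (wt h - wt g) * (scalar \<beta> ^ of_bool b * var_pow ?v (of_bool b - c) * ?G)"
      if b: "adm c B (g n) b" for b
    proof -
      have "row_sum (Suc (Suc (2 * n))) (row_of c (Suc n) h) - row_sum (Suc (2 * n)) (odd_row_of c n b g) =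
          of_int (wt h - wt g) + of_bool b / 2"
        using row_sum_even[of "Suc n" h c] row_sum_odd[OF g] Suc.prems(2) by simp
      hence "?w (Suc (Suc (2 * n))) (odd_row_of c n b g) (row_of c (Suc n) h) =
          var_char ?v (wt h - wt g) * var_pow ?v (of_bool b / 2)"
        by (simp add: row_weight_def var_char_def var_pow_add)
      moreover have "of_bool b - c = of_bool b / 2 + (of_bool b / 2 - c)"
        by simp
      hence "var_pow ?v (of_bool b - c) =
          (var_pow ?v (of_bool b / 2) * var_pow ?v (of_bool b / 2 - c) :: ('v, 'a) laurent)"
        by (simp only: var_pow_add)
      ultimately show ?thesis
        using odd[OF g b] by (simp add: mult_ac)
    qed
    moreover have "adm c B (g n) = adm c B (of_bool (0 < g n))"
      by (auto simp: adm_def)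
    ultimately show "(\<Sum>b | adm c B (g n) b. ?w (Suc (Suc (2 * n))) (odd_row_of c n b g) (row_of c (Suc n) h) *
        array_sum ?R ?w (Suc (2 * n)) (odd_row_of c n b g)) =
        var_char ?v (wt h - wt g) * (end_factor \<beta> c B ?v (0 < g n) * ?G)"
      by (simp add: end_factor_def sum_distrib_left sum_distrib_right)
  qed
  also have "\<dots> = pat ((var_char ?v, end_factor \<beta> c B ?v) # ?ps) h"
    by (simp only: pat.simps strip_op_def[of "var_char ?v"] len)
  finally show ?case
    using Suc.prems by (simp add: take_Suc_conv_app_nth)
qed

section \<open>Symplectic and split orthogonal patterns as arrays of admissible rows\<close>

definition list_of :: "rat \<Rightarrow> nat \<Rightarrow> (nat \<Rightarrow> nat) \<Rightarrow> rat list" where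
  "list_of c k f = map (\<lambda>j. of_nat (f j) + c) [0..<k]"

lemma shape_eq_iff:
  assumes "half_triangular M z" "1 \<le> M"
  shows "shape M z = list_of c (row_len M) f \<longleftrightarrow> z M = row_of c (row_len M) f"
proof -
  have "shape M z = map (\<lambda>j. z M (Suc j)) [0..<row_len M]"
    by (rule nth_equalityI) (auto simp: shape_def simp del: upt_Suc)
  hence "shape M z = list_of c (row_len M) f \<longleftrightarrow> (\<forall>j<row_len M. z M (Suc j) = of_nat (f j) + c)"
    by (auto simp: list_of_def)
  also have "\<dots> \<longleftrightarrow> (\<forall>j. z M j = row_of c (row_len M) f j)"
  proof
    assume *: "\<forall>j<row_len M. z M (Suc j) = of_nat (f j) + c"
    show "\<forall>j. z M j = row_of c (row_len M) f j"
    proof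
      fix j
      show "z M j = row_of c (row_len M) f j"
      proof (cases "1 \<le> j \<and> j \<le> row_len M")
        case True
        then obtain i where "j = Suc i" "i < row_len M"
          by (cases j) auto
        thus ?thesis
          using * by (simp add: row_of_Suc)
      next
        case False
        hence "(M, j) \<notin> positions M"
          by (auto simp: positions_def)
        thus ?thesis
          using False assms by (auto simp: half_triangular_def row_of_def)
      qed
    qed
  qed (simp add: row_of_Suc)
  finally show ?thesis
    by (simp add: fun_eq_iff)
qed

lemma row_of_image:
  "row_of c n ` {f. supp_le n f} =
    {r. (\<forall>j. \<not> (1 \<le> j \<and> j \<le> n) \<longrightarrow> r j = 0) \<and> (\<forall>j. 1 \<le> j \<and> j \<le> n \<longrightarrow> r j - c \<in> \<nat>)}"
proof (intro equalityI subsetI)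
  fix r
  assume "r \<in> {r. (\<forall>j. \<not> (1 \<le> j \<and> j \<le> n) \<longrightarrow> r j = 0) \<and> (\<forall>j. 1 \<le> j \<and> j \<le> n \<longrightarrow> r j - c \<in> \<nat>)}"
  hence r0: "\<And>j. \<not> (1 \<le> j \<and> j \<le> n) \<Longrightarrow> r j = 0" and r: "\<And>j. 1 \<le> j \<Longrightarrow> j \<le> n \<Longrightarrow> r j - c \<in> \<nat>"
    by auto
  have "\<forall>j. \<exists>a. j < n \<longrightarrow> r (Suc j) - c = of_nat a"
  proof
    fix j show "\<exists>a. j < n \<longrightarrow> r (Suc j) - c = of_nat a"
      using r[of "Suc j"] by (metis Nats_cases Suc_leI le_add1 plus_1_eq_Suc)
  qed
  then obtain a where a: "\<And>j. j < n \<Longrightarrow> r (Suc j) - c = of_nat (a j)"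
    by metis
  have "r j = row_of c n (\<lambda>j. if j < n then a j else 0) j" for j
    using r0[of j] a[of "j - 1"] by (cases j) (auto simp: row_of_def algebra_simps)
  hence eq: "r = row_of c n (\<lambda>j. if j < n then a j else 0)"
    by blast
  show "r \<in> row_of c n ` {f. supp_le n f}"
    by (subst eq, rule imageI) (simp add: supp_le_def)
qed (auto simp: row_of_def)

lemma mem_row_set_iff:
  "r \<in> row_set c B i \<longleftrightarrow>
    (\<forall>j. \<not> (1 \<le> j \<and> j \<le> row_len i) \<longrightarrow> r j = 0) \<and>
    (\<forall>j. 1 \<le> j \<and> j \<le> row_len i \<longrightarrow>
      (if odd i \<and> j = row_len i then \<exists>a b. adm c B a b \<and> r j = of_nat a + c - of_bool b / 2
       else r j - c \<in> \<nat>))" (is "_ \<longleftrightarrow> ?P r")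
proof (cases "even i")
  case True
  then obtain n where i: "i = 2 * n"
    by blast
  show ?thesis
    unfolding i row_set_even row_of_image by simp
next
  case False
  then obtain n where i: "i = Suc (2 * n)"
    by (auto elim: oddE)
  show ?thesis
  proof
    assume "r \<in> row_set c B i"
    then obtain b f where f: "r = odd_row_of c n b f" "adm c B (f n) b"
      unfolding i row_set_odd by blast
    show "?P r"
    proof (intro conjI allI impI)
      fix j assume "\<not> (1 \<le> j \<and> j \<le> row_len i)"
      thus "r j = 0"
        by (auto simp: f i odd_row_of_def row_of_def)
    next
      fix j assume j: "1 \<le> j \<and> j \<le> row_len i"
      show "if odd i \<and> j = row_len i then \<exists>a b. adm c B a b \<and> r j = of_nat a + c - of_bool b / 2
          else r j - c \<in> \<nat>"
      proof (cases "j = Suc n")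
        case True
        hence "r j = of_nat (f n) + c - of_bool b / 2"
          by (simp add: f odd_row_of_def)
        hence ex: "\<exists>a b. adm c B a b \<and> r j = of_nat a + c - of_bool b / 2"
          using f(2) by blast
        have "odd i \<and> j = row_len i"
          using True by (simp add: i)
        thus ?thesis
          using ex by (rule if_P[THEN iffD2])
      next
        case False
        hence "r j - c = of_nat (f (j - 1))"
          using j by (simp add: f i odd_row_of_def row_of_def)
        thus ?thesis
          using False by (simp add: i)
      qed
    qed
  next
    assume r: "?P r"
    have "\<forall>j. 1 \<le> j \<and> j \<le> row_len i \<longrightarrow>
        (if odd i \<and> j = row_len i then \<exists>a b. adm c B a b \<and> r j = of_nat a + c - of_bool b / 2
         else r j - c \<in> \<nat>)"
      using r by (rule conjunct2)
    hence "1 \<le> Suc n \<and> Suc n \<le> row_len i \<longrightarrow>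
        (if odd i \<and> Suc n = row_len i then \<exists>a b. adm c B a b \<and> r (Suc n) = of_nat a + c - of_bool b / 2
         else r (Suc n) - c \<in> \<nat>)"
      by (rule spec)
    then obtain a b where ab: "adm c B a b" "r (Suc n) = of_nat a + c - of_bool b / 2"
      by (auto simp: i)
    have "r(Suc n := of_nat a + c) \<in> row_of c (Suc n) ` {f. supp_le (Suc n) f}"
      using r unfolding row_of_image by (auto simp: i)
    then obtain f where f: "r(Suc n := of_nat a + c) = row_of c (Suc n) f" "supp_le (Suc n) f"
      by blast
    have "f n = a"
      using fun_cong[OF f(1), of "Suc n"] by (simp add: row_of_Suc)
    moreover have "r = odd_row_of c n b f"
      using ab(2) \<open>f n = a\<close> f(1) unfolding odd_row_of_def by (metis fun_upd_triv fun_upd_upd)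
    ultimately show "r \<in> row_set c B i"
      using ab(1) f(2) unfolding i row_set_odd by blast
  qed
qed

lemma arrays_row_set_iff:
  "z \<in> arrays (row_set c B) M \<longleftrightarrow> half_triangular M z \<and> interlacing M z \<and>
    (\<forall>(i, j)\<in>positions M. if odd i \<and> j = row_len i
       then \<exists>a b. adm c B a b \<and> z i j = of_nat a + c - of_bool b / 2 else z i j - c \<in> \<nat>)"
    (is "_ \<longleftrightarrow> _ \<and> _ \<and> (\<forall>(i, j)\<in>positions M. ?E i j)")
proof -
  have R: "z i \<in> row_set c B i \<longleftrightarrow> (\<forall>j. \<not> (1 \<le> j \<and> j \<le> row_len i) \<longrightarrow> z i j = 0) \<and>
      (\<forall>j. 1 \<le> j \<and> j \<le> row_len i \<longrightarrow> ?E i j)" for i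
    by (rule mem_row_set_iff)
  have len: "row_len i \<le> row_len (i + 1)" for i
    by (simp add: row_len_def)
  have pos: "(i, j) \<in> positions M \<longleftrightarrow> i \<le> M \<and> 1 \<le> j \<and> j \<le> row_len i" for i j
    by (cases "i = 0") (auto simp: positions_def row_len_def)
  have "(\<forall>i. z i \<in> (if i \<le> M then row_set c B i else {\<lambda>_. 0})) \<longleftrightarrow>
      half_triangular M z \<and> (\<forall>(i, j)\<in>positions M. ?E i j)"
  proof (intro iffI conjI)
    assume *: "\<forall>i. z i \<in> (if i \<le> M then row_set c B i else {\<lambda>_. 0})"
    show "half_triangular M z"
      unfolding half_triangular_def
    proof (intro allI impI)
      fix i j assume "(i, j) \<notin> positions M"
      thus "z i j = 0"
        using *[rule_format, of i] R[of i] pos[of i j] by (cases "i \<le> M") auto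
    qed
    show "\<forall>(i, j)\<in>positions M. ?E i j"
    proof clarify
      fix i j assume "(i, j) \<in> positions M"
      hence ij: "i \<le> M" "1 \<le> j \<and> j \<le> row_len i"
        using pos by auto
      hence "z i \<in> row_set c B i"
        using *[rule_format, of i] by simp
      thus "?E i j"
        using R[of i] ij(2) by blast
    qed
  next
    assume *: "half_triangular M z \<and> (\<forall>(i, j)\<in>positions M. ?E i j)"
    show "\<forall>i. z i \<in> (if i \<le> M then row_set c B i else {\<lambda>_. 0})"
    proof
      fix i
      show "z i \<in> (if i \<le> M then row_set c B i else {\<lambda>_. 0})"
      proof (cases "i \<le> M")
        case True
        have "\<not> (1 \<le> j \<and> j \<le> row_len i) \<Longrightarrow> z i j = 0" for j
          using * pos unfolding half_triangular_def by blast
        moreover have "1 \<le> j \<and> j \<le> row_len i \<Longrightarrow> ?E i j" for j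
          using * pos True by blast
        ultimately show ?thesis
          using True R[of i] by simp
      next
        case False
        have "z i j = 0" for j
          using * pos False unfolding half_triangular_def by blast
        thus ?thesis
          using False by auto
      qed
    qed
  qed
  moreover have "(\<forall>i<M. row_interlacing i (z i) (z (Suc i))) \<longleftrightarrow> interlacing M z"
  proof
    assume *: "\<forall>i<M. row_interlacing i (z i) (z (Suc i))"
    show "interlacing M z"
      unfolding interlacing_def pos
    proof (intro allI impI)
      fix i j assume "i \<le> M \<and> 1 \<le> j \<and> j \<le> row_len i"
      thus "(i + 1 \<le> M \<and> 1 \<le> j + 1 \<and> j + 1 \<le> row_len (i + 1) \<longrightarrow> z (i + 1) (j + 1) \<le> z i j) \<and>
          (i + 1 \<le> M \<and> 1 \<le> j \<and> j \<le> row_len (i + 1) \<longrightarrow> z i j \<le> z (i + 1) j)"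
        using *[rule_format, of i] by (auto simp: row_interlacing_def)
    qed
  next
    assume *: "interlacing M z"
    show "\<forall>i<M. row_interlacing i (z i) (z (Suc i))"
      unfolding row_interlacing_def
    proof (intro allI impI)
      fix i j assume "i < M" "1 \<le> j \<and> j \<le> row_len i"
      thus "(j + 1 \<le> row_len (i + 1) \<longrightarrow> z (Suc i) (j + 1) \<le> z i j) \<and> z i j \<le> z (Suc i) j"
        using *[unfolded interlacing_def pos, rule_format, of i j] len[of i] by auto
    qed
  qed
  ultimately show ?thesis
    by (auto simp: arrays_def)
qed

lemma symplectic_pattern_iff: "symplectic_pattern M z \<longleftrightarrow> z \<in> arrays (row_set 0 {False}) M"
proof -
  have "(\<exists>a b. adm 0 {False} a b \<and> v = of_nat a + 0 - of_bool b / 2) \<longleftrightarrow> v \<in> \<nat>" for v :: rat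
  proof
    assume "v \<in> \<nat>"
    then obtain a where "v = of_nat a"
      by (auto elim: Nats_cases)
    thus "\<exists>a b. adm 0 {False} a b \<and> v = of_nat a + 0 - of_bool b / 2"
      by (intro exI[of _ a] exI[of _ False]) (simp add: adm_def)
  next
    assume "\<exists>a b. adm 0 {False} a b \<and> v = of_nat a + 0 - of_bool b / 2"
    then obtain a b where "b = False" "v = of_nat a + 0 - of_bool b / 2"
      unfolding adm_def by blast
    thus "v \<in> \<nat>"
      by simp
  qed
  hence "(if Q then \<exists>a b. adm 0 {False} a b \<and> v = of_nat a + 0 - of_bool b / 2 else v - 0 \<in> \<nat>) \<longleftrightarrow> v \<in> \<nat>"
    for v :: rat and Q
    by (simp only: diff_zero if_cancel)
  thus ?thesis
    unfolding symplectic_pattern_def arrays_row_set_iff by (simp only:)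
qed

lemma odd_ends_iff: "(i, j) \<in> positions (2 * n) \<Longrightarrow> (i, j) \<in> odd_ends n \<longleftrightarrow> odd i \<and> j = row_len i"
proof -
  assume p: "(i, j) \<in> positions (2 * n)"
  show ?thesis
  proof
    assume "(i, j) \<in> odd_ends n"
    thus "odd i \<and> j = row_len i"
      by (auto simp: odd_ends_def row_len_def)
  next
    assume "odd i \<and> j = row_len i"
    moreover from this obtain k where "i = 2 * k + 1"
      by (auto elim: oddE)
    ultimately show "(i, j) \<in> odd_ends n"
      using p unfolding odd_ends_def positions_def row_len_def
      by (auto intro!: exI[of _ "Suc k"])
  qed
qed

lemma odd_ends_positions: "(i, j) \<in> odd_ends n \<Longrightarrow> (i, j) \<in> positions (2 * n)"
  by (auto simp: odd_ends_def positions_def row_len_def)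

text \<open>The parity of \<open>2 * v\<close> determines the flag. For \<open>c = 0\<close> a
  half-integer is rounded up, so \<open>a\<close> is positive as \<open>adm\<close> demands; for
  \<open>c = 1/2\<close> an integer \<open>v\<close> is \<open>v + 1/2 - 1/2\<close> and any
  \<open>a\<close> is allowed.\<close>

lemma half_integer_entry_iff:
  assumes "c = 0 \<or> c = 1/2"
  shows "(\<exists>a b. adm c UNIV a b \<and> v = of_nat a + c - of_bool b / 2) \<longleftrightarrow> 2 * v \<in> (\<nat> :: rat set)"
proof
  assume "\<exists>a b. adm c UNIV a b \<and> v = of_nat a + c - of_bool b / 2"
  then obtain a b where ab: "adm c UNIV a b" "v = of_nat a + c - of_bool b / 2"
    by blast
  have "2 * v = of_nat (2 * a + (if c = 0 then 0 else 1) - of_bool b)"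
  proof (cases "b \<and> c = 0")
    case True
    then obtain a' where "a = Suc a'"
      using ab(1) by (cases a) (auto simp: adm_def)
    thus ?thesis
      using True ab(2) by simp
  next
    case False
    thus ?thesis
      using ab(2) assms by (cases b) auto
  qed
  thus "2 * v \<in> \<nat>"
    by simp
next
  assume "2 * v \<in> \<nat>"
  then obtain k where k: "2 * v = of_nat k"
    by (auto elim: Nats_cases)
  obtain d where d: "k = 2 * d \<or> k = Suc (2 * d)"
    by (metis evenE oddE Suc_eq_plus1)
  show "\<exists>a b. adm c UNIV a b \<and> v = of_nat a + c - of_bool b / 2"
  proof (cases "c = 0")
    case True
    show ?thesis
    proof (cases "k = 2 * d")
      case True
      thus ?thesis
        using k \<open>c = 0\<close> by (intro exI[of _ d] exI[of _ False]) (simp add: adm_def)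
    next
      case False
      thus ?thesis
        using k d \<open>c = 0\<close> by (intro exI[of _ "Suc d"] exI[of _ True]) (simp add: adm_def)
    qed
  next
    case False
    show ?thesis
    proof (cases "k = 2 * d")
      case True
      thus ?thesis
        using k \<open>c \<noteq> 0\<close> assms by (intro exI[of _ d] exI[of _ True]) (simp add: adm_def)
    next
      case False
      thus ?thesis
        using k d \<open>c \<noteq> 0\<close> assms by (intro exI[of _ d] exI[of _ False]) (simp add: adm_def)
    qed
  qed
qed

text \<open>The first entry of the last row is not an odd end, and its value \<open>h 0 + c\<close>
  decides between the integral and the half-integral alternative.\<close>

lemma split_orthogonal_pattern_iff:
  assumes c: "c = 0 \<or> c = 1/2" and n: "1 \<le> n" and z: "z (2 * n) = row_of c n h"
  shows "split_orthogonal_pattern n z \<longleftrightarrow> z \<in> arrays (row_set c UNIV) (2 * n)"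
proof -
  let ?X = "positions (2 * n) - odd_ends n"
  have p: "(2 * n, 1) \<in> ?X"
    using n by (auto simp: positions_def odd_ends_def row_len_def)
  have z1: "z (2 * n) 1 = of_nat (h 0) + c"
    using n z by (simp add: row_of_def)
  have notin: "of_nat a - 1/2 \<notin> (\<nat> :: rat set)" "of_nat a + 1/2 \<notin> (\<nat> :: rat set)" for a :: nat
  proof -
    show "of_nat a - 1/2 \<notin> (\<nat> :: rat set)"
      using of_nat_minus_half_in_Ints[of a True] Nats_subset_Ints by auto
    show "of_nat a + 1/2 \<notin> (\<nat> :: rat set)"
    proof
      assume "of_nat a + 1/2 \<in> (\<nat> :: rat set)"
      then obtain k where k: "of_nat a + 1/2 = (of_nat k :: rat)"
        by (auto elim: Nats_cases)
      hence "of_nat k - 1/2 = (of_nat a :: rat)"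
        by simp
      thus False
        using of_nat_minus_half_in_Ints[of k True] Ints_of_nat[of a] by auto
    qed
  qed
  have "((\<forall>(i, j)\<in>?X. z i j \<in> \<nat>) \<or> (\<forall>(i, j)\<in>?X. z i j - 1/2 \<in> \<nat>)) \<longleftrightarrow> (\<forall>(i, j)\<in>?X. z i j - c \<in> \<nat>)"
    using c
  proof
    assume c: "c = 0"
    hence "\<not> (\<forall>(i, j)\<in>?X. z i j - 1/2 \<in> \<nat>)"
      using p z1 notin(1)[of "h 0"] by force
    thus ?thesis
      unfolding c diff_zero by blast
  next
    assume c: "c = 1/2"
    hence "\<not> (\<forall>(i, j)\<in>?X. z i j \<in> \<nat>)"
      using p z1 notin(2)[of "h 0"] by force
    thus ?thesis
      unfolding c by blast
  qed
  moreover have "(\<forall>(i, j)\<in>positions (2 * n). if odd i \<and> j = row_len i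
       then \<exists>a b. adm c UNIV a b \<and> z i j = of_nat a + c - of_bool b / 2 else z i j - c \<in> \<nat>) \<longleftrightarrow>
     (\<forall>(i, j)\<in>odd_ends n. 2 * z i j \<in> \<nat>) \<and> (\<forall>(i, j)\<in>?X. z i j - c \<in> \<nat>)"
    unfolding half_integer_entry_iff[OF c] using odd_ends_iff odd_ends_positions by fastforce
  ultimately show ?thesis
    unfolding split_orthogonal_pattern_def arrays_row_set_iff by blast
qed

section \<open>The identities\<close>

lemma half_integer_iff:
  assumes "2 * v \<in> (\<nat> :: rat set)"
  shows "v - 1/2 \<in> \<int> \<longleftrightarrow> v \<notin> \<int>"
proof -
  obtain k where k: "2 * v = of_nat k"
    using assms by (auto elim: Nats_cases)
  obtain d where "k = 2 * d \<or> k = Suc (2 * d)"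
    by (metis evenE oddE Suc_eq_plus1)
  thus ?thesis
  proof
    assume "k = 2 * d"
    hence "v = of_nat d"
      using k by simp
    thus ?thesis
      using of_nat_minus_half_in_Ints[of d True] by simp
  next
    assume "k = Suc (2 * d)"
    hence v: "v = of_nat d + 1/2"
      using k by simp
    hence "v = of_nat (Suc d) - of_bool True / 2"
      by simp
    hence "v \<notin> \<int>"
      using of_nat_minus_half_in_Ints[of "Suc d" True] by metis
    thus ?thesis
      by (simp add: v)
  qed
qed

text \<open>Entries other than odd ends differ from \<open>c\<close> by a natural number and are
  never atypical. So atypical entries can be counted by their row index, as the product of row
  weights does.\<close>

lemma atypical_eq:
  assumes c: "c = 0 \<or> c = 1/2" and n: "1 \<le> n" and z: "z (2 * n) = row_of c n h"
    and arr: "z \<in> arrays (row_set c UNIV) (2 * n)"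
  shows "atypical n z = (\<lambda>i. (i, row_len i)) ` {i \<in> {1..2 * n}. odd i \<and> z i (row_len i) - c \<notin> \<int>}"
proof -
  have E: "if odd i \<and> j = row_len i then 2 * z i j \<in> \<nat> else z i j - c \<in> \<nat>"
    if "(i, j) \<in> positions (2 * n)" for i j
    using arr that unfolding arrays_row_set_iff half_integer_entry_iff[OF c] by blast
  have N: "2 * z i j \<in> \<nat>" if p: "(i, j) \<in> positions (2 * n)" for i j
  proof (cases "odd i \<and> j = row_len i")
    case True
    thus ?thesis
      using E[OF p] by simp
  next
    case False
    hence "z i j - c \<in> \<nat>"
      using E[OF p] by auto
    moreover have "2 * c = 0 \<or> 2 * c = 1"
      using c by auto
    hence "2 * c \<in> \<nat>"
      by (metis Nats_0 Nats_1)
    ultimately have "2 * (z i j - c) + 2 * c \<in> \<nat>"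
      by (intro Nats_add) (rule Nats_double)
    thus ?thesis
      by (simp add: algebra_simps)
  qed
  have z1: "z (2 * n) 1 = of_nat (h 0) + c"
    using n z by (simp add: row_of_def)
  have "atypical n z = {(i, j) \<in> positions (2 * n). z i j - c \<notin> \<int>}"
    using c
  proof
    assume c: "c = 0"
    hence "z (2 * n) 1 \<in> \<int>"
      using z1 by simp
    thus ?thesis
      using N half_integer_iff unfolding atypical_def half_ints_def c by auto
  next
    assume c: "c = 1/2"
    have "of_nat (h 0) + 1/2 = (of_nat (Suc (h 0)) - of_bool True / 2 :: rat)"
      by simp
    hence "z (2 * n) 1 \<notin> \<int>"
      using z1 of_nat_minus_half_in_Ints[of "Suc (h 0)" True] c by metis
    thus ?thesis
      using N half_integer_iff unfolding atypical_def c by auto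
  qed
  also have "\<dots> = (\<lambda>i. (i, row_len i)) ` {i \<in> {1..2 * n}. odd i \<and> z i (row_len i) - c \<notin> \<int>}"
  proof (intro equalityI subsetI)
    fix p
    assume "p \<in> {(i, j) \<in> positions (2 * n). z i j - c \<notin> \<int>}"
    then obtain i j where p: "p = (i, j)" "(i, j) \<in> positions (2 * n)" "z i j - c \<notin> \<int>"
      by blast
    hence "odd i \<and> j = row_len i"
      using E[OF p(2)] Nats_subset_Ints by (auto split: if_splits)
    thus "p \<in> (\<lambda>i. (i, row_len i)) ` {i \<in> {1..2 * n}. odd i \<and> z i (row_len i) - c \<notin> \<int>}"
      using p by (auto simp: positions_def)
  qed (auto simp: positions_def row_len_def elim!: oddE)
  finally show ?thesis .
qed

lemma scalar_power: "scalar (\<beta> ^ k) = (scalar \<beta> ^ k :: ('v, 'a::comm_ring_1) laurent)"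
proof (induction k)
  case (Suc k)
  have "scalar (\<beta> ^ Suc k) = (scalar \<beta> * scalar (\<beta> ^ k) :: ('v, 'a) laurent)"
    by (simp add: scalar_def mult_single)
  thus ?case
    using Suc by simp
qed (simp add: scalar_def)

lemma scalar_1 [simp]: "scalar 1 = (1 :: ('v, 'a::comm_ring_1) laurent)"
  by (simp add: scalar_def)

lemma prod_row_weight:
  "(\<Prod>i=1..2 * m. row_weight x \<beta> c i (z (i - 1)) (z i)) =
    scalar \<beta> ^ card {i \<in> {1..2 * m}. odd i \<and> z i (row_len i) - c \<notin> \<int>} *
    (\<Prod>i=1..m. var_pow (x ! (i - 1)) (row_type z (2 * i) - row_type z (2 * i - 1)) :: ('v, 'a::comm_ring_1) laurent)"
proof (induction m)
  case (Suc m)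
  let ?A = "\<lambda>m. {i \<in> {1..2 * m}. odd i \<and> z i (row_len i) - c \<notin> \<int>}"
  let ?b = "z (Suc (2 * m)) (row_len (Suc (2 * m))) - c \<notin> \<int>"
  have "?A (Suc m) = (if ?b then insert (Suc (2 * m)) (?A m) else ?A m)"
    by (auto simp: le_Suc_eq)
  hence card: "card (?A (Suc m)) = card (?A m) + of_bool ?b"
    by simp
  have type: "row_type z i = row_sum i (z i) - row_sum (i - 1) (z (i - 1))" for i
    by (simp add: row_type_def row_sum_def)
  have "row_weight x \<beta> c (Suc (2 * m)) (z (2 * m)) (z (Suc (2 * m))) *
      row_weight x \<beta> c (Suc (Suc (2 * m))) (z (Suc (2 * m))) (z (Suc (Suc (2 * m)))) =
      scalar \<beta> ^ of_bool ?b * (var_pow (x ! m) (- row_type z (Suc (2 * m))) *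
        var_pow (x ! m) (row_type z (Suc (Suc (2 * m)))) :: ('v, 'a) laurent)"
    by (simp add: row_weight_def type mult.assoc)
  also have "\<dots> = scalar \<beta> ^ of_bool ?b *
      var_pow (x ! m) (row_type z (Suc (Suc (2 * m))) - row_type z (Suc (2 * m)))"
    by (simp add: var_pow_add[symmetric])
  finally have *: "row_weight x \<beta> c (Suc (2 * m)) (z (2 * m)) (z (Suc (2 * m))) *
      row_weight x \<beta> c (Suc (Suc (2 * m))) (z (Suc (2 * m))) (z (Suc (Suc (2 * m)))) =
      (scalar \<beta> ^ of_bool ?b *
      var_pow (x ! m) (row_type z (Suc (Suc (2 * m))) - row_type z (Suc (2 * m))) :: ('v, 'a) laurent)" .
  have "(\<Prod>i=1..2 * Suc m. row_weight x \<beta> c i (z (i - 1)) (z i)) =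
      (\<Prod>i=1..2 * m. row_weight x \<beta> c i (z (i - 1)) (z i)) *
      (row_weight x \<beta> c (Suc (2 * m)) (z (2 * m)) (z (Suc (2 * m))) *
       row_weight x \<beta> c (Suc (Suc (2 * m))) (z (Suc (2 * m))) (z (Suc (Suc (2 * m)))) :: ('v, 'a) laurent)"
    by (simp add: mult.assoc)
  thus ?case
    unfolding Suc.IH * card by (simp add: power_add mult_ac)
qed simp

lemma weight_eq_prod:
  "scalar \<beta> ^ card {i \<in> {1..2 * length x}. odd i \<and> z i (row_len i) - c \<notin> \<int>} * weight x z =
    (\<Prod>i=1..2 * length x. row_weight x \<beta> c i (z (i - 1)) (z i))"
  unfolding prod_row_weight weight_def ..

lemma s_CB_eq_array_sum:
  assumes c: "c = 0 \<or> c = 1/2" and n: "1 \<le> length x"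
  shows "s_CB (list_of c (length x) h) x \<beta> =
    array_sum (row_set c UNIV) (row_weight x \<beta> c) (2 * length x) (row_of c (length x) h)"
  unfolding s_CB_def array_sum_def
proof (rule sum.cong)
  let ?n = "length x"
  show eq: "{z. split_orthogonal_pattern ?n z \<and> shape (2 * ?n) z = list_of c ?n h} =
      {z. z \<in> arrays (row_set c UNIV) (2 * ?n) \<and> z (2 * ?n) = row_of c ?n h}"
  proof (intro Collect_cong)
    fix z
    have "half_triangular (2 * ?n) z \<Longrightarrow> shape (2 * ?n) z = list_of c ?n h \<longleftrightarrow> z (2 * ?n) = row_of c ?n h"
      using shape_eq_iff[of "2 * ?n" z c h] n by simp
    thus "split_orthogonal_pattern ?n z \<and> shape (2 * ?n) z = list_of c ?n h \<longleftrightarrow>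
        z \<in> arrays (row_set c UNIV) (2 * ?n) \<and> z (2 * ?n) = row_of c ?n h"
      using split_orthogonal_pattern_iff[OF c n, of z h] arrays_row_set_iff[of z c UNIV "2 * ?n"]
      unfolding split_orthogonal_pattern_def by blast
  qed
  fix z
  assume "z \<in> {z. z \<in> arrays (row_set c UNIV) (2 * ?n) \<and> z (2 * ?n) = row_of c ?n h}"
  hence "atypical ?n z = (\<lambda>i. (i, row_len i)) ` {i \<in> {1..2 * ?n}. odd i \<and> z i (row_len i) - c \<notin> \<int>}"
    using c n by (intro atypical_eq) auto
  hence "card (atypical ?n z) = card {i \<in> {1..2 * ?n}. odd i \<and> z i (row_len i) - c \<notin> \<int>}"
    by (simp add: card_image inj_on_def)
  thus "scalar (\<beta> ^ card (atypical ?n z)) * weight x z =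
      (\<Prod>i=1..2 * ?n. row_weight x \<beta> c i (z (i - 1)) (z i))"
    by (simp only: scalar_power weight_eq_prod)
qed

lemma symplectic_patterns_eq:
  assumes "1 \<le> M"
  shows "{z. symplectic_pattern M z \<and> shape M z = list_of 0 (row_len M) h} =
    {z. z \<in> arrays (row_set 0 {False}) M \<and> z M = row_of 0 (row_len M) h}"
  using shape_eq_iff[OF _ assms] symplectic_pattern_iff unfolding symplectic_pattern_def by blast

lemma sp_even_eq_array_sum:
  fixes x :: "'v list"
  assumes n: "1 \<le> length x"
  shows "(sp_even (list_of 0 (length x) h) x :: ('v, 'a::comm_ring_1) laurent) =
    array_sum (row_set 0 {False}) (row_weight x 1 0) (2 * length x) (row_of 0 (length x) h)"
proof -
  have "1 \<le> 2 * length x"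
    using n by simp
  note * = symplectic_patterns_eq[OF this, of h, unfolded row_len_even]
  have "weight x z = (\<Prod>i=1..2 * length x. row_weight x 1 0 i (z (i - 1)) (z i) :: ('v, 'a) laurent)" for z
    using weight_eq_prod[of 1 x z 0] by simp
  thus ?thesis
    unfolding sp_even_def array_sum_def * by simp
qed

lemma end_factor_sp: "end_factor \<beta> 0 {False} v = (\<lambda>_. 1)"
proof
  fix s
  have "{b. adm 0 {False} (of_bool s) b} = {False}"
    by (auto simp: adm_def)
  thus "end_factor \<beta> 0 {False} v s = 1"
    by (simp add: end_factor_def)
qed

lemma end_factor_int:
  "end_factor \<beta> 0 UNIV v = (\<lambda>s. if s then 1 + scalar \<beta> * var_char v 1 else 1)"
proof
  fix s
  have "{b. adm 0 UNIV (of_bool s) b} = (if s then {False, True} else {False})"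
    by (auto simp: adm_def)
  thus "end_factor \<beta> 0 UNIV v s = (if s then 1 + scalar \<beta> * var_char v 1 else 1)"
    by (simp add: end_factor_def var_char_def)
qed

text \<open>An odd end lowered from \<open>a + 1/2\<close> is the natural number \<open>a\<close>,
  so both flags are always admissible and the factor does not depend on the row.\<close>

lemma end_factor_half:
  "end_factor \<beta> (1/2) UNIV v = (\<lambda>_. var_pow v (- 1/2) + scalar \<beta> * var_pow v (1/2))"
proof
  fix s
  have "{b. adm (1/2) UNIV (of_bool s) b} = {False, True}"
    by (auto simp: adm_def)
  thus "end_factor \<beta> (1/2) UNIV v s = var_pow v (- 1/2) + scalar \<beta> * var_pow v (1/2)"
    by (simp add: end_factor_def)
qed

lemma sp_even_eq_sp_pat:
  assumes "1 \<le> length x" "supp_le (length x) h"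
  shows "sp_even (list_of 0 (length x) h) x = sp_pat (rev (map var_char x)) h"
  using array_sum_even[of "length x" x h 0 "{False}" 1] assms
  by (simp add: sp_even_eq_array_sum sp_pat_def end_factor_sp rev_map comp_def)

lemma s_CB_eq_beta_pat:
  assumes "1 \<le> length x" "supp_le (length x) h"
  shows "s_CB (list_of 0 (length x) h) x \<beta> = beta_pat (scalar \<beta>) (rev (map var_char x)) h"
  using array_sum_even[of "length x" x h 0 UNIV \<beta>] assms
  by (simp add: s_CB_eq_array_sum beta_pat_def end_factor_int rev_map comp_def)

text \<open>Constant end factors pass through the linear strip operators, which reduces
  half-integral shapes to symplectic patterns.\<close>

lemma pat_const:
  "pat (map (\<lambda>v. (p v, \<lambda>_. c v)) vs) f = prod_list (map c vs) * sp_pat (map p vs) f"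
proof (induction vs arbitrary: f)
  case (Cons v vs)
  have "trunc (length vs) (pat (map (\<lambda>v. (p v, \<lambda>_. c v)) vs)) =
      (\<lambda>f. prod_list (map c vs) * trunc (length vs) (sp_pat (map p vs)) f)"
    using Cons by (auto simp: trunc_def)
  thus ?case
    by (simp add: sp_pat_Cons strip_op_scale mult.assoc)
qed (simp add: sp_pat_Nil)

definition half_factor :: "'a \<Rightarrow> 'v list \<Rightarrow> ('v, 'a::comm_ring_1) laurent" where
  "half_factor \<beta> x = (\<Prod>v\<leftarrow>rev x. var_pow v (- 1/2) + scalar \<beta> * var_pow v (1/2))"

lemma s_CB_eq_sp_pat:
  assumes "1 \<le> length x" "supp_le (length x) h"
  shows "s_CB (list_of (1/2) (length x) h) x \<beta> = half_factor \<beta> x * sp_pat (rev (map var_char x)) h"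
proof -
  have "s_CB (list_of (1/2) (length x) h) x \<beta> =
      pat (map (\<lambda>v. (var_char v, \<lambda>_. var_pow v (- 1/2) + scalar \<beta> * var_pow v (1/2))) (rev x)) h"
    using array_sum_even[of "length x" x h "1/2" UNIV \<beta>] assms
    by (simp add: s_CB_eq_array_sum end_factor_half rev_map)
  also have "\<dots> = half_factor \<beta> x * sp_pat (rev (map var_char x)) h"
    by (simp only: pat_const half_factor_def rev_map)
  finally show ?thesis .
qed

lemma sp_odd_eq_odd_pat:
  fixes x :: "'v list"
  assumes h: "supp_le (Suc (length x)) h"
  shows "(sp_odd (list_of 0 (Suc (length x)) h) x s :: ('v, 'a::comm_ring_1) laurent) =
    odd_pat (var_char s) (rev (map var_char x)) h"
proof -
  let ?n = "length x" and ?R = "row_set 0 {False}"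
  let ?ps = "rev (map var_char x) :: (int \<Rightarrow> ('v, 'a) laurent) list"
  \<comment> \<open>Only the last row carries \<open>s\<close>; below it the weights are those of
    the even case.\<close>
  define w :: "nat \<Rightarrow> (nat \<Rightarrow> rat) \<Rightarrow> (nat \<Rightarrow> rat) \<Rightarrow> ('v, 'a) laurent" where
    "w i q r = (if i = Suc (2 * ?n) then var_pow s (row_sum i r - row_sum (i - 1) q)
      else row_weight x 1 0 i q r)" for i q r
  \<comment> \<open>The last row has odd index, so the recursion wants it as an odd row, with the
    flag for a typical end.\<close>
  have odd_row: "row_of 0 (Suc ?n) h = odd_row_of 0 ?n False h"
    by (simp add: odd_row_of_def row_of_Suc fun_upd_idem)
  have "weight x z * var_pow s (row_type z (2 * ?n + 1)) =
      (\<Prod>i=1..Suc (2 * ?n). w i (z (i - 1)) (z i))" for z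
  proof -
    have "(weight x z :: ('v, 'a) laurent) = (\<Prod>i=1..2 * ?n. row_weight x 1 0 i (z (i - 1)) (z i))"
      using weight_eq_prod[of 1 x z 0] by simp
    also have "\<dots> = (\<Prod>i=1..2 * ?n. w i (z (i - 1)) (z i))"
      by (rule prod.cong) (auto simp: w_def)
    finally show ?thesis
      by (simp add: w_def row_type_def row_sum_def)
  qed
  hence "sp_odd (list_of 0 (Suc ?n) h) x s = array_sum ?R w (Suc (2 * ?n)) (odd_row_of 0 ?n False h)"
    unfolding sp_odd_def array_sum_def odd_row[symmetric]
    using symplectic_patterns_eq[of "Suc (2 * ?n)" h] by simp
  also have "\<dots> = (\<Sum>q\<in>row_of 0 ?n ` {f. interl f h \<and> supp_le ?n f}.
      w (Suc (2 * ?n)) q (odd_row_of 0 ?n False h) * array_sum ?R w (2 * ?n) q)"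
  proof -
    have "odd_row_of 0 ?n False h \<in> ?R (Suc (2 * ?n))"
      using h by (auto simp: row_set_odd adm_def)
    thus ?thesis
      using array_sum_Suc[where R = ?R and w = w, OF row_set_0 finite_row_set_below]
        row_set_even_below[OF h] by simp
  qed
  also have "\<dots> = (\<Sum>f | interl f h \<and> supp_le ?n f.
      w (Suc (2 * ?n)) (row_of 0 ?n f) (odd_row_of 0 ?n False h) * array_sum ?R w (2 * ?n) (row_of 0 ?n f))"
    by (subst sum.reindex) (auto intro: inj_on_subset[OF inj_on_row_of])
  also have "\<dots> = (\<Sum>f | interl f h \<and> supp_le ?n f. var_char s (wt h - wt f) * sp_pat ?ps f)"
  proof (rule sum.cong[OF refl])
    fix f assume "f \<in> {f. interl f h \<and> supp_le ?n f}"
    hence f: "supp_le ?n f"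
      by simp
    have "array_sum ?R w (2 * ?n) (row_of 0 ?n f) = array_sum ?R (row_weight x 1 0) (2 * ?n) (row_of 0 ?n f)"
      by (rule array_sum_cong) (simp add: w_def)
    also have "\<dots> = sp_pat ?ps f"
      using array_sum_even[of ?n x f 0 "{False}" 1] f
      by (simp add: sp_pat_def end_factor_sp rev_map comp_def)
    finally show "w (Suc (2 * ?n)) (row_of 0 ?n f) (odd_row_of 0 ?n False h) *
        array_sum ?R w (2 * ?n) (row_of 0 ?n f) = var_char s (wt h - wt f) * sp_pat ?ps f"
      using row_sum_even[OF f] row_sum_odd[OF h] by (simp add: w_def var_char_def[of s])
  qed
  finally show ?thesis
    by (simp add: odd_pat_def strip_op_trunc_sum[OF finsuppI[OF h]])
qed

lemma so_odd_eq_s_CB: "so_odd l x = s_CB l x 1"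
  by (simp add: so_odd_def s_CB_def)

section \<open>Lists of parts as rows\<close>

lemma nth_list_of: "j < k \<Longrightarrow> list_of c k f ! j = of_nat (f j) + c"
  by (simp add: list_of_def)

lemma parts_in_iff:
  assumes c: "c = 0 \<or> c = 1/2" and m: "1 \<le> m"
  shows "l \<in> parts_in (of_nat u + c) m \<longleftrightarrow> length l = m \<and> sorted_wrt (\<ge>) l \<and>
    (\<forall>a\<in>set l. a - c \<in> \<nat>) \<and> hd l \<le> of_nat u + c"
proof -
  have half: "of_nat a + 1/2 \<notin> (\<int> :: rat set)" "of_nat a - 1/2 \<notin> (\<int> :: rat set)" for a :: nat
    using of_nat_minus_half_in_Ints[of "Suc a" True] of_nat_minus_half_in_Ints[of a True] by simp_all
  have pos: "a - 1/2 \<in> \<int> \<and> 0 \<le> a \<longleftrightarrow> a - 1/2 \<in> \<nat>" for a :: rat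
  proof
    assume a: "a - 1/2 \<in> \<int> \<and> 0 \<le> a"
    then obtain k where k: "a - 1/2 = of_int k"
      by (auto elim: Ints_cases)
    \<comment> \<open>From \<open>0 \<le> a\<close> only \<open>k \<ge> -1/2\<close> follows;
      integrality of \<open>k\<close> then excludes negative values.\<close>
    hence "(of_int (- 1) :: rat) < of_int k"
      using a by simp
    hence "0 \<le> k"
      by (simp only: of_int_less_iff)
    thus "a - 1/2 \<in> \<nat>"
      using k by (simp add: Nats_altdef2)
  next
    assume "a - 1/2 \<in> \<nat>"
    thus "a - 1/2 \<in> \<int> \<and> 0 \<le> a"
      unfolding Nats_altdef2 by auto
  qed
  show ?thesis
    using c
  proof
    assume c: "c = 0"
    have "of_nat u + c \<in> \<int>" "of_nat u + c - 1/2 \<notin> \<int>"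
      using half(2)[of u] by (simp_all add: c)
    thus ?thesis
      using m unfolding parts_in_def partitions_def half_ints_def c by (auto simp: Nats_altdef2)
  next
    assume c: "c = 1/2"
    have "of_nat u + c \<notin> \<int>" "of_nat u + c - 1/2 \<in> \<int>"
      using half(1)[of u] by (simp_all add: c)
    thus ?thesis
      using m unfolding parts_in_def half_partitions_def half_ints_def c
      by (simp only: mem_Collect_eq pos) auto
  qed
qed

lemma list_of_rows_in:
  assumes c: "c = 0 \<or> c = 1/2" and m: "1 \<le> m"
  shows "parts_in (of_nat u + c) m = list_of c m ` rows_in m u"
proof (intro equalityI subsetI)
  fix l
  assume "l \<in> parts_in (of_nat u + c) m"
  hence l: "length l = m" "sorted_wrt (\<ge>) l" "\<forall>a\<in>set l. a - c \<in> \<nat>" "hd l \<le> of_nat u + c"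
    using parts_in_iff[OF c m] by auto
  have "\<forall>j. \<exists>a. j < m \<longrightarrow> l ! j = of_nat a + c"
  proof
    fix j
    have "\<exists>a. l ! j - c = of_nat a" if "j < m"
      using l(1,3) that by (metis Nats_cases nth_mem)
    thus "\<exists>a. j < m \<longrightarrow> l ! j = of_nat a + c"
      by (metis diff_add_cancel)
  qed
  then obtain a where a: "\<And>j. j < m \<Longrightarrow> l ! j = of_nat (a j) + c"
    by metis
  define f where "f j = (if j < m then a j else 0)" for j
  have "l = list_of c m f"
    using l(1) a by (intro nth_equalityI) (auto simp: nth_list_of f_def list_of_def)
  moreover have "antimono f"
  proof (rule antimonoI)
    fix i j :: nat
    assume "i \<le> j"
    show "f j \<le> f i"
    proof (cases "i < j \<and> j < m")
      case True
      hence "l ! j \<le> l ! i"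
        using l(1,2) sorted_wrt_nth_less by blast
      thus ?thesis
        using a True by (simp add: f_def)
    next
      case False
      thus ?thesis
        using \<open>i \<le> j\<close> by (auto simp: f_def)
    qed
  qed
  moreover have "f 0 \<le> u"
    using l(1,4) a[of 0] m by (cases l) (auto simp: f_def)
  ultimately show "l \<in> list_of c m ` rows_in m u"
    by (auto simp: rows_in_def supp_le_def f_def)
next
  fix l
  assume "l \<in> list_of c m ` rows_in m u"
  then obtain f where f: "l = list_of c m f" "antimono f" "f 0 \<le> u"
    by (auto simp: rows_in_def)
  have "sorted_wrt (\<ge>) l"
    using f(2) unfolding sorted_wrt_iff_nth_less f(1) by (auto simp: list_of_def antimono_def)
  moreover have "hd l \<le> of_nat u + c"
    using f m by (simp add: list_of_def hd_map)
  ultimately show "l \<in> parts_in (of_nat u + c) m"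
    using parts_in_iff[OF c m, of l u] by (auto simp: f(1) list_of_def)
qed

lemma sum_parts_in:
  assumes "c = 0 \<or> c = 1/2" and "1 \<le> m"
  shows "(\<Sum>l\<in>parts_in (of_nat u + c) m. F l) = (\<Sum>f\<in>rows_in m u. F (list_of c m f))"
proof -
  have "inj_on (list_of c m) (rows_in m u)"
  proof (rule inj_onI)
    fix f g
    assume fg: "f \<in> rows_in m u" "g \<in> rows_in m u" and eq: "list_of c m f = list_of c m g"
    show "f = g"
    proof
      fix j
      have "j < m \<Longrightarrow> of_nat (f j) + c = of_nat (g j) + c"
        using eq nth_list_of by metis
      thus "f j = g j"
        using fg by (cases "j < m") (auto simp: rows_in_def supp_le_def)
    qed
  qed
  thus ?thesis
    unfolding list_of_rows_in[OF assms] by (simp add: sum.reindex)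
qed

lemma replicate_append_list_of:
  "replicate a (of_nat u + c) @ list_of c m f = list_of c (a + m) (prepend a u f)"
  by (rule nth_equalityI) (auto simp: list_of_def nth_append prepend_def)

lemma replicate_eq_list_of: "replicate N (of_nat u + c) = list_of c N (prepend N u (\<lambda>_. 0))"
  using replicate_append_list_of[of N u c 0] by (simp add: list_of_def)

lemma supp_le_prepend_0: "supp_le N (prepend N u (\<lambda>_. 0))"
  by (simp add: supp_le_def prepend_def)

lemma supp_le_prepend_rows_in: "f \<in> rows_in m u \<Longrightarrow> supp_le (a + m) (prepend a u f)"
  by (simp add: supp_le_prepend rows_in_def)

section \<open>The identities for rectangular shapes\<close>

context
  fixes n m :: nat and x y :: "'v list"
  assumes m: "1 \<le> m" and mn: "m \<le> n" and len_x: "length x = n" and len_y: "length y = m"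
begin

text \<open>Shared by the symplectic identity and the half-integral case of \<open>s_CB\<close>. The
  cut delivers the part in \<open>y\<close> with its variables reversed, which
  \<open>sp_pat_rev\<close> repairs.\<close>

lemma sp_pat_rectangle:
  "(sp_pat (rev (map var_char (x @ y))) (prepend (n + m) u (\<lambda>_. 0)) :: ('v, 'a::comm_ring_1) laurent) =
    (\<Sum>f\<in>rows_in m u. sp_pat (rev (map var_char x)) (prepend (n - m) u f) * sp_pat (rev (map var_char y)) f)"
proof -
  let ?X = "map var_char x :: (int \<Rightarrow> ('v, 'a) laurent) list"
  let ?Y = "map var_char y :: (int \<Rightarrow> ('v, 'a) laurent) list"
  have Y: "\<forall>p\<in>set ?Y. additive_char p"
    by (auto simp: additive_char_var_char)
  have N: "n + m = n - m + 2 * length (rev ?Y)"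
    using mn len_y by simp
  have "sp_pat (rev ?Y @ rev ?X) (prepend (n + m) u (\<lambda>_. 0)) =
      (\<Sum>f\<in>rows_in m u. sp_pat ?Y f * sp_pat (rev ?X) (prepend (n - m) u f))"
    unfolding N using mn len_x len_y Y by (subst sp_pat_cut) auto
  also have "\<dots> = (\<Sum>f\<in>rows_in m u. sp_pat (rev ?X) (prepend (n - m) u f) * sp_pat (rev ?Y) f)"
    using len_y sp_pat_rev[OF Y]
    by (intro sum.cong refl) (auto simp: rows_in_def mult.commute)
  finally show ?thesis
    by simp
qed

lemma s_CB_rectangle_int:
  fixes \<beta> :: "'a::comm_ring_1"
  shows "s_CB (replicate (n + m) (of_nat u)) (x @ y) \<beta> =
    (\<Sum>l\<in>parts_in (of_nat u) m. s_CB (replicate (n - m) (of_nat u) @ l) x \<beta> * s_CB l y \<beta>)"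
proof -
  let ?X = "map var_char x :: (int \<Rightarrow> ('v, 'a) laurent) list"
  let ?Y = "map var_char y :: (int \<Rightarrow> ('v, 'a) laurent) list"
  have Y: "\<forall>p\<in>set ?Y. additive_char p"
    by (auto simp: additive_char_var_char)
  have N: "n + m = n - m + 2 * length (rev ?Y)"
    using mn len_y by simp
  have "s_CB (replicate (n + m) (of_nat u)) (x @ y) \<beta> =
      beta_pat (scalar \<beta>) (rev ?Y @ rev ?X) (prepend (n + m) u (\<lambda>_. 0))"
    using s_CB_eq_beta_pat[of "x @ y" "prepend (n + m) u (\<lambda>_. 0)" \<beta>] m len_x len_y
      replicate_eq_list_of[of "n + m" u 0] supp_le_prepend_0[of "n + m" u] by simp
  also have "\<dots> = (\<Sum>f\<in>rows_in m u. beta_pat (scalar \<beta>) ?Y f * beta_pat (scalar \<beta>) (rev ?X) (prepend (n - m) u f))"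
    unfolding N using mn len_x len_y Y by (subst beta_pat_cut) auto
  also have "\<dots> = (\<Sum>f\<in>rows_in m u.
      s_CB (replicate (n - m) (of_nat u) @ list_of 0 m f) x \<beta> * s_CB (list_of 0 m f) y \<beta>)"
  proof (rule sum.cong[OF refl])
    fix f assume f: "f \<in> rows_in m u"
    have "s_CB (list_of 0 m f) y \<beta> = beta_pat (scalar \<beta>) ?Y f"
      using s_CB_eq_beta_pat[of y f \<beta>] beta_pat_rev[OF Y, of f "scalar \<beta>"] f m len_y
      by (auto simp: rows_in_def)
    moreover have "s_CB (replicate (n - m) (of_nat u) @ list_of 0 m f) x \<beta> =
        beta_pat (scalar \<beta>) (rev ?X) (prepend (n - m) u f)"
      using s_CB_eq_beta_pat[of x "prepend (n - m) u f" \<beta>] m mn len_x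
        supp_le_prepend_rows_in[OF f, of "n - m"] replicate_append_list_of[of "n - m" u 0 m f] by simp
    ultimately show "beta_pat (scalar \<beta>) ?Y f * beta_pat (scalar \<beta>) (rev ?X) (prepend (n - m) u f) =
        s_CB (replicate (n - m) (of_nat u) @ list_of 0 m f) x \<beta> * s_CB (list_of 0 m f) y \<beta>"
      by (simp add: mult.commute)
  qed
  finally show ?thesis
    using m by (simp add: sum_parts_in[where c = 0, simplified])
qed

lemma s_CB_rectangle_half:
  fixes \<beta> :: "'a::comm_ring_1"
  shows "s_CB (replicate (n + m) (of_nat u + 1/2)) (x @ y) \<beta> =
    (\<Sum>l\<in>parts_in (of_nat u + 1/2) m. s_CB (replicate (n - m) (of_nat u + 1/2) @ l) x \<beta> * s_CB l y \<beta>)"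
proof -
  have "s_CB (replicate (n + m) (of_nat u + 1/2)) (x @ y) \<beta> = half_factor \<beta> (x @ y) *
      sp_pat (rev (map var_char (x @ y))) (prepend (n + m) u (\<lambda>_. 0))"
    using s_CB_eq_sp_pat[of "x @ y" "prepend (n + m) u (\<lambda>_. 0)" \<beta>] m len_x len_y
      replicate_eq_list_of[of "n + m" u "1/2"] supp_le_prepend_0[of "n + m" u] by simp
  also have "\<dots> = (\<Sum>f\<in>rows_in m u. half_factor \<beta> x * sp_pat (rev (map var_char x)) (prepend (n - m) u f) *
      (half_factor \<beta> y * sp_pat (rev (map var_char y)) f))"
    unfolding sp_pat_rectangle sum_distrib_left by (simp add: half_factor_def mult_ac)
  also have "\<dots> = (\<Sum>f\<in>rows_in m u.
      s_CB (replicate (n - m) (of_nat u + 1/2) @ list_of (1/2) m f) x \<beta> * s_CB (list_of (1/2) m f) y \<beta>)"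
  proof (rule sum.cong[OF refl])
    fix f assume f: "f \<in> rows_in m u"
    show "half_factor \<beta> x * sp_pat (rev (map var_char x)) (prepend (n - m) u f) *
        (half_factor \<beta> y * sp_pat (rev (map var_char y)) f) =
        s_CB (replicate (n - m) (of_nat u + 1/2) @ list_of (1/2) m f) x \<beta> * s_CB (list_of (1/2) m f) y \<beta>"
      using s_CB_eq_sp_pat[of y f \<beta>] s_CB_eq_sp_pat[of x "prepend (n - m) u f" \<beta>] f m mn len_x len_y
        supp_le_prepend_rows_in[OF f, of "n - m"] replicate_append_list_of[of "n - m" u "1/2" m f]
      by (simp add: rows_in_def)
  qed
  finally show ?thesis
    using m by (simp add: sum_parts_in[where c = "1/2", simplified])
qed

lemma sp_even_rectangle:
  "(sp_even (replicate (n + m) (of_nat u)) (x @ y) :: ('v, 'a::comm_ring_1) laurent) =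
    (\<Sum>l\<in>parts_in (of_nat u) m. sp_even (replicate (n - m) (of_nat u) @ l) x * sp_even l y)"
proof -
  have "(sp_even (replicate (n + m) (of_nat u)) (x @ y) :: ('v, 'a) laurent) =
      sp_pat (rev (map var_char (x @ y))) (prepend (n + m) u (\<lambda>_. 0))"
    using sp_even_eq_sp_pat[of "x @ y" "prepend (n + m) u (\<lambda>_. 0)"] m len_x len_y
      replicate_eq_list_of[of "n + m" u 0] supp_le_prepend_0[of "n + m" u] by simp
  also have "\<dots> = (\<Sum>f\<in>rows_in m u.
      sp_even (replicate (n - m) (of_nat u) @ list_of 0 m f) x * sp_even (list_of 0 m f) y)"
    unfolding sp_pat_rectangle
  proof (rule sum.cong[OF refl])
    fix f assume f: "f \<in> rows_in m u"
    have "(sp_even (list_of 0 m f) y :: ('v, 'a) laurent) = sp_pat (rev (map var_char y)) f"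
      using sp_even_eq_sp_pat[of y f] f m len_y by (simp add: rows_in_def)
    moreover have "(sp_even (replicate (n - m) (of_nat u) @ list_of 0 m f) x :: ('v, 'a) laurent) =
        sp_pat (rev (map var_char x)) (prepend (n - m) u f)"
      using sp_even_eq_sp_pat[of x "prepend (n - m) u f"] m mn len_x
        supp_le_prepend_rows_in[OF f, of "n - m"] replicate_append_list_of[of "n - m" u 0 m f] by simp
    ultimately show "sp_pat (rev (map var_char x)) (prepend (n - m) u f) * sp_pat (rev (map var_char y)) f =
        (sp_even (replicate (n - m) (of_nat u) @ list_of 0 m f) x * sp_even (list_of 0 m f) y :: ('v, 'a) laurent)"
      by simp
  qed
  finally show ?thesis
    using m by (simp add: sum_parts_in[where c = 0, simplified])
qed

lemma sp_odd_rectangle: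
  "(sp_even (replicate (n + m + 1) (of_nat u)) (x @ y @ [s]) :: ('v, 'a::comm_ring_1) laurent) =
    var_pow s (- of_nat u) *
    (\<Sum>l\<in>parts_in (of_nat u) (m + 1). sp_odd (replicate (n - m) (of_nat u) @ l) x s * sp_odd l y s)"
proof -
  let ?X = "map var_char x :: (int \<Rightarrow> ('v, 'a) laurent) list"
  let ?Y = "map var_char y :: (int \<Rightarrow> ('v, 'a) laurent) list"
  have Y: "\<forall>p\<in>set ?Y. additive_char p"
    by (auto simp: additive_char_var_char)
  let ?S = "var_char s :: int \<Rightarrow> ('v, 'a) laurent" and ?r = "prepend (n + m + 1) u (\<lambda>_. 0)"
  have N: "n + m + 1 = Suc (n - m) + 2 * length (rev ?Y)"
    using mn len_y by simp
  have r: "supp_le (n + m + 1) ?r"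
    by (rule supp_le_prepend_0)
  have "(sp_even (replicate (n + m + 1) (of_nat u)) (x @ y @ [s]) :: ('v, 'a) laurent) =
      sp_pat (?S # rev ?Y @ rev ?X) ?r"
    using sp_even_eq_sp_pat[of "x @ y @ [s]" ?r] len_x len_y
      replicate_eq_list_of[of "n + m + 1" u 0] r by simp
  also have "\<dots> = sp_pat (rev ?Y @ ?S # rev ?X) ?r"
    using r len_x len_y Y additive_char_var_char by (intro sp_pat_move) (auto simp: add.commute)
  \<comment> \<open>The cut inverts the character of \<open>s\<close> in both halves, so inverting
    it beforehand makes \<open>s\<close> itself appear. \<open>sp_pat_inv\<close> treats a head
    variable only, hence \<open>sp_pat_cong\<close> below the variables of \<open>y\<close>.\<close>
  also have "\<dots> = sp_pat (rev ?Y @ inv_char ?S # rev ?X) ?r"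
  proof (rule sp_pat_cong)
    fix f assume "supp_le (length (?S # rev ?X)) f"
    thus "sp_pat (?S # rev ?X) f = sp_pat (inv_char ?S # rev ?X) f"
      by (intro sp_pat_inv[symmetric] finsuppI)
  qed (use r len_x len_y in \<open>auto simp: add.commute\<close>)
  \<comment> \<open>The split-off factor \<open>p (int u)\<close>, taken at the inverted character,
    is the prefactor of exponent \<open>- u\<close>.\<close>
  also have "\<dots> = inv_char ?S (int u) * (\<Sum>f\<in>rows_in (Suc m) u.
      odd_pat ?S ?Y f * odd_pat ?S (rev ?X) (prepend (n - m) u f))"
    using sp_pat_cut_odd[of "rev ?Y" "inv_char ?S" "rev ?X" "n - m" u] mn len_x len_y Y
      additive_char_inv_char[of ?S] additive_char_var_char[of s]
    unfolding N by auto
  also have "\<dots> = var_pow s (- of_nat u) * (\<Sum>f\<in>rows_in (Suc m) u.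
      sp_odd (replicate (n - m) (of_nat u) @ list_of 0 (Suc m) f) x s * sp_odd (list_of 0 (Suc m) f) y s)"
  proof -
    have "odd_pat ?S ?Y f * odd_pat ?S (rev ?X) (prepend (n - m) u f) =
        sp_odd (replicate (n - m) (of_nat u) @ list_of 0 (Suc m) f) x s * sp_odd (list_of 0 (Suc m) f) y s"
      if f: "f \<in> rows_in (Suc m) u" for f
    proof -
      have "sp_odd (list_of 0 (Suc m) f) y s = odd_pat ?S (rev ?Y) f"
        using f sp_odd_eq_odd_pat[of y f s, where 'a = 'a] len_y by (simp add: rows_in_def)
      also have "\<dots> = odd_pat ?S ?Y f"
        by (rule odd_pat_rev[OF Y])
      finally have "sp_odd (list_of 0 (Suc m) f) y s = odd_pat ?S ?Y f" .
      moreover have "sp_odd (replicate (n - m) (of_nat u) @ list_of 0 (Suc m) f) x s =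
          odd_pat ?S (rev ?X) (prepend (n - m) u f)"
        using sp_odd_eq_odd_pat[of x "prepend (n - m) u f" s] mn len_x
          supp_le_prepend_rows_in[OF f, of "n - m"] replicate_append_list_of[of "n - m" u 0 "Suc m" f]
        by simp
      ultimately show ?thesis
        by (simp add: mult.commute)
    qed
    thus ?thesis
      by (simp add: var_char_def[of s])
  qed
  finally show ?thesis
    by (simp add: sum_parts_in[where c = 0, simplified])
qed

end

theorem theorem4p4:
  fixes n m :: nat
    and x y :: "'v list"
    and \<beta> :: "'a::comm_ring_1"
  assumes "1 \<le> m" and "m \<le> n"
    and "length x = n" and "length y = m"
    and "distinct (x @ y)"
  shows
    "(\<forall>u. 2 * u \<in> \<nat> \<longrightarrow>
        s_CB (replicate (n + m) u) (x @ y) \<beta> =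
          (\<Sum>l\<in>parts_in u m. s_CB (replicate (n - m) u @ l) x \<beta> * s_CB l y \<beta>)) \<and>
     (\<forall>u. u \<in> \<nat> \<longrightarrow>
        (sp_even (replicate (n + m) u) (x @ y) :: ('v, 'a) laurent) =
          (\<Sum>l\<in>parts_in u m. sp_even (replicate (n - m) u @ l) x * sp_even l y)) \<and>
     (\<forall>u. 2 * u \<in> \<nat> \<longrightarrow>
        (so_odd (replicate (n + m) u) (x @ y) :: ('v, 'a) laurent) =
          (\<Sum>l\<in>parts_in u m. so_odd (replicate (n - m) u @ l) x * so_odd l y)) \<and>
     (\<forall>u s. u \<in> \<nat> \<and> s \<notin> set (x @ y) \<longrightarrow>
        (sp_even (replicate (n + m + 1) u) (x @ y @ [s]) :: ('v, 'a) laurent) =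
          var_pow s (- u) *
          (\<Sum>l\<in>parts_in u (m + 1). sp_odd (replicate (n - m) u @ l) x s * sp_odd l y s))"
proof -
  have CB: "s_CB (replicate (n + m) u) (x @ y) \<gamma> =
      (\<Sum>l\<in>parts_in u m. s_CB (replicate (n - m) u @ l) x \<gamma> * s_CB l y \<gamma>)"
    if u: "2 * u \<in> \<nat>" for u and \<gamma> :: 'a
  proof -
    obtain k where k: "2 * u = of_nat k"
      using u by (metis Nats_cases)
    obtain d where "k = 2 * d \<or> k = Suc (2 * d)"
      by (metis evenE oddE Suc_eq_plus1)
    hence "u = of_nat d \<or> u = of_nat d + 1/2"
      using k by auto
    thus ?thesis
      using s_CB_rectangle_int[OF assms(1-4)] s_CB_rectangle_half[OF assms(1-4)] by blast
  qed
  show ?thesis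
    using CB sp_even_rectangle[OF assms(1-4)] sp_odd_rectangle[OF assms(1-4)]
    unfolding so_odd_eq_s_CB by (auto elim!: Nats_cases)
qed

end
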